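(* For every $K>0$ there is a constant $C=C(K)$ with the following property. Let $f:B_{10}\times\mathbb{R}\times\mathbb{R}^3\to(0,\infty)$ be a $C^2$ function and let $u$ be an admissible solution of $$\sigma_2(D^2u(x))=f(x,u(x),Du(x)),\qquad x\in B_{10}\subset\mathbb{R}^3,$$ with $\|f\|_{C^2}\le K$, $\|1/f\|_{L^\infty}\le K$ and $\|u\|_{C^1}\le K$. Let $y_0\in\overline{B_1}$ be a point with $\sigma_1(y_0)=\sup_{B_1}\sigma_1$. Then $$\sup_{B_1}\sigma_1=\sigma_1(y_0)\le C\int_{B_1(y_0)}\sigma_1(x)\,\bigl(\sigma_1 f-\sigma_3\bigr)(x)\,dx.$$
   Context: $B_r$ denotes the open ball of radius $r$ centered at the origin of $\mathbb{R}^3$ and $B_r(y)$ the open ball of radius $r$ centered at $y$. For a symmetric $3\times3$ matrix $A$, $\sigma_k(A)$ is the $k$-th elementary symmetric function of its eigenvalues. A solution $u$ is admissible if $u$ is smooth and at every point $D^2u\in\Gamma_2=\{A:\sigma_1(A)>0,\ \sigma_2(A)>0\}$. Write $\sigma_k(x)=\sigma_k(D^2u(x))$ (so $\sigma_1=\Delta u$), and in $\sigma_1 f-\sigma_3$ the function $f$ is evaluated at $(x,u(x),Du(x))$. The norms of $f$ and $1/f$ are sup norms over $B_{10}\times\mathbb{R}\times\mathbb{R}^3$ (for $f$, including derivatives up to order two in all variables), and $\|u\|_{C^1}=\sup_{B_{10}}(|u|+|Du|)$. *)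

theory Defs
  imports "HOL-Analysis.Analysis" "HOL-Computational_Algebra.Computational_Algebra"
begin

definition charpoly :: "real ^ 'n ^ 'n \<Rightarrow> real poly" where
  "charpoly A = det (mat [:0, 1:] - (\<chi> i j. [:A $ i $ j:]))"

text \<open>Real eigenvalues, repeated according to algebraic multiplicity. A symmetric
  \<open>n \<times> n\<close> matrix has exactly \<open>n\<close> of them.\<close>
definition eigvals :: "real ^ 'n ^ 'n \<Rightarrow> real list" where
  "eigvals A = sorted_list_of_multiset (proots (charpoly A))"

definition elem_sym :: "nat \<Rightarrow> real list \<Rightarrow> real" where
  "elem_sym k xs = (\<Sum>I | I \<subseteq> {..<length xs} \<and> card I = k. \<Prod>i\<in>I. xs ! i)"

definition sigma_k :: "nat \<Rightarrow> real ^ 'n ^ 'n \<Rightarrow> real" where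
  "sigma_k k A = elem_sym k (eigvals A)"

definition Gamma2 :: "(real ^ 3 ^ 3) set" where
  "Gamma2 = {A. transpose A = A \<and> sigma_k 1 A > 0 \<and> sigma_k 2 A > 0}"

definition dderiv :: "'a::real_normed_vector \<Rightarrow> ('a \<Rightarrow> real) \<Rightarrow> 'a \<Rightarrow> real" where
  "dderiv v g x = frechet_derivative g (at x) v"

definition grad :: "(real ^ 'n \<Rightarrow> real) \<Rightarrow> real ^ 'n \<Rightarrow> real ^ 'n" where
  "grad u x = (\<chi> i. dderiv (axis i 1) u x)"

definition hessian :: "(real ^ 'n \<Rightarrow> real) \<Rightarrow> real ^ 'n \<Rightarrow> real ^ 'n ^ 'n" where
  "hessian u x = (\<chi> i j. dderiv (axis i 1) (dderiv (axis j 1) u) x)"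

text \<open>The following notions are meant for open sets \<open>S\<close>; they then depend only on the
  restriction of \<open>g\<close> to \<open>S\<close>.\<close>

primrec Ck_on :: "nat \<Rightarrow> 'a::euclidean_space set \<Rightarrow> ('a \<Rightarrow> real) \<Rightarrow> bool" where
  "Ck_on 0 S g \<longleftrightarrow> continuous_on S g"
| "Ck_on (Suc k) S g \<longleftrightarrow> g differentiable_on S \<and> (\<forall>b\<in>Basis. Ck_on k S (dderiv b g))"

definition smooth_on :: "'a::euclidean_space set \<Rightarrow> ('a \<Rightarrow> real) \<Rightarrow> bool" where
  "smooth_on S g \<longleftrightarrow> (\<forall>k. Ck_on k S g)"

text \<open>The norms are extended-real valued, so that a bound by a real number includes
  finiteness.\<close>

definition sup_norm :: "'a set \<Rightarrow> ('a \<Rightarrow> real) \<Rightarrow> ereal" where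
  "sup_norm S g = (SUP x\<in>S. ereal \<bar>g x\<bar>)"

definition C1_norm :: "(real ^ 'n) set \<Rightarrow> (real ^ 'n \<Rightarrow> real) \<Rightarrow> ereal" where
  "C1_norm S u = (SUP x\<in>S. ereal (\<bar>u x\<bar> + norm (grad u x)))"

definition C2_norm :: "'a::euclidean_space set \<Rightarrow> ('a \<Rightarrow> real) \<Rightarrow> ereal" where
  "C2_norm S g = sup_norm S g
     + (\<Sum>b\<in>Basis. sup_norm S (dderiv b g))
     + (\<Sum>b\<in>Basis. \<Sum>c\<in>Basis. sup_norm S (dderiv b (dderiv c g)))"

definition admissible_on :: "(real ^ 3) set \<Rightarrow> (real ^ 3 \<Rightarrow> real) \<Rightarrow> bool" where
  "admissible_on S u \<longleftrightarrow> smooth_on S u \<and> (\<forall>x\<in>S. hessian u x \<in> Gamma2)"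

definition sigma2_solution_on ::
  "(real ^ 3) set \<Rightarrow> ((real ^ 3) \<times> real \<times> (real ^ 3) \<Rightarrow> real) \<Rightarrow> (real ^ 3 \<Rightarrow> real) \<Rightarrow> bool" where
  "sigma2_solution_on S f u \<longleftrightarrow> (\<forall>x\<in>S. sigma_k 2 (hessian u x) = f (x, u x, grad u x))"

end

theory Submission
  imports Defs
begin

text \<open>In dimension three, \<open>f + \<lambda>\<^sub>1\<^sup>2 = (\<lambda>\<^sub>1 + \<lambda>\<^sub>2)(\<lambda>\<^sub>1 + \<lambda>\<^sub>3)\<close> when \<open>\<sigma>\<^sub>2 = f\<close>. Hence the
  linearised operator \<open>L = \<Sum> F\<^sub>i\<^sub>j \<partial>\<^sub>i\<partial>\<^sub>j\<close> with \<open>F = \<sigma>\<^sub>1 I - D\<^sup>2u\<close> is \<open>V = \<sigma>\<^sub>1 f - \<sigma>\<^sub>3\<close> times the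
  Laplacian of the metric \<open>f dx\<^sup>2 + dp\<^sup>2\<close> on the graph of \<open>Du\<close>, whose volume density is \<open>V\<close>; it is also in
  divergence form. Differentiating the equation twice, a sharp bound on the third-order terms gives
  \<open>L \<sigma>\<^sub>1 \<ge> - C \<sigma>\<^sub>1 V\<close>. The squared distance \<open>2 \<rho> = f(y)|x - y|\<^sup>2 + |Du(x) - Du(y)|\<^sup>2\<close> behaves, up to
  relative errors of order \<open>\<surd>\<rho>\<close>, like the squared distance in Euclidean three-space:
  \<open>L \<rho> \<approx> 3 V\<close> and \<open>F(D\<rho>, D\<rho>) \<le> 2 \<rho> V\<close>. So a truncated and regularised version of the
  fundamental solution \<open>\<rho>\<^bsup>-1/2\<^esup>\<close> can be tested against \<open>\<sigma>\<^sub>1\<close>: its singular part bounds \<open>\<sigma>\<^sub>1(y)\<close>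
  from above by \<open>C \<integral> \<sigma>\<^sub>1 V\<close>, since the set where \<open>\<rho>\<close> is small has \<open>V\<close>-volume comparable to that of a
  Euclidean ball.\<close>

section \<open>Spectral theorem for symmetric matrices\<close>

text \<open>The ratio of the eigenvalues of the linearised operator is not controlled by K, so every
  error has to be measured against V. Two facts allow this: third derivatives of u enter L \<rho>
  only contracted with F, and this contraction is a first derivative of the right-hand side; and 2
  \<sigma>1 f \<le> 3 V, so a multiple of \<sigma>1 is always an admissible error. The third-order
  bound has little room: it rests on a Cauchy inequality with factor 1 - d, where d is bounded below
  only by a multiple of f / \<sigma>1^2. This gap just absorbs the terms linear in D \<sigma>1 that
  the dependence of f on Du creates, at the price of a multiple of \<sigma>1^2, hence of \<sigma>1
  V. The regularisation is never removed by a limit. Its parameter is e = 2 d^2, where d is now the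
  size of an ellipsoid around y on which Du is close to its linearisation. K does not control d, but
  the regularised kernel has a defect of order d^-3 on the ellipsoid, whose V-volume is of order
  d^3, so d cancels. The truncation error must therefore be bounded uniformly in e.\<close>

lemma self_adjoint_eigenvector:
  fixes f :: "'a::euclidean_space \<Rightarrow> 'a"
  assumes S: "subspace S" "S \<noteq> {0}" and f: "linear f" "f ` S \<subseteq> S"
    and adj: "\<And>x y. x \<bullet> f y = f x \<bullet> y"
  obtains v l where "v \<in> S" "norm v = 1" "f v = l *\<^sub>R v"
proof -
  let ?U = "S \<inter> sphere 0 1"
  obtain z where z: "z \<in> S" "z \<noteq> 0"
    using S subspace_0 by blast
  then have "z /\<^sub>R norm z \<in> ?U"
    using S by (simp add: subspace_scale)
  then have ne: "?U \<noteq> {}" by blast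
  have "compact ?U"
    using S(1) by (intro closed_Int_compact closed_subspace compact_sphere)
  moreover have contf: "continuous_on ?U (\<lambda>x. x \<bullet> f x)"
    using f by (intro continuous_intros linear_continuous_on) (simp add: linear_conv_bounded_linear)
  ultimately obtain v where v: "v \<in> ?U" and max: "\<And>x. x \<in> ?U \<Longrightarrow> x \<bullet> f x \<le> v \<bullet> f v"
    using continuous_attains_sup[of ?U "\<lambda>x. x \<bullet> f x"] ne by blast
  define l where "l = v \<bullet> f v"
  have vv: "v \<bullet> v = 1" using v by (simp add: dot_square_norm)
  have le: "x \<bullet> f x \<le> l * (x \<bullet> x)" if "x \<in> S" for x
  proof (cases "x = 0")
    case False
    then have "x /\<^sub>R norm x \<in> ?U" using S that by (simp add: subspace_scale)
    from max[OF this] have "(x \<bullet> f x) / (norm x)\<^sup>2 \<le> l"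
      using f(1) by (simp add: l_def linear_cmul power2_eq_square field_simps)
    then show ?thesis using False by (simp add: pos_divide_le_eq dot_square_norm)
  qed simp
  \<comment> \<open>The residual of the eigenvalue equation serves as direction of variation;
    invariance of \<open>S\<close> keeps it in \<open>S\<close>.\<close>
  define y where "y = l *\<^sub>R v - f v"
  have yS: "y \<in> S"
    using v f S unfolding y_def by (auto intro!: subspace_diff subspace_scale)
  have "y \<bullet> y = 0"
  proof (rule ccontr)
    assume "y \<bullet> y \<noteq> 0"
    then have yy: "y \<bullet> y > 0" by simp
    define c where "c = l * (y \<bullet> y) - y \<bullet> f y"
    have c: "c \<ge> 0" using le[OF yS] by (simp add: c_def)
    \<comment> \<open>The form \<open>x \<mapsto> l|x|\<^sup>2 - x \<bullet> f x\<close> is nonnegative on \<open>S\<close> and vanishes at \<open>v\<close>, so its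
      first variation at \<open>v\<close> in the direction \<open>y\<close> vanishes.\<close>
    have q: "0 \<le> 2 * t * (y \<bullet> y) + t\<^sup>2 * c" for t
    proof -
      have "v + t *\<^sub>R y \<in> S"
        using v yS S by (auto intro!: subspace_add subspace_scale)
      from le[OF this] have "0 \<le> l * ((v + t *\<^sub>R y) \<bullet> (v + t *\<^sub>R y)) - (v + t *\<^sub>R y) \<bullet> f (v + t *\<^sub>R y)"
        by simp
      also have "\<dots> = l * (v \<bullet> v) - v \<bullet> f v + 2 * t * (y \<bullet> (l *\<^sub>R v - f v)) + t\<^sup>2 * c"
        using adj[of v y] f(1)
        by (simp add: linear_add linear_cmul inner_add inner_diff c_def power2_eq_square algebra_simps inner_commute)
      also have "\<dots> = 2 * t * (y \<bullet> y) + t\<^sup>2 * c"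
        using vv by (simp add: l_def y_def)
      finally show ?thesis .
    qed
    \<comment> \<open>A negative \<open>t\<close> for which the quadratic in \<open>q\<close> equals
      \<open>t * (y \<bullet> y) - t\<^sup>2\<close>, hence is negative; the 1 in the denominator
      covers \<open>c = 0\<close>.\<close>
    define t where "t = - (y \<bullet> y) / (c + 1)"
    have "t * (c + 1) = - (y \<bullet> y)" using c by (simp add: t_def)
    then have "2 * t * (y \<bullet> y) + t\<^sup>2 * c = t * (y \<bullet> y) - t\<^sup>2"
      by (simp add: power2_eq_square) algebra
    moreover have "t < 0" using c yy by (simp add: t_def divide_neg_pos)
    moreover have "t * (y \<bullet> y) < 0" using yy \<open>t < 0\<close> by (simp add: mult_neg_pos)
    ultimately show False using q[of t] by (smt (verit) zero_le_power2)
  qed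
  then have "f v = l *\<^sub>R v" by (simp add: y_def)
  with v show ?thesis by (intro that) auto
qed

text \<open>Induction on the dimension: a unit eigenvector is split off, and self-adjointness makes
  its orthogonal complement in \<open>S\<close> invariant again.\<close>

lemma self_adjoint_orthonormal_eigenvectors:
  fixes f :: "'a::euclidean_space \<Rightarrow> 'a"
  assumes f: "linear f" and adj: "\<And>x y. x \<bullet> f y = f x \<bullet> y"
  shows "subspace S \<Longrightarrow> f ` S \<subseteq> S \<Longrightarrow> dim S = n \<Longrightarrow>
    \<exists>B\<subseteq>S. finite B \<and> card B = n \<and> pairwise orthogonal B \<and> (\<forall>b\<in>B. norm b = 1 \<and> (\<exists>l. f b = l *\<^sub>R b))"
proof (induction n arbitrary: S)
  case 0
  then show ?case by (intro exI[of _ "{}"]) auto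
next
  case (Suc n)
  then have "S \<noteq> {0}" by auto
  then obtain v l where v: "v \<in> S" "norm v = 1" "f v = l *\<^sub>R v"
    using self_adjoint_eigenvector[OF Suc.prems(1) _ f Suc.prems(2) adj] by blast
  let ?T = "{y \<in> S. \<forall>x\<in>span {v}. orthogonal x y}"
  have T_eq: "?T = {y \<in> S. orthogonal v y}"
    by (auto simp: span_singleton orthogonal_def)
  have "dim ?T + dim (span {v}) = dim S"
    using v Suc.prems(1) by (intro dim_subspace_orthogonal_to_vectors) (auto simp: span_minimal)
  moreover have "dim (span {v}) = 1"
    using v(2) by (subst dim_span) (auto simp: dim_singleton)
  ultimately have "dim ?T = n" using Suc.prems(3) by simp
  moreover have "subspace ?T"
    unfolding T_eq using Suc.prems(1)
    by (auto simp: subspace_def orthogonal_def inner_add_right)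
  moreover have "f ` ?T \<subseteq> ?T"
  proof -
    have "v \<bullet> f y = 0" if "v \<bullet> y = 0" for y
      using adj[of v y] v(3) that by simp
    then show ?thesis unfolding T_eq using Suc.prems(2) by (auto simp: orthogonal_def)
  qed
  ultimately obtain B where B: "B \<subseteq> ?T" "finite B" "card B = n" "pairwise orthogonal B"
      "\<forall>b\<in>B. norm b = 1 \<and> (\<exists>l. f b = l *\<^sub>R b)"
    using Suc.IH[of ?T] by blast
  have "v \<notin> B" using B(1) v(2) unfolding T_eq by (auto simp: orthogonal_def)
  moreover have "pairwise orthogonal (insert v B)"
    using B(1,4) unfolding T_eq by (auto simp: pairwise_insert orthogonal_commute)
  moreover have "insert v B \<subseteq> S" using B(1) v by auto
  ultimately show ?case
    using B v by (intro exI[of _ "insert v B"]) auto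
qed

text \<open>The columns of \<open>P\<close> are orthonormal eigenvectors. The spectral decomposition
  is stated entrywise because later computations manipulate index sums.\<close>

lemma symmetric_matrix_diagonalizable:
  fixes A :: "real ^ 'n ^ 'n"
  assumes "transpose A = A"
  obtains P :: "real ^ 'n ^ 'n" and l :: "'n \<Rightarrow> real" where "orthogonal_matrix P"
    "\<And>i j. A $ i $ j = (\<Sum>a\<in>UNIV. l a * P $ i $ a * P $ j $ a)"
proof -
  have adj: "x \<bullet> (A *v y) = (A *v x) \<bullet> y" for x y
    using assms by (metis dot_lmul_matrix vector_transpose_matrix)
  obtain B where B: "finite B" "card B = CARD('n)" "pairwise orthogonal B"
      "\<forall>b\<in>B. norm b = 1 \<and> (\<exists>l. A *v b = l *\<^sub>R b)"
    using self_adjoint_orthonormal_eigenvectors[OF matrix_vector_mul_linear adj subspace_UNIV _ refl]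
    by (auto simp: dim_UNIV)
  obtain e where e: "bij_betw e (UNIV::'n set) B"
    using B(1,2) by (metis finite_class.finite_UNIV bij_betw_iff_card)
  then have eB: "e a \<in> B" for a by (auto simp: bij_betw_def)
  have "\<exists>l. \<forall>a. A *v e a = l a *\<^sub>R e a"
    using B(4) eB by (intro choice) blast
  then obtain l where l: "\<And>a. A *v e a = l a *\<^sub>R e a" by blast
  have ee: "e a \<bullet> e b = (if a = b then 1 else 0)" for a b
  proof (cases "a = b")
    case True
    then show ?thesis using B(4) eB by (simp add: dot_square_norm)
  next
    case False
    then have "e a \<noteq> e b" using e by (auto simp: bij_betw_def inj_on_def)
    then show ?thesis using B(3) eB False by (auto simp: pairwise_def orthogonal_def)
  qed
  define P :: "real ^ 'n ^ 'n" where "P = (\<chi> i a. e a $ i)"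
  have PP: "transpose P ** P = mat 1"
    using ee by (simp add: vec_eq_iff matrix_matrix_mult_def transpose_def mat_def P_def inner_vec_def)
  then have P: "orthogonal_matrix P" by (simp add: orthogonal_matrix)
  have AP: "(A ** P) $ i $ a = l a * P $ i $ a" for i a
  proof -
    have "(A ** P) $ i $ a = (A *v e a) $ i"
      by (simp add: matrix_matrix_mult_def matrix_vector_mult_def P_def)
    then show ?thesis by (simp add: l P_def)
  qed
  have "A = (A ** P) ** transpose P"
    using P by (simp add: orthogonal_matrix_def flip: matrix_mul_assoc)
  then have "A $ i $ j = ((A ** P) ** transpose P) $ i $ j" for i j
    by (rule arg_cong)
  then have "A $ i $ j = (\<Sum>a\<in>UNIV. (A ** P) $ i $ a * P $ j $ a)" for i j
    by (simp only: matrix_matrix_mult_def[of "A ** P"] transpose_def vec_lambda_beta)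
  then show ?thesis using that[OF P, of l] AP by simp
qed

section \<open>The characteristic polynomial and the list of eigenvalues\<close>

lemma poly_det_3:
  fixes M :: "real poly ^ 3 ^ 3"
  shows "poly (det M) x = det (\<chi> i j. poly (M $ i $ j) x)"
  by (simp add: det_3)

lemma poly_charpoly_3:
  fixes A :: "real ^ 3 ^ 3"
  shows "poly (charpoly A) x = det (mat x - A)"
  unfolding charpoly_def poly_det_3
  by (rule arg_cong[where f = det]) (auto simp: vec_eq_iff mat_def)

lemma det_mat_minus_3:
  fixes A :: "real ^ 3 ^ 3"
  assumes "transpose A = A"
  shows "det (mat x - A) = x ^ 3 - trace A * x\<^sup>2
    + ((trace A)\<^sup>2 - (\<Sum>i\<in>UNIV. \<Sum>j\<in>UNIV. (A $ i $ j)\<^sup>2)) / 2 * x - det A"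
proof -
  have s: "A $ 2 $ 1 = A $ 1 $ 2" "A $ 3 $ 1 = A $ 1 $ 3" "A $ 3 $ 2 = A $ 2 $ 3"
    using assms by (auto simp: transpose_def vec_eq_iff)
  show ?thesis
    by (simp add: det_3 trace_def sum_3 mat_def s power2_eq_square power3_eq_cube field_simps)
qed

lemma det_orthogonal_conjugation:
  fixes P A :: "real ^ 'n ^ 'n"
  assumes "orthogonal_matrix P" and A: "\<And>i j. A $ i $ j = (\<Sum>a\<in>UNIV. l a * P $ i $ a * P $ j $ a)"
  shows "det A = (\<Prod>a\<in>UNIV. l a)"
proof -
  let ?D = "(\<chi> i j. if i = j then l i else 0) :: real ^ 'n ^ 'n"
  have PD: "(P ** ?D) $ i $ a = l a * P $ i $ a" for i a
    by (simp add: matrix_matrix_mult_def if_distrib cong: if_cong) 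
  have "A = P ** ?D ** transpose P"
    by (simp add: vec_eq_iff A matrix_matrix_mult_def[of "P ** ?D"] PD transpose_def)
  then have "det A = det P * det ?D * det P"
    by (simp add: det_mul)
  moreover have "det P * det P = 1"
    using det_orthogonal_matrix[OF assms(1)] by auto
  moreover have "det ?D = (\<Prod>a\<in>UNIV. l a)"
    by (subst det_diagonal) auto
  ultimately show ?thesis by (simp add: mult.assoc mult.commute mult.left_commute)
qed

lemma orthogonal_matrix_columns:
  fixes P :: "real ^ 'n ^ 'n"
  assumes "orthogonal_matrix P"
  shows "(\<Sum>i\<in>UNIV. P $ i $ a * P $ i $ b) = (if a = b then 1 else 0)"
proof -
  have "(transpose P ** P) $ a $ b = mat 1 $ a $ b"
    using assms by (simp add: orthogonal_matrix)
  then show ?thesis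
    by (simp only: matrix_matrix_mult_def transpose_def mat_def vec_lambda_beta)
qed

lemma orthogonal_matrix_rows:
  fixes P :: "real ^ 'n ^ 'n"
  assumes "orthogonal_matrix P"
  shows "(\<Sum>a\<in>UNIV. P $ i $ a * P $ j $ a) = (if i = j then 1 else 0)"
proof -
  have "(P ** transpose P) $ i $ j = mat 1 $ i $ j"
    using assms by (simp add: orthogonal_matrix_def)
  then show ?thesis
    by (simp only: matrix_matrix_mult_def transpose_def mat_def vec_lambda_beta)
qed

lemma prod_UNIV_3: "prod f (UNIV :: 3 set) = f 1 * f 2 * f 3"
  unfolding UNIV_3 by (simp add: ac_simps)

text \<open>The matrix \<open>P\<close> that diagonalises \<open>A\<close> also diagonalises
  \<open>mat x - A\<close>, with entries \<open>x - l a\<close>, so the determinant splits into real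
  linear factors.\<close>

lemma charpoly_symmetric_3_roots:
  fixes A :: "real ^ 3 ^ 3"
  assumes "transpose A = A"
  obtains a b c where "charpoly A = [:-a, 1:] * [:-b, 1:] * [:-c, 1:]"
proof -
  obtain P :: "real ^ 3 ^ 3" and l where P: "orthogonal_matrix P"
    and A: "\<And>i j. A $ i $ j = (\<Sum>a\<in>UNIV. l a * P $ i $ a * P $ j $ a)"
    using symmetric_matrix_diagonalizable[OF assms] by blast
  have "poly (charpoly A) x = poly ([:-l 1, 1:] * [:-l 2, 1:] * [:-l 3, 1:]) x" for x
  proof -
    have "mat x $ i $ j - A $ i $ j = (\<Sum>a\<in>UNIV. (x - l a) * P $ i $ a * P $ j $ a)" for i j
      using orthogonal_matrix_rows[OF P, of i j]
      by (simp add: A mat_def left_diff_distrib sum_subtractf mult.assoc flip: sum_distrib_left)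
    then have "det (mat x - A) = (\<Prod>a\<in>UNIV. x - l a)"
      by (intro det_orthogonal_conjugation[OF P]) simp
    then show ?thesis
      by (simp add: poly_charpoly_3 prod_UNIV_3 algebra_simps)
  qed
  then have "poly (charpoly A) = poly ([:-l 1, 1:] * [:-l 2, 1:] * [:-l 3, 1:])" by (rule ext)
  then have "charpoly A = [:-l 1, 1:] * [:-l 2, 1:] * [:-l 3, 1:]"
    by (simp only: poly_eq_poly_eq_iff)
  then show ?thesis by (rule that)
qed

lemma sum_Pow_insert:
  assumes "finite A" "a \<notin> A"
  shows "sum g (Pow (insert a A)) = sum g (Pow A) + (\<Sum>I\<in>Pow A. g (insert a I))"
proof -
  have "inj_on (insert a) (Pow A)"
    using assms by (auto simp: inj_on_def)
  moreover have "Pow A \<inter> insert a ` Pow A = {}"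
    using assms by auto
  ultimately show ?thesis
    using assms by (simp add: Pow_insert sum.union_disjoint sum.reindex)
qed

lemma elem_sym_length_3:
  fixes p q r :: real
  shows "elem_sym 1 [p, q, r] = p + q + r"
    and "elem_sym 2 [p, q, r] = p * q + p * r + q * r"
    and "elem_sym 3 [p, q, r] = p * q * r"
proof -
  have 3: "{..<length [p, q, r]} = {0, 1, 2::nat}" by auto
  have eq: "elem_sym k [p, q, r] = (\<Sum>I\<in>Pow {0, 1, 2}. if card I = k then \<Prod>i\<in>I. [p, q, r] ! i else 0)" for k
    unfolding elem_sym_def 3 by (subst sum.inter_filter[symmetric]) (auto intro!: sum.cong)
  show "elem_sym 1 [p, q, r] = p + q + r" "elem_sym 2 [p, q, r] = p * q + p * r + q * r"
    "elem_sym 3 [p, q, r] = p * q * r"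
    unfolding eq by (simp_all add: sum_Pow_insert)
qed

text \<open>Bridge from sorted root lists to polynomials in the entries: the list has three members
  whose linear factors multiply to \<open>charpoly A\<close>, and coefficients are compared through
  the values at 0, 1 and -1. Afterwards only \<open>trace\<close>, \<open>sig2\<close> and
  \<open>det\<close> are used.\<close>

lemma sigma_k_symmetric_3:
  fixes A :: "real ^ 3 ^ 3"
  assumes sym: "transpose A = A"
  shows "sigma_k 1 A = trace A"
    and "sigma_k 2 A = ((trace A)\<^sup>2 - (\<Sum>i\<in>UNIV. \<Sum>j\<in>UNIV. (A $ i $ j)\<^sup>2)) / 2"
    and "sigma_k 3 A = det A"
proof -
  obtain a b c where abc: "charpoly A = [:-a, 1:] * [:-b, 1:] * [:-c, 1:]"
    using charpoly_symmetric_3_roots[OF sym] .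
  have m: "mset (eigvals A) = {#a, b, c#}"
    unfolding eigvals_def abc by (simp add: proots_mult del: mult_pCons_left mult_pCons_right)
  then have "length (eigvals A) = 3"
    by (metis size_mset size_add_mset size_empty numeral_3_eq_3)
  then obtain p q r where pqr: "eigvals A = [p, q, r]"
    by (auto simp: numeral_3_eq_3 length_Suc_conv)
  have "(\<Prod>x\<in>#mset (eigvals A). [:-x, 1:]) = charpoly A"
    unfolding m abc by (simp add: mult.assoc del: mult_pCons_left mult_pCons_right)
  then have "charpoly A = [:-p, 1:] * [:-q, 1:] * [:-r, 1:]"
    unfolding pqr by (simp add: mult.assoc del: mult_pCons_left mult_pCons_right)
  then have ev: "(x - p) * (x - q) * (x - r) = det (mat x - A)" for x
    by (simp add: algebra_simps flip: poly_charpoly_3)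
  note ev' = ev[unfolded det_mat_minus_3[OF sym]]
  have "(x - p) * (x - q) * (x - r) = x ^ 3 - (p + q + r) * x\<^sup>2 + (p * q + p * r + q * r) * x - p * q * r" for x
    by (simp add: algebra_simps power2_eq_square power3_eq_cube)
  note ev'' = ev'[unfolded this]
  have "p * q * r = det A" "p + q + r = trace A"
    "p * q + p * r + q * r = ((trace A)\<^sup>2 - (\<Sum>i\<in>UNIV. \<Sum>j\<in>UNIV. (A $ i $ j)\<^sup>2)) / 2"
    using ev''[of 0, simplified] ev''[of 1, simplified] ev''[of "-1", simplified] by linarith+
  then show "sigma_k 1 A = trace A"
    "sigma_k 2 A = ((trace A)\<^sup>2 - (\<Sum>i\<in>UNIV. \<Sum>j\<in>UNIV. (A $ i $ j)\<^sup>2)) / 2"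
    "sigma_k 3 A = det A"
    by (simp_all only: sigma_k_def pqr elem_sym_length_3)
qed

section \<open>Algebra of the second elementary symmetric function\<close>

definition sig2 :: "real ^ 3 ^ 3 \<Rightarrow> real" where
  "sig2 A = ((trace A)\<^sup>2 - (\<Sum>i\<in>UNIV. \<Sum>j\<in>UNIV. (A $ i $ j)\<^sup>2)) / 2"

definition newton :: "real ^ 3 ^ 3 \<Rightarrow> 3 \<Rightarrow> 3 \<Rightarrow> real" where
  "newton A i j = (if i = j then trace A else 0) - A $ i $ j"

text \<open>Since \<open>f + \<lambda>\<^sub>1\<^sup>2 = (\<lambda>\<^sub>1 + \<lambda>\<^sub>2)(\<lambda>\<^sub>1 + \<lambda>\<^sub>3)\<close> for \<open>f = \<sigma>\<^sub>2\<close>, this is the volume density of the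
  metric \<open>f dx\<^sup>2 + dp\<^sup>2\<close> on the graph of the gradient, and \<open>newton A\<close> is this density times the inverse metric.\<close>
definition vol :: "real ^ 3 ^ 3 \<Rightarrow> real" where
  "vol A = trace A * sig2 A - det A"

text \<open>For orthogonal \<open>P\<close>, the coordinates of \<open>x\<close> in the basis of
  columns of \<open>P\<close>. Vectors are functions of an index here, so that a tensor can be
  rotated one slot at a time.\<close>

definition rot :: "real ^ 'n ^ 'n \<Rightarrow> ('n \<Rightarrow> real) \<Rightarrow> 'n \<Rightarrow> real" where
  "rot P x a = (\<Sum>i\<in>UNIV. P $ i $ a * x i)"

lemma rot_bilinear:
  "(\<Sum>a\<in>UNIV. l a * (rot P x a * rot P y a)) =
    (\<Sum>i\<in>UNIV. \<Sum>j\<in>UNIV. (\<Sum>a\<in>UNIV. l a * P $ i $ a * P $ j $ a) * x i * y j)"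
proof -
  have "(\<Sum>a\<in>UNIV. l a * (rot P x a * rot P y a)) =
      (\<Sum>a\<in>UNIV. \<Sum>i\<in>UNIV. \<Sum>j\<in>UNIV. l a * P $ i $ a * P $ j $ a * x i * y j)"
    unfolding rot_def sum_product unfolding sum_distrib_left by (intro sum.cong refl) (simp only: mult_ac)
  also have "\<dots> = (\<Sum>i\<in>UNIV. \<Sum>a\<in>UNIV. \<Sum>j\<in>UNIV. l a * P $ i $ a * P $ j $ a * x i * y j)"
    by (rule sum.swap)
  also have "\<dots> = (\<Sum>i\<in>UNIV. \<Sum>j\<in>UNIV. \<Sum>a\<in>UNIV. l a * P $ i $ a * P $ j $ a * x i * y j)"
    by (intro sum.cong sum.swap refl)
  finally show ?thesis
    by (simp add: sum_distrib_right)
qed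

lemma sum_delta_mult:
  fixes x :: "'n::finite \<Rightarrow> real"
  shows "(\<Sum>j\<in>UNIV. (if i = j then 1 else 0) * x j) = x i"
proof -
  have "(if i = j then 1 else 0) * x j = (if i = j then x j else 0)" for j by auto
  then show ?thesis by simp
qed

lemma rot_inner:
  assumes "orthogonal_matrix P"
  shows "(\<Sum>a\<in>UNIV. rot P x a * rot P y a) = (\<Sum>i\<in>UNIV. x i * y i)"
  using rot_bilinear[of "\<lambda>_. 1" P x y]
  by (simp add: orthogonal_matrix_rows[OF assms] sum_delta_mult mult.assoc)

lemma rot_trace:
  "(\<Sum>a\<in>UNIV. l a * rot P (\<lambda>i. rot P (M i) a) a) =
    (\<Sum>i\<in>UNIV. \<Sum>j\<in>UNIV. (\<Sum>a\<in>UNIV. l a * P $ i $ a * P $ j $ a) * M i j)"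
proof -
  have "(\<Sum>a\<in>UNIV. l a * rot P (\<lambda>i. rot P (M i) a) a) =
      (\<Sum>a\<in>UNIV. \<Sum>i\<in>UNIV. \<Sum>j\<in>UNIV. l a * P $ i $ a * P $ j $ a * M i j)"
    unfolding rot_def sum_distrib_left by (intro sum.cong refl) (simp only: mult_ac)
  also have "\<dots> = (\<Sum>i\<in>UNIV. \<Sum>a\<in>UNIV. \<Sum>j\<in>UNIV. l a * P $ i $ a * P $ j $ a * M i j)"
    by (rule sum.swap)
  also have "\<dots> = (\<Sum>i\<in>UNIV. \<Sum>j\<in>UNIV. \<Sum>a\<in>UNIV. l a * P $ i $ a * P $ j $ a * M i j)"
    by (intro sum.cong sum.swap refl)
  finally show ?thesis
    by (simp add: sum_distrib_right)
qed

lemma rot_sum: "rot P (\<lambda>k. \<Sum>j\<in>S. g j k) c = (\<Sum>j\<in>S. rot P (g j) c)"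
  unfolding rot_def sum_distrib_left by (rule sum.swap)

lemma rot_mult: "rot P (\<lambda>k. c * g k) a = c * rot P g a"
  unfolding rot_def sum_distrib_left by (simp only: mult_ac)

lemma rot_commute: "rot P (\<lambda>i. rot P (\<lambda>j. M i j) b) a = rot P (\<lambda>j. rot P (\<lambda>i. M i j) a) b"
  unfolding rot_def sum_distrib_left by (subst sum.swap) (simp only: mult_ac)

text \<open>The square of the trace is the sum of the squared eigenvalues plus 2
  \<open>sig2 A\<close>, so each \<open>l a\<close> is smaller than the trace in absolute value;
  this places the eigenvalues of \<open>newton A\<close> between 0 and twice the trace. The formula
  for \<open>vol A\<close> is the factorisation of \<open>vol A\<close> as (l1 + l2)(l1 + l3)(l2 +
  l3).\<close>

lemma Gamma2_diagonal:
  fixes A :: "real ^ 3 ^ 3"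
  assumes sym: "transpose A = A" and w: "trace A > 0" and f: "sig2 A > 0"
  obtains P :: "real ^ 3 ^ 3" and l :: "3 \<Rightarrow> real" where "orthogonal_matrix P"
    "\<And>i j. A $ i $ j = (\<Sum>a\<in>UNIV. l a * P $ i $ a * P $ j $ a)"
    "\<And>i j. newton A i j = (\<Sum>a\<in>UNIV. (trace A - l a) * P $ i $ a * P $ j $ a)"
    "\<And>a. 0 < trace A - l a" "\<And>a. trace A - l a < 2 * trace A"
    "trace A = l 1 + l 2 + l 3" "sig2 A = l 1 * l 2 + l 1 * l 3 + l 2 * l 3"
    "\<And>a. vol A = (trace A - l a) * (sig2 A + (l a)\<^sup>2)" "det A = l 1 * l 2 * l 3"
proof -
  obtain P :: "real ^ 3 ^ 3" and l where P: "orthogonal_matrix P"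
    and A: "\<And>i j. A $ i $ j = (\<Sum>a\<in>UNIV. l a * P $ i $ a * P $ j $ a)"
    using symmetric_matrix_diagonalizable[OF sym] by blast
  have N: "newton A i j = (\<Sum>a\<in>UNIV. (trace A - l a) * P $ i $ a * P $ j $ a)" for i j
    using orthogonal_matrix_rows[OF P, of i j]
    by (simp add: A newton_def left_diff_distrib sum_subtractf mult.assoc flip: sum_distrib_left)
  have "det (mat x - A) = (x - l 1) * (x - l 2) * (x - l 3)" for x
  proof -
    have "mat x $ i $ j - A $ i $ j = (\<Sum>a\<in>UNIV. (x - l a) * P $ i $ a * P $ j $ a)" for i j
      using orthogonal_matrix_rows[OF P, of i j]
      by (simp add: A mat_def left_diff_distrib sum_subtractf mult.assoc flip: sum_distrib_left)
    then have "det (mat x - A) = (\<Prod>a\<in>UNIV. x - l a)"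
      by (intro det_orthogonal_conjugation[OF P]) simp
    then show ?thesis by (simp add: prod_UNIV_3)
  qed
  then have "(x - l 1) * (x - l 2) * (x - l 3) = x ^ 3 - trace A * x\<^sup>2 + sig2 A * x - det A" for x
    using det_mat_minus_3[OF sym] by (simp add: sig2_def)
  moreover have "(x - l 1) * (x - l 2) * (x - l 3) = x ^ 3 - (l 1 + l 2 + l 3) * x\<^sup>2
      + (l 1 * l 2 + l 1 * l 3 + l 2 * l 3) * x - l 1 * l 2 * l 3" for x
    by (simp add: algebra_simps power2_eq_square power3_eq_cube)
  ultimately have eq: "x ^ 3 - (l 1 + l 2 + l 3) * x\<^sup>2
      + (l 1 * l 2 + l 1 * l 3 + l 2 * l 3) * x - l 1 * l 2 * l 3
      = x ^ 3 - trace A * x\<^sup>2 + sig2 A * x - det A" for x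
    by simp
  have w': "trace A = l 1 + l 2 + l 3" and f': "sig2 A = l 1 * l 2 + l 1 * l 3 + l 2 * l 3"
    and d': "det A = l 1 * l 2 * l 3"
    using eq[of 0, simplified] eq[of 1, simplified] eq[of "-1", simplified] by linarith+
  have ww: "(trace A)\<^sup>2 = (l 1)\<^sup>2 + (l 2)\<^sup>2 + (l 3)\<^sup>2 + 2 * sig2 A"
    unfolding w' f' by (simp add: power2_eq_square algebra_simps)
  have "(l a)\<^sup>2 < (trace A)\<^sup>2" for a
    using exhaust_3[of a] ww f zero_le_power2[of "l 1"] zero_le_power2[of "l 2"] zero_le_power2[of "l 3"] 
    by (elim disjE; simp only:; linarith)
  then have abs: "\<bar>l a\<bar> < trace A" for a
    using w abs_le_square_iff[of "trace A" "l a"] by (metis abs_of_pos not_le)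
  have V: "vol A = (trace A - l a) * (sig2 A + (l a)\<^sup>2)" for a
    using exhaust_3[of a] unfolding vol_def w' f' d'
    by (elim disjE) (simp_all add: power2_eq_square algebra_simps)
  show ?thesis
    using abs by (intro that[OF P A N _ _ w' f' V d']) (simp_all add: abs_less_iff)
qed

section \<open>The sharp bound on the third-order terms\<close>

text \<open>The \<open>F\<close>s are the eigenvalues of the Newton tensor and \<open>w\<close> is
  the trace; \<open>a\<close>, \<open>b\<close>, \<open>c\<close> are the third derivatives T k k k,
  T i i k, T j j k for one fixed k, \<open>g\<close> is the k-th derivative of the right-hand side
  and \<open>p\<close> a slope derivative of f. Plain Cauchy gives only t^2 \<le> 5/3 R. Subtracting
  a multiple of \<open>g\<close> from t lowers 5/3 to 1 - d with d > 0.\<close>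

lemma scalar_third_order_bound:
  fixes F1 F2 F3 f a b c g p w :: real
  assumes F: "F1 > 0" "F2 > 0" "F3 > 0" and f: "f > 0"
    and f4: "4 * f = 2 * (F1 * F2 + F1 * F3 + F2 * F3) - F1\<^sup>2 - F2\<^sup>2 - F3\<^sup>2"
    and w: "w = (F1 + F2 + F3) / 2" and g: "g = F1 * a + F2 * b + F3 * c"
  shows "a\<^sup>2 + 3 * b\<^sup>2 + 3 * c\<^sup>2 - (a + b + c)\<^sup>2 + p * (a + b + c)
    \<ge> - (30 / f) * g\<^sup>2 - (9 / 2 * w\<^sup>2 / f) * p\<^sup>2"
proof -
  define t where "t = a + b + c"
  define R where "R = a\<^sup>2 + 3 * b\<^sup>2 + 3 * c\<^sup>2"
  define P where "P = F1\<^sup>2 + (F2\<^sup>2 + F3\<^sup>2) / 3"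
  define L where "L = F1 + (F2 + F3) / 3"
  define s where "s = L / P"
  \<comment> \<open>\<open>e\<close> and \<open>d\<close> measure the gap below 1. The relation
    \<open>f4\<close> enters through the identity \<open>LP\<close>, and positivity of
    \<open>f\<close> makes the gap positive.\<close>
  define e where "e = 2 * w * F1 + f"
  define d where "d = 4 / 9 * e / P"
  have P: "P > 0" using F by (simp add: P_def add_pos_nonneg)
  have e: "e \<ge> f" "e > 0" using F f w by (auto simp: e_def add_pos_pos)
  have d0: "d > 0" using e P by (simp add: d_def)
  have LP: "L\<^sup>2 - 2 / 3 * P = 4 / 9 * e"
    using f4 by (simp add: L_def P_def e_def w power2_eq_square field_simps)
  \<comment> \<open>Cauchy's inequality for \<open>t - s g\<close>; the value of \<open>s\<close> minimises the second factor.\<close>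
  define x where "x = 1 - s * F1"
  define y where "y = 1 - s * F2"
  define z where "z = 1 - s * F3"
  have N: "x\<^sup>2 + y\<^sup>2 / 3 + z\<^sup>2 / 3 = 1 - d"
  proof -
    have "x\<^sup>2 + y\<^sup>2 / 3 + z\<^sup>2 / 3 = 5 / 3 - 2 * s * L + s\<^sup>2 * P"
      by (simp add: x_def y_def z_def L_def P_def power2_eq_square field_simps)
    also have "\<dots> = 5 / 3 - L\<^sup>2 / P"
      using P by (simp add: s_def power2_eq_square field_simps)
    also have "\<dots> = 1 - d"
      using P LP by (simp add: d_def field_simps)
    finally show ?thesis .
  qed
  have "(x * a + y * b + z * c)\<^sup>2 \<le> (x\<^sup>2 + y\<^sup>2 / 3 + z\<^sup>2 / 3) * R"
  proof -
    have "(x\<^sup>2 + y\<^sup>2 / 3 + z\<^sup>2 / 3) * R - (x * a + y * b + z * c)\<^sup>2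
        = (3 * x * b - y * a)\<^sup>2 / 3 + (3 * x * c - z * a)\<^sup>2 / 3 + (y * c - z * b)\<^sup>2"
      by (simp add: R_def power2_eq_square field_simps)
    then show ?thesis
      using zero_le_power2[of "3 * x * b - y * a"] zero_le_power2[of "3 * x * c - z * a"]
        zero_le_power2[of "y * c - z * b"] by linarith
  qed
  moreover have "x * a + y * b + z * c = t - s * g"
    by (simp add: x_def y_def z_def t_def g algebra_simps)
  ultimately have C: "(t - s * g)\<^sup>2 \<le> (1 - d) * R"
    using N by simp
  have d1: "d \<le> 1" using N by (smt (verit) zero_le_power2 divide_nonneg_pos)
  have R0: "R \<ge> 0" by (simp add: R_def)
  \<comment> \<open>Multiplying by \<open>1 + d\<close> turns the gap into a surplus
    \<open>d * t\<^sup>2\<close>: one half pays for the cross term with \<open>s * g\<close>, the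
    other half for \<open>p * t\<close>.\<close>
  have "(1 + d) * (t - s * g)\<^sup>2 \<le> (1 + d) * ((1 - d) * R)"
    using C d0 by (intro mult_left_mono) auto
  also have "\<dots> = R - d\<^sup>2 * R" by (simp add: power2_eq_square algebra_simps)
  also have "\<dots> \<le> R" using R0 by simp
  finally have C': "(1 + d) * (t - s * g)\<^sup>2 \<le> R" .
  have "0 \<le> (d * t - 2 * (1 + d) * (s * g))\<^sup>2 / (2 * d)"
    using d0 by simp
  also have "\<dots> = d / 2 * t\<^sup>2 - 2 * (1 + d) * t * (s * g) + 2 * (1 + d)\<^sup>2 * (s * g)\<^sup>2 / d"
    using d0 by (simp add: power2_eq_square field_simps)
  finally have B: "d / 2 * t\<^sup>2 - 2 * (1 + d) * t * (s * g) \<ge> - (2 * (1 + d)\<^sup>2 * (s * g)\<^sup>2 / d)"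
    by simp
  have "(1 + d)\<^sup>2 \<le> 2\<^sup>2"
    using d0 d1 by (intro power_mono) auto
  then have "2 * (1 + d)\<^sup>2 * (s * g)\<^sup>2 / d \<le> 8 * (s * g)\<^sup>2 / d"
    using d0 by (intro divide_right_mono mult_right_mono) auto
  also have "\<dots> = 8 * (s\<^sup>2 / d) * g\<^sup>2"
    by (simp add: power_mult_distrib)
  also have "\<dots> \<le> 8 * (15 / 4 / f) * g\<^sup>2"
  proof -
    \<comment> \<open>Origin of the constant 30: since L^2 / P = 2/3 + d is at most 5/3, this
      quotient is at most 15 / (4 f), and it is multiplied by 2 (1 + d)^2 \<le> 8.\<close>
    have "s\<^sup>2 / d = 9 / 4 * (L\<^sup>2 / P) / e"
      using P e by (simp add: s_def d_def power2_eq_square field_simps)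
    also have "L\<^sup>2 / P = 5 / 3 - (1 - d)"
      using LP P by (simp add: d_def field_simps)
    also have "9 / 4 * (5 / 3 - (1 - d)) / e \<le> 9 / 4 * (5 / 3) / f"
      using d0 d1 e f by (intro frac_le) auto
    finally have "s\<^sup>2 / d \<le> 15 / 4 / f" by simp
    then show ?thesis by (intro mult_right_mono) auto
  qed
  finally have B': "2 * (1 + d)\<^sup>2 * (s * g)\<^sup>2 / d \<le> 30 / f * g\<^sup>2" by simp
  have "0 \<le> (d * t + p)\<^sup>2 / (2 * d)"
    using d0 by simp
  also have "\<dots> = d / 2 * t\<^sup>2 + p * t + p\<^sup>2 / (2 * d)"
    using d0 by (simp add: power2_eq_square field_simps)
  finally have D: "d / 2 * t\<^sup>2 + p * t \<ge> - (p\<^sup>2 / (2 * d))" by simp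
  have "P \<le> (F1 + F2 + F3)\<^sup>2"
  proof -
    have "(F1 + F2 + F3)\<^sup>2 = P + 2 / 3 * F2\<^sup>2 + 2 / 3 * F3\<^sup>2 + 2 * (F1 * F2 + F1 * F3 + F2 * F3)"
      by (simp add: P_def power2_eq_square field_simps)
    moreover have "0 \<le> 2 / 3 * F2\<^sup>2 + 2 / 3 * F3\<^sup>2 + 2 * (F1 * F2 + F1 * F3 + F2 * F3)"
      using F by simp
    ultimately show ?thesis by simp
  qed
  then have P4: "P \<le> 4 * w\<^sup>2" by (simp add: w power_divide)
  have "p\<^sup>2 / (2 * d) = 9 / 8 * P / e * p\<^sup>2"
    using P e by (simp add: d_def field_simps)
  also have "\<dots> \<le> 9 / 8 * (4 * w\<^sup>2) / f * p\<^sup>2"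
    using P4 P e f by (intro mult_right_mono frac_le) auto
  finally have D': "p\<^sup>2 / (2 * d) \<le> 9 / 2 * w\<^sup>2 / f * p\<^sup>2" by simp
  have "(1 + d) * (t - s * g)\<^sup>2 = t\<^sup>2 + d * t\<^sup>2 - 2 * (1 + d) * t * (s * g) + (1 + d) * (s * g)\<^sup>2"
    by (simp add: power2_eq_square algebra_simps)
  moreover have "(1 + d) * (s * g)\<^sup>2 \<ge> 0" using d0 by simp
  moreover have "d * t\<^sup>2 = d / 2 * t\<^sup>2 + d / 2 * t\<^sup>2" by simp
  ultimately have "R - t\<^sup>2 + p * t \<ge> - (30 / f * g\<^sup>2) - (9 / 2 * w\<^sup>2 / f * p\<^sup>2)"
    using C' B B' D D' by linarith
  then show ?thesis by (simp add: R_def t_def)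
qed

text \<open>Each value of the last index c gives one instance of the scalar bound. By total symmetry
  an entry T b b c with b different from c occurs in three index orders, which is the weight 3; the
  squares with three distinct indices are dropped.\<close>

lemma diagonal_third_order_bound:
  fixes T :: "3 \<Rightarrow> 3 \<Rightarrow> 3 \<Rightarrow> real" and F p :: "3 \<Rightarrow> real" and f w :: real
  assumes F: "\<And>a. F a > 0" and f: "f > 0"
    and f4: "4 * f = 2 * (F 1 * F 2 + F 1 * F 3 + F 2 * F 3) - (F 1)\<^sup>2 - (F 2)\<^sup>2 - (F 3)\<^sup>2"
    and w: "w = (F 1 + F 2 + F 3) / 2"
    and T: "\<And>a b c. T a b c = T b a c" "\<And>a b c. T a b c = T a c b"
  shows "(\<Sum>a\<in>UNIV. \<Sum>b\<in>UNIV. \<Sum>c\<in>UNIV. (T a b c)\<^sup>2) - (\<Sum>c\<in>UNIV. (\<Sum>a\<in>UNIV. T a a c)\<^sup>2)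
      + (\<Sum>c\<in>UNIV. p c * (\<Sum>a\<in>UNIV. T a a c))
    \<ge> - (30 / f) * (\<Sum>c\<in>UNIV. (\<Sum>a\<in>UNIV. F a * T a a c)\<^sup>2) - (9 / 2 * w\<^sup>2 / f) * (\<Sum>c\<in>UNIV. (p c)\<^sup>2)"
proof -
  let ?B = "\<lambda>g c. - (30 / f) * g\<^sup>2 - (9 / 2 * w\<^sup>2 / f) * (p c)\<^sup>2"
  note s = T(1)[of 2 1 1] T(1)[of 3 1 1] T(1)[of 1 2 2] T(1)[of 3 2 2] T(1)[of 1 3 3] T(1)[of 2 3 3]
    T(2)[of 1 2 1] T(2)[of 1 3 1] T(2)[of 2 1 2] T(2)[of 2 3 2] T(2)[of 3 1 3] T(2)[of 3 2 3]
  have 1: "(T 1 1 1)\<^sup>2 + 3 * (T 2 2 1)\<^sup>2 + 3 * (T 3 3 1)\<^sup>2 - (T 1 1 1 + T 2 2 1 + T 3 3 1)\<^sup>2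
      + p 1 * (T 1 1 1 + T 2 2 1 + T 3 3 1) \<ge> ?B (F 1 * T 1 1 1 + F 2 * T 2 2 1 + F 3 * T 3 3 1) 1"
    by (rule scalar_third_order_bound[OF F F F f _ _ refl]) (use f4 w in auto)
  have 2: "(T 2 2 2)\<^sup>2 + 3 * (T 1 1 2)\<^sup>2 + 3 * (T 3 3 2)\<^sup>2 - (T 2 2 2 + T 1 1 2 + T 3 3 2)\<^sup>2
      + p 2 * (T 2 2 2 + T 1 1 2 + T 3 3 2) \<ge> ?B (F 2 * T 2 2 2 + F 1 * T 1 1 2 + F 3 * T 3 3 2) 2"
    by (rule scalar_third_order_bound[OF F F F f _ _ refl]) (use f4 w in auto)
  have 3: "(T 3 3 3)\<^sup>2 + 3 * (T 1 1 3)\<^sup>2 + 3 * (T 2 2 3)\<^sup>2 - (T 3 3 3 + T 1 1 3 + T 2 2 3)\<^sup>2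
      + p 3 * (T 3 3 3 + T 1 1 3 + T 2 2 3) \<ge> ?B (F 3 * T 3 3 3 + F 1 * T 1 1 3 + F 2 * T 2 2 3) 3"
    by (rule scalar_third_order_bound[OF F F F f _ _ refl]) (use f4 w in auto)
  have sq: "(\<Sum>a\<in>UNIV. \<Sum>b\<in>UNIV. \<Sum>c\<in>UNIV. (T a b c)\<^sup>2)
    = (T 1 1 1)\<^sup>2 + 3 * (T 2 2 1)\<^sup>2 + 3 * (T 3 3 1)\<^sup>2 + ((T 2 2 2)\<^sup>2 + 3 * (T 1 1 2)\<^sup>2 + 3 * (T 3 3 2)\<^sup>2)
      + ((T 3 3 3)\<^sup>2 + 3 * (T 1 1 3)\<^sup>2 + 3 * (T 2 2 3)\<^sup>2)
      + ((T 1 2 3)\<^sup>2 + (T 1 3 2)\<^sup>2 + (T 2 1 3)\<^sup>2 + (T 2 3 1)\<^sup>2 + (T 3 1 2)\<^sup>2 + (T 3 2 1)\<^sup>2)"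
    unfolding sum_3 s by simp
  have "(T 1 2 3)\<^sup>2 + (T 1 3 2)\<^sup>2 + (T 2 1 3)\<^sup>2 + (T 2 3 1)\<^sup>2 + (T 3 1 2)\<^sup>2 + (T 3 2 1)\<^sup>2 \<ge> 0"
    by simp
  moreover have "(30 / f) * (\<Sum>c\<in>UNIV. (\<Sum>a\<in>UNIV. F a * T a a c)\<^sup>2) =
      (30 / f) * (F 1 * T 1 1 1 + F 2 * T 2 2 1 + F 3 * T 3 3 1)\<^sup>2
      + (30 / f) * (F 2 * T 2 2 2 + F 1 * T 1 1 2 + F 3 * T 3 3 2)\<^sup>2
      + (30 / f) * (F 3 * T 3 3 3 + F 1 * T 1 1 3 + F 2 * T 2 2 3)\<^sup>2"
    unfolding sum_3 by (simp only: distrib_left add_ac)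
  moreover have "(9 / 2 * w\<^sup>2 / f) * (\<Sum>c\<in>UNIV. (p c)\<^sup>2) =
      (9 / 2 * w\<^sup>2 / f) * (p 1)\<^sup>2 + (9 / 2 * w\<^sup>2 / f) * (p 2)\<^sup>2 + (9 / 2 * w\<^sup>2 / f) * (p 3)\<^sup>2"
    unfolding sum_3 by (simp only: distrib_left)
  moreover have "(\<Sum>c\<in>UNIV. (\<Sum>a\<in>UNIV. T a a c)\<^sup>2) = (T 1 1 1 + T 2 2 1 + T 3 3 1)\<^sup>2
     + (T 2 2 2 + T 1 1 2 + T 3 3 2)\<^sup>2 + (T 3 3 3 + T 1 1 3 + T 2 2 3)\<^sup>2"
    unfolding sum_3 by (simp only: add_ac)
  moreover have "(\<Sum>c\<in>UNIV. p c * (\<Sum>a\<in>UNIV. T a a c)) = p 1 * (T 1 1 1 + T 2 2 1 + T 3 3 1)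
     + p 2 * (T 2 2 2 + T 1 1 2 + T 3 3 2) + p 3 * (T 3 3 3 + T 1 1 3 + T 2 2 3)"
    unfolding sum_3 by (simp only: add_ac)
  ultimately show ?thesis
    unfolding sq using 1 2 3 by linarith
qed

text \<open>All sums are invariant when the three slots of \<open>T\<close> are rotated together,
  and in the eigenbasis of \<open>A\<close> the contraction with \<open>newton A\<close> becomes a
  weighted diagonal sum, which is the previous case.\<close>

lemma third_order_bound:
  fixes A :: "real ^ 3 ^ 3" and T :: "3 \<Rightarrow> 3 \<Rightarrow> 3 \<Rightarrow> real" and p :: "3 \<Rightarrow> real"
  assumes A: "transpose A = A" "trace A > 0" "sig2 A > 0"
    and T: "\<And>i j k. T i j k = T j i k" "\<And>i j k. T i j k = T i k j"
  shows "(\<Sum>i\<in>UNIV. \<Sum>j\<in>UNIV. \<Sum>k\<in>UNIV. (T i j k)\<^sup>2) - (\<Sum>k\<in>UNIV. (\<Sum>i\<in>UNIV. T i i k)\<^sup>2)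
      + (\<Sum>k\<in>UNIV. p k * (\<Sum>i\<in>UNIV. T i i k))
    \<ge> - (30 / sig2 A) * (\<Sum>k\<in>UNIV. (\<Sum>i\<in>UNIV. \<Sum>j\<in>UNIV. newton A i j * T i j k)\<^sup>2)
      - (9 / 2 * (trace A)\<^sup>2 / sig2 A) * (\<Sum>k\<in>UNIV. (p k)\<^sup>2)"
proof -
  obtain P :: "real ^ 3 ^ 3" and l where P: "orthogonal_matrix P"
    and N: "\<And>i j. newton A i j = (\<Sum>a\<in>UNIV. (trace A - l a) * P $ i $ a * P $ j $ a)"
    and F: "\<And>a. 0 < trace A - l a"
    and w: "trace A = l 1 + l 2 + l 3" and f: "sig2 A = l 1 * l 2 + l 1 * l 3 + l 2 * l 3"
    by (rule Gamma2_diagonal[OF A], rule that; assumption)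
  define S where "S a b c = rot P (\<lambda>i. rot P (\<lambda>j. rot P (\<lambda>k. T i j k) c) b) a" for a b c
  have S1: "S a b c = S b a c" for a b c
  proof -
    have "S a b c = rot P (\<lambda>j. rot P (\<lambda>i. rot P (\<lambda>k. T i j k) c) a) b"
      unfolding S_def by (rule rot_commute)
    also have "\<dots> = S b a c"
      unfolding S_def by (simp only: T(1))
    finally show ?thesis .
  qed
  have S2: "S a b c = S a c b" for a b c
  proof -
    have "S a b c = rot P (\<lambda>i. rot P (\<lambda>k. rot P (\<lambda>j. T i j k) b) c) a"
      unfolding S_def by (simp only: rot_commute[of P _ b c])
    also have "\<dots> = S a c b"
      unfolding S_def by (simp only: T(2))
    finally show ?thesis .
  qed
  have sq: "(\<Sum>a\<in>UNIV. \<Sum>b\<in>UNIV. \<Sum>c\<in>UNIV. (S a b c)\<^sup>2) = (\<Sum>i\<in>UNIV. \<Sum>j\<in>UNIV. \<Sum>k\<in>UNIV. (T i j k)\<^sup>2)"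
  proof -
    have "(\<Sum>a\<in>UNIV. \<Sum>b\<in>UNIV. \<Sum>c\<in>UNIV. (S a b c)\<^sup>2) = (\<Sum>b\<in>UNIV. \<Sum>c\<in>UNIV. \<Sum>a\<in>UNIV. (S a b c)\<^sup>2)"
      by (subst sum.swap) (intro sum.cong refl sum.swap)
    also have "\<dots> = (\<Sum>b\<in>UNIV. \<Sum>c\<in>UNIV. \<Sum>i\<in>UNIV. (rot P (\<lambda>j. rot P (\<lambda>k. T i j k) c) b)\<^sup>2)"
      unfolding S_def power2_eq_square rot_inner[OF P] ..
    also have "\<dots> = (\<Sum>c\<in>UNIV. \<Sum>i\<in>UNIV. \<Sum>b\<in>UNIV. (rot P (\<lambda>j. rot P (\<lambda>k. T i j k) c) b)\<^sup>2)"
      by (subst sum.swap) (intro sum.cong refl sum.swap)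
    also have "\<dots> = (\<Sum>c\<in>UNIV. \<Sum>i\<in>UNIV. \<Sum>j\<in>UNIV. (rot P (\<lambda>k. T i j k) c)\<^sup>2)"
      unfolding power2_eq_square rot_inner[OF P] ..
    also have "\<dots> = (\<Sum>i\<in>UNIV. \<Sum>j\<in>UNIV. \<Sum>c\<in>UNIV. (rot P (\<lambda>k. T i j k) c)\<^sup>2)"
      by (subst sum.swap) (intro sum.cong refl sum.swap)
    finally show ?thesis
      unfolding power2_eq_square rot_inner[OF P] .
  qed
  have tr: "(\<Sum>a\<in>UNIV. m a * S a a c) =
      rot P (\<lambda>k. \<Sum>i\<in>UNIV. \<Sum>j\<in>UNIV. (\<Sum>a\<in>UNIV. m a * P $ i $ a * P $ j $ a) * T i j k) c" for m c
    unfolding S_def rot_trace rot_sum rot_mult ..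
  have t: "(\<Sum>a\<in>UNIV. S a a c) = rot P (\<lambda>k. \<Sum>i\<in>UNIV. T i i k) c" for c
    using tr[of "\<lambda>_. 1" c] by (simp add: orthogonal_matrix_rows[OF P] sum_delta_mult)
  have g: "(\<Sum>a\<in>UNIV. (trace A - l a) * S a a c) =
      rot P (\<lambda>k. \<Sum>i\<in>UNIV. \<Sum>j\<in>UNIV. newton A i j * T i j k) c" for c
    unfolding N by (rule tr)
  have *: "4 * sig2 A = 2 * ((trace A - l 1) * (trace A - l 2) + (trace A - l 1) * (trace A - l 3)
      + (trace A - l 2) * (trace A - l 3)) - (trace A - l 1)\<^sup>2 - (trace A - l 2)\<^sup>2 - (trace A - l 3)\<^sup>2"
    unfolding f w by (simp add: power2_eq_square algebra_simps)
  have "trace A = (trace A - l 1 + (trace A - l 2) + (trace A - l 3)) / 2"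
    unfolding w by simp
  from diagonal_third_order_bound[where F = "\<lambda>a. trace A - l a" and p = "rot P p" and T = S, OF F A(3) * this S1 S2]
  show ?thesis
    unfolding sq t g unfolding power2_eq_square rot_inner[OF P] .
qed

section \<open>The volume density and the linearised operator\<close>

lemma trace_squared: "(trace A)\<^sup>2 = (\<Sum>i\<in>UNIV. \<Sum>j\<in>UNIV. (A $ i $ j)\<^sup>2) + 2 * sig2 A"
  by (simp add: sig2_def field_simps)

lemma entry_le_trace:
  assumes "trace A > 0" "sig2 A \<ge> 0"
  shows "\<bar>A $ i $ j\<bar> \<le> trace A"
proof -
  have "(A $ i $ j)\<^sup>2 \<le> (\<Sum>j\<in>UNIV. (A $ i $ j)\<^sup>2)"
    by (rule member_le_sum) auto
  also have "\<dots> \<le> (\<Sum>i\<in>UNIV. \<Sum>j\<in>UNIV. (A $ i $ j)\<^sup>2)"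
    by (rule member_le_sum[where f = "\<lambda>i. \<Sum>j\<in>UNIV. (A $ i $ j)\<^sup>2"]) (auto intro: sum_nonneg)
  also have "\<dots> \<le> (trace A)\<^sup>2"
    using assms by (simp add: trace_squared)
  finally show ?thesis
    using assms by (simp add: abs_le_square_iff[symmetric])
qed

text \<open>Each eigenvalue of \<open>newton A\<close> times \<open>sig2 A\<close> is at most
  \<open>vol A\<close>, and the three eigenvalues add up to twice the trace.\<close>

lemma vol_lower_bound:
  assumes A: "transpose A = A" "trace A > 0" "sig2 A > 0"
  shows "2 * trace A * sig2 A \<le> 3 * vol A"
proof -
  obtain l :: "3 \<Rightarrow> real" where F: "\<And>a. 0 < trace A - l a" and w: "trace A = l 1 + l 2 + l 3"
    and V: "\<And>a. vol A = (trace A - l a) * (sig2 A + (l a)\<^sup>2)"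
    by (rule Gamma2_diagonal[OF A], rule that; assumption)
  have "(trace A - l a) * sig2 A \<le> vol A" for a
    unfolding V[of a] using F[of a] by (intro mult_left_mono) auto
  from add_mono[OF add_mono[OF this[of 1] this[of 2]] this[of 3]]
  have "(3 * trace A - (l 1 + l 2 + l 3)) * sig2 A \<le> 3 * vol A"
    by (simp add: algebra_simps)
  then show ?thesis by (simp add: w[symmetric])
qed

text \<open>In eigenvalues, (w - l) l^2 = \<open>vol A\<close> - (w - l) \<open>sig2 A\<close>,
  summed over the three eigenvalues l, with w the trace. Added to \<open>newton_trace\<close> for
  \<open>c = sig2 A\<close>, it leaves exactly 3 \<open>vol A\<close>, the main term of L
  \<rho>.\<close>

lemma newton_square:
  assumes "transpose A = A"
  shows "(\<Sum>i\<in>UNIV. \<Sum>j\<in>UNIV. newton A i j * (\<Sum>k\<in>UNIV. A $ i $ k * A $ j $ k))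
    = 3 * vol A - 2 * trace A * sig2 A"
proof -
  have s: "A $ 2 $ 1 = A $ 1 $ 2" "A $ 3 $ 1 = A $ 1 $ 3" "A $ 3 $ 2 = A $ 2 $ 3"
    using assms by (auto simp: transpose_def vec_eq_iff)
  show ?thesis
    unfolding sum_3 newton_def vol_def sig2_def trace_def det_3 s
    by (simp add: power2_eq_square field_simps)
qed

lemma newton_trace: "(\<Sum>i\<in>UNIV. \<Sum>j\<in>UNIV. newton A i j * (if i = j then c else 0)) = 2 * trace A * c"
  unfolding sum_3 newton_def by (simp add: trace_def sum_3 algebra_simps)

lemma newton_commute: "transpose A = A \<Longrightarrow> newton A i j = newton A j i"
  by (auto simp: newton_def transpose_def vec_eq_iff)

lemma rot_eigen:
  fixes P A :: "real ^ 'n ^ 'n"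
  assumes P: "orthogonal_matrix P" and A: "\<And>i j. A $ i $ j = (\<Sum>a\<in>UNIV. l a * P $ i $ a * P $ j $ a)"
  shows "rot P (\<lambda>i. \<Sum>k\<in>UNIV. A $ i $ k * q k) a = l a * rot P q a"
proof -
  have "rot P (\<lambda>i. \<Sum>k\<in>UNIV. A $ i $ k * q k) a
      = (\<Sum>i\<in>UNIV. P $ i $ a * (\<Sum>b\<in>UNIV. l b * P $ i $ b * rot P q b))"
  proof -
    have "(\<Sum>k\<in>UNIV. A $ i $ k * q k) = (\<Sum>b\<in>UNIV. l b * P $ i $ b * rot P q b)" for i
      unfolding A rot_def sum_distrib_left sum_distrib_right
      by (subst sum.swap) (simp only: mult_ac)
    then show ?thesis by (simp add: rot_def[of P _ a])
  qed
  also have "\<dots> = (\<Sum>b\<in>UNIV. (\<Sum>i\<in>UNIV. P $ i $ a * P $ i $ b) * (l b * rot P q b))"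
    unfolding sum_distrib_left sum_distrib_right by (subst sum.swap) (simp only: mult_ac)
  also have "\<dots> = l a * rot P q a"
    unfolding orthogonal_matrix_columns[OF P] sum_delta_mult ..
  finally show ?thesis .
qed

text \<open>Here \<open>x\<close> stands for the displacement, \<open>q\<close> for the slope
  difference, and \<open>y\<close> for the gradient of the squared distance. In the eigenbasis
  Cauchy's inequality produces the factor (w - l)(c + l^2); with \<open>sig2 A\<close> in place of
  \<open>c\<close> it would be \<open>vol A\<close>, whence the error term.\<close>

lemma newton_gradient_bound:
  fixes x q :: "3 \<Rightarrow> real"
  assumes A: "transpose A = A" "trace A > 0" "sig2 A > 0" and c: "c > 0"
  defines "y \<equiv> \<lambda>i. c * x i + (\<Sum>k\<in>UNIV. A $ i $ k * q k)"
  shows "(\<Sum>i\<in>UNIV. \<Sum>j\<in>UNIV. newton A i j * y i * y j)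
    \<le> (vol A + 2 * trace A * \<bar>c - sig2 A\<bar>) * (c * (\<Sum>i\<in>UNIV. (x i)\<^sup>2) + (\<Sum>i\<in>UNIV. (q i)\<^sup>2))"
proof -
  obtain P :: "real ^ 3 ^ 3" and l where P: "orthogonal_matrix P"
    and A': "\<And>i j. A $ i $ j = (\<Sum>a\<in>UNIV. l a * P $ i $ a * P $ j $ a)"
    and N: "\<And>i j. newton A i j = (\<Sum>a\<in>UNIV. (trace A - l a) * P $ i $ a * P $ j $ a)"
    and F: "\<And>a. 0 < trace A - l a" and F2: "\<And>a. trace A - l a < 2 * trace A"
    and V: "\<And>a. vol A = (trace A - l a) * (sig2 A + (l a)\<^sup>2)"
    by (rule Gamma2_diagonal[OF A], rule that; assumption)
  let ?M = "vol A + 2 * trace A * \<bar>c - sig2 A\<bar>"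
  have y: "rot P y a = c * rot P x a + l a * rot P q a" for a
  proof -
    have "rot P y a = rot P (\<lambda>i. c * x i) a + rot P (\<lambda>i. \<Sum>k\<in>UNIV. A $ i $ k * q k) a"
      by (simp add: y_def rot_def distrib_left sum.distrib)
    then show ?thesis by (simp add: rot_mult rot_eigen[OF P A'])
  qed
  have each: "(trace A - l a) * (rot P y a * rot P y a) \<le> ?M * (c * (rot P x a)\<^sup>2 + (rot P q a)\<^sup>2)" for a
  proof -
    have "(c + (l a)\<^sup>2) * (c * (rot P x a)\<^sup>2 + (rot P q a)\<^sup>2) - (rot P y a)\<^sup>2 = c * (rot P q a - l a * rot P x a)\<^sup>2"
      unfolding y by (simp add: power2_eq_square algebra_simps)
    then have "(rot P y a)\<^sup>2 \<le> (c + (l a)\<^sup>2) * (c * (rot P x a)\<^sup>2 + (rot P q a)\<^sup>2)"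
      using c by (smt (verit) mult_nonneg_nonneg zero_le_power2)
    then have "(trace A - l a) * (rot P y a * rot P y a) \<le>
        (trace A - l a) * ((c + (l a)\<^sup>2) * (c * (rot P x a)\<^sup>2 + (rot P q a)\<^sup>2))"
      using F[of a] by (intro mult_left_mono) (auto simp: power2_eq_square)
    also have "\<dots> = ((trace A - l a) * (c + (l a)\<^sup>2)) * (c * (rot P x a)\<^sup>2 + (rot P q a)\<^sup>2)"
      by simp
    also have "\<dots> \<le> ?M * (c * (rot P x a)\<^sup>2 + (rot P q a)\<^sup>2)"
    proof (rule mult_right_mono)
      have "(trace A - l a) * (c + (l a)\<^sup>2) = vol A + (trace A - l a) * (c - sig2 A)"
        unfolding V[of a] by (simp add: algebra_simps)
      also have "(trace A - l a) * (c - sig2 A) \<le> (trace A - l a) * \<bar>c - sig2 A\<bar>"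
        using F[of a] by (intro mult_left_mono) auto
      also have "\<dots> \<le> 2 * trace A * \<bar>c - sig2 A\<bar>"
        using F2[of a] by (intro mult_right_mono) auto
      finally show "(trace A - l a) * (c + (l a)\<^sup>2) \<le> ?M" by simp
    qed (use c in \<open>auto intro: add_nonneg_nonneg\<close>)
    finally show ?thesis .
  qed
  have "(\<Sum>i\<in>UNIV. \<Sum>j\<in>UNIV. newton A i j * y i * y j) = (\<Sum>a\<in>UNIV. (trace A - l a) * (rot P y a * rot P y a))"
    unfolding rot_bilinear N ..
  also have "\<dots> \<le> (\<Sum>a\<in>UNIV. ?M * (c * (rot P x a)\<^sup>2 + (rot P q a)\<^sup>2))"
    by (intro sum_mono each)
  also have "\<dots> = ?M * (c * (\<Sum>a\<in>UNIV. rot P x a * rot P x a) + (\<Sum>a\<in>UNIV. rot P q a * rot P q a))"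
    by (simp only: distrib_left sum.distrib sum_distrib_left power2_eq_square)
  finally show ?thesis
    unfolding rot_inner[OF P] by (simp only: power2_eq_square)
qed

text \<open>\<open>M\<close> maps Euclidean balls to balls of the metric at one point; its columns
  are eigenvectors scaled by (f + l^2)^(-1/2). The determinant follows by multiplying the three
  formulas for \<open>vol A\<close> and noting that \<open>vol A\<close> is also the product of the
  eigenvalues of \<open>newton A\<close>.\<close>

lemma metric_normalization:
  assumes A: "transpose A = A" "trace A > 0" "sig2 A > 0"
  obtains M :: "real ^ 3 ^ 3" where "\<bar>det M\<bar> = 1 / vol A"
    "\<And>x. sig2 A * (norm (M *v x))\<^sup>2 + (norm (A *v (M *v x)))\<^sup>2 = (norm x)\<^sup>2"
proof -
  obtain P :: "real ^ 3 ^ 3" and l where P: "orthogonal_matrix P"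
    and A': "\<And>i j. A $ i $ j = (\<Sum>a\<in>UNIV. l a * P $ i $ a * P $ j $ a)"
    and F: "\<And>a. 0 < trace A - l a"
    and w: "trace A = l 1 + l 2 + l 3" and f: "sig2 A = l 1 * l 2 + l 1 * l 3 + l 2 * l 3"
    and V: "\<And>a. vol A = (trace A - l a) * (sig2 A + (l a)\<^sup>2)"
    and d: "det A = l 1 * l 2 * l 3"
    by (rule Gamma2_diagonal[OF A], rule that; assumption)
  define m where "m a = 1 / sqrt (sig2 A + (l a)\<^sup>2)" for a
  have pos: "sig2 A + (l a)\<^sup>2 > 0" for a using A(3) by (simp add: add_pos_nonneg)
  have m2: "(m a)\<^sup>2 * (sig2 A + (l a)\<^sup>2) = 1" for a
    using pos[of a] by (simp add: m_def power_divide)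
  have m0: "m a > 0" for a using pos[of a] by (simp add: m_def)
  define M :: "real ^ 3 ^ 3" where "M = (\<chi> i a. P $ i $ a * m a)"
  have M: "(M *v x) $ i = (\<Sum>a\<in>UNIV. P $ i $ a * (m a * x $ a))" for x i
    by (simp add: M_def matrix_vector_mult_def mult_ac)
  have rM: "rot P (\<lambda>i. (M *v x) $ i) a = m a * x $ a" for x a
  proof -
    have "rot P (\<lambda>i. (M *v x) $ i) a = (\<Sum>b\<in>UNIV. (\<Sum>i\<in>UNIV. P $ i $ a * P $ i $ b) * (m b * x $ b))"
      unfolding rot_def M sum_distrib_left sum_distrib_right by (subst sum.swap) (simp only: mult_ac)
    then show ?thesis
      unfolding orthogonal_matrix_columns[OF P] sum_delta_mult .
  qed
  have n: "(norm v)\<^sup>2 = (\<Sum>a\<in>UNIV. (rot P (\<lambda>i. v $ i) a)\<^sup>2)" for v :: "real ^ 3"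
    unfolding power2_eq_square rot_inner[OF P] by (simp add: norm_vec_def L2_set_def sum_nonneg power2_eq_square)
  have rAM: "rot P (\<lambda>i. (A *v (M *v x)) $ i) a = l a * (m a * x $ a)" for x a
    using rot_eigen[OF P A', of "\<lambda>i. (M *v x) $ i" a] by (simp add: matrix_vector_mult_def[of A] rM)
  show ?thesis
  proof (rule that)
    show "sig2 A * (norm (M *v x))\<^sup>2 + (norm (A *v (M *v x)))\<^sup>2 = (norm x)\<^sup>2" for x
    proof -
      have "sig2 A * (norm (M *v x))\<^sup>2 + (norm (A *v (M *v x)))\<^sup>2
          = (\<Sum>a\<in>UNIV. ((m a)\<^sup>2 * (sig2 A + (l a)\<^sup>2)) * (x $ a)\<^sup>2)"
        unfolding n rM rAM by (simp add: sum_distrib_left sum.distrib[symmetric] power_mult_distrib algebra_simps)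
      then show ?thesis
        unfolding m2 by (simp add: norm_vec_def L2_set_def sum_nonneg)
    qed
    let ?D = "(\<chi> i j. if i = j then m i else 0) :: real ^ 3 ^ 3"
    have "M = P ** ?D"
      by (simp add: M_def vec_eq_iff matrix_matrix_mult_def if_distrib cong: if_cong)
    then have "det M = det P * (m 1 * m 2 * m 3)"
      by (simp add: det_mul det_diagonal prod_UNIV_3)
    then have dM: "\<bar>det M\<bar> = m 1 * m 2 * m 3"
      using det_orthogonal_matrix[OF P] m0[of 1] m0[of 2] m0[of 3] by (auto simp: abs_mult)
    have v: "vol A = (trace A - l 1) * (trace A - l 2) * (trace A - l 3)"
      unfolding vol_def w f d by (simp add: algebra_simps)
    have v0: "vol A > 0" unfolding v using F by simp
    have "vol A * ((sig2 A + (l 1)\<^sup>2) * (sig2 A + (l 2)\<^sup>2) * (sig2 A + (l 3)\<^sup>2))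
       = ((trace A - l 1) * (sig2 A + (l 1)\<^sup>2)) * ((trace A - l 2) * (sig2 A + (l 2)\<^sup>2)) * ((trace A - l 3) * (sig2 A + (l 3)\<^sup>2))"
      unfolding v by (simp only: mult_ac)
    also have "\<dots> = vol A * (vol A * vol A)"
      by (simp only: V[symmetric] mult_ac)
    finally have vv: "(sig2 A + (l 1)\<^sup>2) * (sig2 A + (l 2)\<^sup>2) * (sig2 A + (l 3)\<^sup>2) = (vol A)\<^sup>2"
      using v0 by (simp add: power2_eq_square)
    have "m 1 * m 2 * m 3 = 1 / sqrt ((sig2 A + (l 1)\<^sup>2) * (sig2 A + (l 2)\<^sup>2) * (sig2 A + (l 3)\<^sup>2))"
      by (simp add: m_def real_sqrt_mult)
    then show "\<bar>det M\<bar> = 1 / vol A"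
      unfolding dM vv using v0 by simp
  qed
qed

section \<open>Partial derivatives and the divergence theorem\<close>

lemma dderiv_along_line:
  assumes "g differentiable (at (x + s *\<^sub>R a))"
  shows "((\<lambda>s. g (x + s *\<^sub>R a)) has_real_derivative dderiv a g (x + s *\<^sub>R a)) (at s)"
proof -
  let ?D = "frechet_derivative g (at (x + s *\<^sub>R a))"
  have D: "(g has_derivative ?D) (at (x + s *\<^sub>R a))"
    using assms frechet_derivative_works by blast
  have "((\<lambda>s. g (x + s *\<^sub>R a)) has_derivative (\<lambda>h. ?D (h *\<^sub>R a))) (at s)"
    by (rule has_derivative_compose[where f = "\<lambda>s. x + s *\<^sub>R a", OF _ D]) (auto intro!: derivative_eq_intros)
  moreover have "?D (h *\<^sub>R a) = dderiv a g (x + s *\<^sub>R a) * h" for h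
    using D by (simp add: dderiv_def has_derivative_bounded_linear linear_simps)
  ultimately show ?thesis
    unfolding has_field_derivative_def by simp
qed

lemma second_difference:
  assumes S: "\<And>z. z \<in> ball x d \<Longrightarrow> g differentiable (at z)" "\<And>z. z \<in> ball x d \<Longrightarrow> dderiv a g differentiable (at z)"
    and t: "t > 0" "t * (norm a + norm b) < d"
  obtains z where "z \<in> ball x d"
    "g (x + t *\<^sub>R a + t *\<^sub>R b) - g (x + t *\<^sub>R a) - g (x + t *\<^sub>R b) + g x = t\<^sup>2 * dderiv b (dderiv a g) z"
proof -
  have ball: "x + s *\<^sub>R a + r *\<^sub>R b \<in> ball x d" if "0 \<le> s" "s \<le> t" "0 \<le> r" "r \<le> t" for s r
  proof -
    have "norm (s *\<^sub>R a + r *\<^sub>R b) \<le> s * norm a + r * norm b"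
      using that by (intro order_trans[OF norm_triangle_ineq]) simp
    also have "\<dots> \<le> t * norm a + t * norm b"
      using that by (intro add_mono mult_right_mono) auto
    also have "\<dots> < d" using t(2) by (simp add: distrib_left)
    finally show ?thesis by (simp add: dist_norm add_ac norm_minus_commute)
  qed
  let ?p = "\<lambda>s. g (x + s *\<^sub>R a + t *\<^sub>R b) - g (x + s *\<^sub>R a)"
  have "(?p has_real_derivative dderiv a g (x + s *\<^sub>R a + t *\<^sub>R b) - dderiv a g (x + s *\<^sub>R a)) (at s)"
    if "0 \<le> s" "s \<le> t" for s
  proof -
    have d: "g differentiable (at ((x + t *\<^sub>R b) + s *\<^sub>R a))" "g differentiable (at (x + s *\<^sub>R a))"
      using ball[OF that, of t] ball[OF that, of 0] t by (auto intro!: S(1) simp: add_ac)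
    from DERIV_diff[OF dderiv_along_line[OF d(1)] dderiv_along_line[OF d(2)]] show ?thesis
      by (simp add: add_ac)
  qed
  then obtain s where s: "0 < s" "s < t"
    and 1: "?p t - ?p 0 = (t - 0) * (dderiv a g (x + s *\<^sub>R a + t *\<^sub>R b) - dderiv a g (x + s *\<^sub>R a))"
    using MVT2[OF t(1), of ?p "\<lambda>s. dderiv a g (x + s *\<^sub>R a + t *\<^sub>R b) - dderiv a g (x + s *\<^sub>R a)"] by blast
  let ?q = "\<lambda>r. dderiv a g (x + s *\<^sub>R a + r *\<^sub>R b)"
  have "(?q has_real_derivative dderiv b (dderiv a g) (x + s *\<^sub>R a + r *\<^sub>R b)) (at r)"
    if "0 \<le> r" "r \<le> t" for r
    using ball[of s r] s that by (intro dderiv_along_line S(2)) auto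
  then obtain r where r: "0 < r" "r < t"
    and 2: "?q t - ?q 0 = (t - 0) * dderiv b (dderiv a g) (x + s *\<^sub>R a + r *\<^sub>R b)"
    using MVT2[OF t(1), of ?q "\<lambda>r. dderiv b (dderiv a g) (x + s *\<^sub>R a + r *\<^sub>R b)"] by blast
  show ?thesis
  proof (rule that)
    show "x + s *\<^sub>R a + r *\<^sub>R b \<in> ball x d"
      using s r by (intro ball) auto
    show "g (x + t *\<^sub>R a + t *\<^sub>R b) - g (x + t *\<^sub>R a) - g (x + t *\<^sub>R b) + g x
        = t\<^sup>2 * dderiv b (dderiv a g) (x + s *\<^sub>R a + r *\<^sub>R b)"
      using 1 2 by (simp add: power2_eq_square)
  qed
qed

text \<open>The second difference is symmetric in \<open>a\<close> and \<open>b\<close>, so the two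
  mixed derivatives share values at points arbitrarily near \<open>x\<close>; continuity then
  excludes a difference at \<open>x\<close>.\<close>

lemma dderiv_commute:
  assumes S: "open S" "x \<in> S" and g: "\<And>z. z \<in> S \<Longrightarrow> g differentiable (at z)"
    "\<And>z. z \<in> S \<Longrightarrow> dderiv a g differentiable (at z)" "\<And>z. z \<in> S \<Longrightarrow> dderiv b g differentiable (at z)"
    and cont: "continuous_on S (dderiv b (dderiv a g))" "continuous_on S (dderiv a (dderiv b g))"
  shows "dderiv b (dderiv a g) x = dderiv a (dderiv b g) x"
proof (rule ccontr)
  let ?u = "dderiv b (dderiv a g)" and ?v = "dderiv a (dderiv b g)"
  assume ne: "?u x \<noteq> ?v x"
  define e where "e = \<bar>?u x - ?v x\<bar> / 2"
  have e: "e > 0" using ne by (simp add: e_def)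
  obtain d0 where d0: "d0 > 0" "ball x d0 \<subseteq> S" using S openE by blast
  have "continuous (at x) ?u" "continuous (at x) ?v"
    using cont S continuous_on_eq_continuous_at by blast+
  then have "\<exists>d>0. \<forall>z. dist z x < d \<longrightarrow> dist (?u z) (?u x) < e" "\<exists>d>0. \<forall>z. dist z x < d \<longrightarrow> dist (?v z) (?v x) < e"
    using e unfolding continuous_at_eps_delta by blast+
  then obtain d1 d2 where d12: "d1 > 0" "d2 > 0" "\<And>z. dist z x < d1 \<Longrightarrow> dist (?u z) (?u x) < e"
      "\<And>z. dist z x < d2 \<Longrightarrow> dist (?v z) (?v x) < e"
    by blast
  define d where "d = min d0 (min d1 d2)"
  have d: "d > 0" using d0 d12 by (simp add: d_def)
  define t where "t = d / (norm a + norm b + 1)"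
  have "norm a + norm b + 1 > 0" by (simp add: add_nonneg_pos)
  then have t: "t > 0" "t * (norm a + norm b) < d"
    using d by (auto simp: t_def field_simps)
  have ball: "ball x d \<subseteq> S" using d0 by (auto simp: d_def)
  obtain z where z: "z \<in> ball x d"
    "g (x + t *\<^sub>R a + t *\<^sub>R b) - g (x + t *\<^sub>R a) - g (x + t *\<^sub>R b) + g x = t\<^sup>2 * ?u z"
    by (rule second_difference[of x d g a t b]) (use g ball t in auto)
  obtain z' where z': "z' \<in> ball x d"
    "g (x + t *\<^sub>R b + t *\<^sub>R a) - g (x + t *\<^sub>R b) - g (x + t *\<^sub>R a) + g x = t\<^sup>2 * ?v z'"
    by (rule second_difference[of x d g b t a]) (use g ball t in \<open>auto simp: add.commute\<close>)
  have "t\<^sup>2 * ?u z = t\<^sup>2 * ?v z'"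
    using z(2) z'(2) unfolding add.assoc[of x] add.commute[of "t *\<^sub>R b"] by linarith
  then have "?u z = ?v z'" using t by simp
  moreover have "dist (?u z) (?u x) < e" "dist (?v z') (?v x) < e"
    using z(1) z'(1) by (auto intro!: d12(3,4) simp: d_def dist_commute[of _ x])
  ultimately show False
    by (auto simp: e_def dist_real_def abs_if split: if_splits)
qed

text \<open>Translation invariance makes the integral of every difference quotient vanish, and
  dominated convergence passes this on to the derivative.\<close>

lemma integral_directional_derivative_zero:
  fixes h D :: "'a::euclidean_space \<Rightarrow> real"
  assumes der: "\<And>x. ((\<lambda>t. h (x + t *\<^sub>R e)) has_real_derivative D x) (at 0)"
    and cont: "continuous_on UNIV h" "continuous_on UNIV D"
    and supp: "\<And>x. x \<notin> cball y R \<Longrightarrow> h x = 0"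
  shows "integrable lborel D" "integral\<^sup>L lborel D = 0"
proof -
  have D0: "D x = 0" if "x \<notin> cball y R" for x
  proof -
    have "open (- cball y R)" by auto
    moreover have "continuous (at 0) (\<lambda>t. x + t *\<^sub>R e)" by (intro continuous_intros)
    ultimately have "eventually (\<lambda>t. x + t *\<^sub>R e \<in> - cball y R) (nhds 0)"
      using that unfolding continuous_at_open eventually_nhds by fastforce
    then have "eventually (\<lambda>t. h (x + t *\<^sub>R e) = 0) (nhds 0)"
      by eventually_elim (use supp in auto)
    then have "((\<lambda>t. h (x + t *\<^sub>R e)) has_real_derivative 0) (at 0) = ((\<lambda>t. 0) has_real_derivative 0) (at 0)"
      by (intro DERIV_cong_ev) auto
    then show ?thesis using der[of x] DERIV_unique by fastforce
  qed
  have derx: "((\<lambda>t. h (x + t *\<^sub>R e)) has_real_derivative D (x + s *\<^sub>R e)) (at s)" for x s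
    using der[of "x + s *\<^sub>R e"] DERIV_shift[of "\<lambda>t. h (x + t *\<^sub>R e)" "D (x + s *\<^sub>R e)" 0 s]
    by (simp add: algebra_simps)
  have int: "integrable lborel f" if "continuous_on UNIV f" "\<And>x. x \<notin> cball y R \<Longrightarrow> f x = 0" for f :: "'a \<Rightarrow> real"
  proof -
    have "f = (\<lambda>x. indicator (cball y R) x *\<^sub>R f x)"
      using that(2) by (auto simp: fun_eq_iff indicator_def)
    moreover have "integrable lborel (\<lambda>x. indicator (cball y R) x *\<^sub>R f x)"
      using that(1) by (intro borel_integrable_compact) (auto intro: continuous_on_subset)
    ultimately show ?thesis by simp
  qed
  show intD: "integrable lborel D" by (rule int[OF cont(2) D0])
  have inth: "integrable lborel h" by (rule int[OF cont(1) supp])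
  have [measurable]: "h \<in> borel_measurable borel" "D \<in> borel_measurable borel"
    using cont by (auto intro: borel_measurable_continuous_onI)
  have "bounded (D ` cball y R)"
    by (intro compact_imp_bounded compact_continuous_image continuous_on_subset[OF cont(2)]) auto
  then obtain M where "M > 0" "\<forall>v\<in>D ` cball y R. norm v \<le> M"
    unfolding bounded_pos by blast
  then have M: "\<And>x. x \<in> cball y R \<Longrightarrow> \<bar>D x\<bar> \<le> M" "M > 0" by auto
  define d where "d n = inverse (real (Suc n))" for n
  have d: "d n > 0" "d n \<le> 1" for n by (auto simp: d_def inverse_le_1_iff)
  define k where "k n x = (h (d n *\<^sub>R e + x) - h x) / d n" for n x
  have int_shift: "integrable lborel (\<lambda>x. h (c + x))" "(LINT x|lborel. h (c + x)) = integral\<^sup>L lborel h" for c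
    using integrable_distr_eq[of "(+) c" lborel borel h] integral_distr[of "(+) c" lborel borel h] inth
    by (simp_all add: lborel_distr_plus)
  have kint: "integral\<^sup>L lborel (k n) = 0" for n
    unfolding k_def using int_shift inth by simp
  \<comment> \<open>By the mean value theorem the quotient is a value of \<open>D\<close> at a point
    shifted by at most \<open>norm e\<close>, as \<open>d n \<le> 1\<close>; hence the enlarged
    ball.\<close>
  have bound: "\<bar>k n x\<bar> \<le> M * indicator (cball y (R + norm e)) x" for n x
  proof -
    obtain s where s: "0 < s" "s < d n" "h (x + d n *\<^sub>R e) - h (x + 0 *\<^sub>R e) = (d n - 0) * D (x + s *\<^sub>R e)"
      using MVT2[of 0 "d n" "\<lambda>t. h (x + t *\<^sub>R e)" "\<lambda>s. D (x + s *\<^sub>R e)"] derx d by blast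
    then have k: "k n x = D (x + s *\<^sub>R e)" using d[of n] by (simp add: k_def add_ac)
    show ?thesis
    proof (cases "x + s *\<^sub>R e \<in> cball y R")
      case True
      have "dist y x \<le> dist y (x + s *\<^sub>R e) + norm (s *\<^sub>R e)"
        using dist_triangle[of y x "x + s *\<^sub>R e"] by (simp add: dist_norm)
      also have "\<dots> \<le> R + norm e"
        using True s d[of n] by (intro add_mono) (auto intro: mult_left_le_one_le)
      finally show ?thesis using M(1)[OF True] by (simp add: k)
    next
      case False
      then show ?thesis using D0 M by (simp add: k)
    qed
  qed
  have "(\<lambda>n. integral\<^sup>L lborel (k n)) \<longlonglongrightarrow> integral\<^sup>L lborel D"
  proof (rule integral_dominated_convergence[where w = "\<lambda>x. M * indicator (cball y (R + norm e)) x"])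
    show "integrable lborel (\<lambda>x. M * indicator (cball y (R + norm e)) x)"
      using borel_integrable_compact[of "cball y (R + norm e)" "\<lambda>_. M"] by (simp add: mult.commute)
    show "AE x in lborel. (\<lambda>n. k n x) \<longlonglongrightarrow> D x"
    proof (rule AE_I2)
      fix x
      have "((\<lambda>t. (h (x + t *\<^sub>R e) - h x) / t) \<longlongrightarrow> D x) (at 0)"
        using der[of x] by (simp add: DERIV_def)
      moreover have "filterlim d (at 0) sequentially"
        unfolding filterlim_at using LIMSEQ_inverse_real_of_nat by (auto simp: d_def[abs_def])
      ultimately show "(\<lambda>n. k n x) \<longlonglongrightarrow> D x"
        unfolding k_def by (auto dest: filterlim_compose simp: add_ac)
    qed
    show "k n \<in> borel_measurable lborel" for n
      unfolding k_def[abs_def] by measurable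
  qed (use bound in auto)
  then show "integral\<^sup>L lborel D = 0"
    using kint by (simp add: LIMSEQ_const_iff)
qed

text \<open>A full derivative encoded by an explicit family of partials: introduction rules compute
  the family for compound expressions, and \<open>has_partials_unique\<close> reads it off.\<close>

definition has_partials :: "(real ^ 'n \<Rightarrow> real) \<Rightarrow> ('n \<Rightarrow> real) \<Rightarrow> real ^ 'n \<Rightarrow> bool" where
  "has_partials g G x \<longleftrightarrow> (g has_derivative (\<lambda>h. \<Sum>i\<in>UNIV. G i * h $ i)) (at x)"

abbreviation pd :: "'n::finite \<Rightarrow> (real ^ 'n \<Rightarrow> real) \<Rightarrow> real ^ 'n \<Rightarrow> real" where
  "pd i \<equiv> dderiv (axis i 1)"

lemma has_partials_pd:
  fixes g :: "real ^ 'n \<Rightarrow> real"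
  assumes "g differentiable (at x)"
  shows "has_partials g (\<lambda>i. pd i g x) x"
proof -
  let ?D = "frechet_derivative g (at x)"
  have D: "(g has_derivative ?D) (at x)"
    using assms frechet_derivative_works by blast
  then interpret linear ?D by (rule has_derivative_linear)
  have "?D h = (\<Sum>i\<in>UNIV. pd i g x * h $ i)" for h
  proof -
    have "?D h = ?D (\<Sum>i\<in>UNIV. (h $ i) *\<^sub>R axis i 1)"
      by (subst basis_expansion[symmetric, of h]) (simp add: scalar_mult_eq_scaleR)
    then show ?thesis by (simp add: sum scale dderiv_def mult.commute)
  qed
  then have "?D = (\<lambda>h. \<Sum>i\<in>UNIV. pd i g x * h $ i)" by (rule ext)
  with D show ?thesis unfolding has_partials_def by simp
qed

lemma has_partials_dderiv:
  assumes "has_partials g G x"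
  shows "dderiv v g x = (\<Sum>i\<in>UNIV. G i * v $ i)"
  using assms by (simp add: has_partials_def dderiv_def flip: frechet_derivative_at)

lemma has_partials_unique:
  assumes "has_partials g G x"
  shows "pd i g x = G i"
  unfolding has_partials_dderiv[OF assms] by (simp add: axis_def if_distrib cong: if_cong)

lemma has_partials_const: "has_partials (\<lambda>_. c) (\<lambda>_. 0) x"
  by (simp add: has_partials_def)

lemma has_partials_nth: "has_partials (\<lambda>x. x $ k) (\<lambda>i. if i = k then 1 else 0) x"
proof -
  have "((\<lambda>x. x $ k) has_derivative (\<lambda>h. h $ k)) (at x)"
    by (intro bounded_linear_imp_has_derivative bounded_linear_vec_nth)
  then show ?thesis
    unfolding has_partials_def by (simp add: if_distrib[of "\<lambda>z. z * _"] cong: if_cong)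
qed

lemma has_partials_add:
  "has_partials g G x \<Longrightarrow> has_partials h H x \<Longrightarrow> has_partials (\<lambda>x. g x + h x) (\<lambda>i. G i + H i) x"
  unfolding has_partials_def by (drule (1) has_derivative_add) (simp add: sum.distrib distrib_right)

lemma has_partials_diff:
  "has_partials g G x \<Longrightarrow> has_partials h H x \<Longrightarrow> has_partials (\<lambda>x. g x - h x) (\<lambda>i. G i - H i) x"
  unfolding has_partials_def by (drule (1) has_derivative_diff) (simp add: sum_subtractf left_diff_distrib)

lemma has_partials_sum:
  "(\<And>j. j \<in> J \<Longrightarrow> has_partials (g j) (G j) x) \<Longrightarrow> has_partials (\<lambda>x. \<Sum>j\<in>J. g j x) (\<lambda>i. \<Sum>j\<in>J. G j i) x"
  by (induction J rule: infinite_finite_induct) (auto intro: has_partials_const has_partials_add)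

lemma has_partials_compose:
  assumes "(\<phi> has_real_derivative d) (at (g x))" "has_partials g G x"
  shows "has_partials (\<lambda>x. \<phi> (g x)) (\<lambda>i. d * G i) x"
  using has_derivative_compose[OF assms(2)[unfolded has_partials_def] assms(1)[unfolded has_field_derivative_def]]
  unfolding has_partials_def by (simp add: sum_distrib_left mult.assoc)

lemma has_partials_mult:
  "has_partials g G x \<Longrightarrow> has_partials h H x \<Longrightarrow> has_partials (\<lambda>x. g x * h x) (\<lambda>i. G i * h x + g x * H i) x"
  unfolding has_partials_def
  by (drule (1) has_derivative_mult) (simp add: sum.distrib sum_distrib_left sum_distrib_right algebra_simps)

lemma has_partials_cong_open:
  assumes "has_partials g G x" "open S" "x \<in> S" "\<And>z. z \<in> S \<Longrightarrow> g z = h z"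
  shows "has_partials h G x"
  using assms has_derivative_transform_within_open[of g _ x UNIV S h] unfolding has_partials_def by blast

lemma has_partials_eq: "has_partials g G x \<Longrightarrow> (\<And>i. G i = H i) \<Longrightarrow> has_partials g H x"
  by (simp add: has_partials_def)

lemma has_partials_differentiable: "has_partials g G x \<Longrightarrow> g differentiable (at x)"
  unfolding has_partials_def differentiable_def by blast

lemma has_partials_continuous: "has_partials g G x \<Longrightarrow> isCont g x"
  unfolding has_partials_def by (rule has_derivative_continuous)

text \<open>The fields are extended by zero. On the open set outside the small closed ball they
  vanish together with their partials, so the extensions stay continuous and each diagonal partial
  integrates to zero.\<close>

lemma divergence_compact_support:
  fixes X :: "'n::finite \<Rightarrow> real ^ 'n \<Rightarrow> real" and G :: "'n \<Rightarrow> real ^ 'n \<Rightarrow> 'n \<Rightarrow> real"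
  assumes R: "r < R"
    and part: "\<And>i x. x \<in> ball y R \<Longrightarrow> has_partials (X i) (G i x) x"
    and cont: "\<And>i. continuous_on (ball y R) (\<lambda>x. G i x i)"
    and supp: "\<And>i x. x \<in> ball y R \<Longrightarrow> x \<notin> cball y r \<Longrightarrow> X i x = 0"
  shows "set_integrable lborel (ball y R) (\<lambda>x. \<Sum>i\<in>UNIV. G i x i)"
    and "(LINT x:ball y R|lborel. \<Sum>i\<in>UNIV. G i x i) = 0"
proof -
  define Y where "Y i x = (if x \<in> ball y R then X i x else 0)" for i x
  define H where "H i x = (if x \<in> ball y R then G i x i else 0)" for i x
  have out: "- cball y r \<union> ball y R = UNIV" using R by auto
  have Y0: "Y i x = 0" if "x \<notin> cball y r" for i x using that supp by (auto simp: Y_def)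
  have H0: "H i x = 0" if "x \<notin> cball y r" for i x
  proof (cases "x \<in> ball y R")
    case True
    have "has_partials (X i) (\<lambda>_. 0) x"
      by (rule has_partials_cong_open[OF has_partials_const, of "ball y R - cball y r"])
        (use True that supp in \<open>auto simp: open_Diff\<close>)
    then show ?thesis
      using True has_partials_unique[OF part[OF True]] has_partials_unique H_def by metis
  qed (simp add: H_def)
  have YH: "((\<lambda>t. Y i (x + t *\<^sub>R axis i 1)) has_real_derivative H i x) (at 0)" for i x
  proof (cases "x \<in> ball y R")
    case True
    have *: "has_partials (Y i) (G i x) x"
      by (rule has_partials_cong_open[OF part[OF True], of "ball y R"]) (use True in \<open>auto simp: Y_def\<close>)
    have "Y i differentiable (at (x + 0 *\<^sub>R axis i 1))"
      using has_partials_differentiable[OF *] by simp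
    from dderiv_along_line[OF this] show ?thesis
      using has_partials_unique[OF *] True by (simp add: H_def)
  next
    case False
    have *: "has_partials (Y i) (\<lambda>_. 0) x"
      by (rule has_partials_cong_open[OF has_partials_const, of "- cball y r"]) (use False R Y0 in auto)
    have "Y i differentiable (at (x + 0 *\<^sub>R axis i 1))"
      using has_partials_differentiable[OF *] by simp
    from dderiv_along_line[OF this] show ?thesis
      using has_partials_unique[OF *] False by (simp add: H_def)
  qed
  have cY: "continuous_on UNIV (Y i)" for i
  proof -
    have "continuous_on (ball y R) (Y i)"
      by (subst continuous_on_cong[OF refl, of _ _ "X i"])
        (auto simp: Y_def intro!: continuous_at_imp_continuous_on has_partials_continuous part)
    moreover have "continuous_on (- cball y r) (Y i)"
      by (subst continuous_on_cong[OF refl, of _ _ "\<lambda>_. 0"]) (use Y0 in auto)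
    ultimately show ?thesis
      unfolding out[symmetric] by (intro continuous_on_open_Un) auto
  qed
  have cH: "continuous_on UNIV (H i)" for i
  proof -
    have "continuous_on (ball y R) (H i)"
      by (subst continuous_on_cong[OF refl, of _ _ "\<lambda>x. G i x i"]) (use cont in \<open>auto simp: H_def\<close>)
    moreover have "continuous_on (- cball y r) (H i)"
      by (subst continuous_on_cong[OF refl, of _ _ "\<lambda>_. 0"]) (use H0 in auto)
    ultimately show ?thesis
      unfolding out[symmetric] by (intro continuous_on_open_Un) auto
  qed
  note I = integral_directional_derivative_zero[OF YH cY cH Y0]
  have eq: "(\<lambda>x. indicator (ball y R) x *\<^sub>R (\<Sum>i\<in>UNIV. G i x i)) = (\<lambda>x. \<Sum>i\<in>UNIV. H i x)"
    by (auto simp: fun_eq_iff H_def indicator_def)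
  show "set_integrable lborel (ball y R) (\<lambda>x. \<Sum>i\<in>UNIV. G i x i)"
    unfolding set_integrable_def eq using I(1) by simp
  show "(LINT x:ball y R|lborel. \<Sum>i\<in>UNIV. G i x i) = 0"
    unfolding set_lebesgue_integral_def eq using I by simp
qed

section \<open>Smooth functions and the chain rule along the jet of u\<close>

lemma smooth_on_pd: "smooth_on S g \<Longrightarrow> smooth_on S (pd i g)"
proof -
  assume "smooth_on S g"
  then have "Ck_on (Suc k) S g" for k unfolding smooth_on_def by blast
  moreover have "axis i (1::real) \<in> Basis" by (auto simp: Basis_vec_def)
  ultimately show ?thesis unfolding smooth_on_def by simp
qed

lemma smooth_on_differentiable:
  assumes "smooth_on S g" "open S" "x \<in> S"
  shows "g differentiable (at x)"
proof -
  have "Ck_on (Suc 0) S g" using assms(1) unfolding smooth_on_def by blast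
  then show ?thesis
    using assms by (auto simp: differentiable_on_def at_within_open[of x S])
qed

lemma smooth_on_continuous: "smooth_on S g \<Longrightarrow> continuous_on S g"
  unfolding smooth_on_def by (metis Ck_on.simps(1))

lemma smooth_on_has_partials:
  "smooth_on S g \<Longrightarrow> open S \<Longrightarrow> x \<in> S \<Longrightarrow> has_partials g (\<lambda>i. pd i g x) x"
  by (intro has_partials_pd smooth_on_differentiable)

lemma smooth_on_pd_commute:
  assumes "smooth_on S g" "open S" "x \<in> S"
  shows "pd i (pd j g) x = pd j (pd i g) x"
  using assms
  by (intro dderiv_commute[of S]) (auto intro: smooth_on_differentiable smooth_on_continuous smooth_on_pd)

lemma pd_cong_open:
  assumes "smooth_on S g" "open S" "x \<in> S" "\<And>z. z \<in> S \<Longrightarrow> g z = h z"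
  shows "pd i g x = pd i h x"
  using has_partials_unique[OF has_partials_cong_open[OF smooth_on_has_partials[OF assms(1-3)] assms(2-4)]] by simp

abbreviation jet :: "(real ^ 'n \<Rightarrow> real) \<Rightarrow> real ^ 'n \<Rightarrow> (real ^ 'n) \<times> real \<times> (real ^ 'n)" where
  "jet u x \<equiv> (x, u x, grad u x)"

abbreviation (input) ebase :: "'n::finite \<Rightarrow> (real ^ 'n) \<times> real \<times> (real ^ 'n)" where
  "ebase k \<equiv> (axis k 1, 0, 0)"
abbreviation (input) evalue :: "(real ^ 'n) \<times> real \<times> (real ^ 'n)" where
  "evalue \<equiv> (0, 1, 0)"
abbreviation (input) eslope :: "'n::finite \<Rightarrow> (real ^ 'n) \<times> real \<times> (real ^ 'n)" where
  "eslope k \<equiv> (0, 0, axis k 1)"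

lemma jet_basis:
  "ebase k \<in> Basis" "evalue \<in> Basis" "eslope k \<in> Basis"
  by (auto simp: Basis_prod_def Basis_vec_def zero_prod_def image_iff)

lemma dderiv_expand_jet:
  fixes F :: "(real ^ 'n) \<times> real \<times> (real ^ 'n) \<Rightarrow> real"
  assumes "F differentiable (at z)"
  shows "dderiv (a, s, b) F z = (\<Sum>k\<in>UNIV. dderiv (ebase k) F z * a $ k) + dderiv evalue F z * s
    + (\<Sum>k\<in>UNIV. dderiv (eslope k) F z * b $ k)"
proof -
  let ?D = "frechet_derivative F (at z)"
  have "(F has_derivative ?D) (at z)"
    using assms frechet_derivative_works by blast
  then interpret linear ?D by (rule has_derivative_linear)
  have a: "a = (\<Sum>k\<in>UNIV. a $ k *\<^sub>R axis k 1)" and b: "b = (\<Sum>k\<in>UNIV. b $ k *\<^sub>R axis k 1)"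
    by (simp_all add: vec_eq_iff axis_def if_distrib cong: if_cong)
  have "(a, s, b) = (\<Sum>k\<in>UNIV. a $ k *\<^sub>R ebase k) + s *\<^sub>R evalue + (\<Sum>k\<in>UNIV. b $ k *\<^sub>R eslope k)"
    by (subst a, subst b) (simp add: prod_eq_iff fst_sum snd_sum)
  then have "?D (a, s, b) = ?D ((\<Sum>k\<in>UNIV. a $ k *\<^sub>R ebase k) + s *\<^sub>R evalue + (\<Sum>k\<in>UNIV. b $ k *\<^sub>R eslope k))"
    by (rule arg_cong)
  then show ?thesis
    by (simp only: add sum scale dderiv_def real_scaleR_def mult.commute)
qed

text \<open>The chain rule asks only for differentiability of \<open>F\<close> at the jet, so it
  applies to f and also to the first derivatives of a C^2 function f.\<close>

lemma has_partials_jet: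
  fixes F :: "(real ^ 'n) \<times> real \<times> (real ^ 'n) \<Rightarrow> real"
  assumes F: "F differentiable (at (jet u x))" and S: "smooth_on S u" "open S" "x \<in> S"
  shows "has_partials (\<lambda>x. F (jet u x))
    (\<lambda>k. dderiv (ebase k) F (jet u x) + dderiv evalue F (jet u x) * pd k u x
      + (\<Sum>i\<in>UNIV. dderiv (eslope i) F (jet u x) * pd k (pd i u) x)) x"
proof -
  have g: "grad u z = (\<Sum>i\<in>UNIV. pd i u z *\<^sub>R axis i 1)" for z
    by (simp add: vec_eq_iff grad_def axis_def if_distrib cong: if_cong)
  have du: "(u has_derivative (\<lambda>h. \<Sum>k\<in>UNIV. pd k u x * h $ k)) (at x)"
    using smooth_on_has_partials[OF S] by (simp add: has_partials_def)
  have d2: "(pd i u has_derivative (\<lambda>h. \<Sum>k\<in>UNIV. pd k (pd i u) x * h $ k)) (at x)" for i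
    using smooth_on_has_partials[OF smooth_on_pd[OF S(1)] S(2,3)] by (simp add: has_partials_def)
  have dg: "(grad u has_derivative (\<lambda>h. \<Sum>i\<in>UNIV. (\<Sum>k\<in>UNIV. pd k (pd i u) x * h $ k) *\<^sub>R axis i 1)) (at x)"
    unfolding g[abs_def] by (intro has_derivative_sum has_derivative_scaleR_left d2)
  have jet: "(jet u has_derivative (\<lambda>h. (h, \<Sum>k\<in>UNIV. pd k u x * h $ k,
      \<Sum>i\<in>UNIV. (\<Sum>k\<in>UNIV. pd k (pd i u) x * h $ k) *\<^sub>R axis i 1))) (at x)"
    by (intro has_derivative_Pair du dg has_derivative_ident)
  let ?D = "frechet_derivative F (at (jet u x))"
  have D: "(F has_derivative ?D) (at (jet u x))"
    using F frechet_derivative_works by blast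
  have "?D (h, \<Sum>k\<in>UNIV. pd k u x * h $ k, \<Sum>i\<in>UNIV. (\<Sum>k\<in>UNIV. pd k (pd i u) x * h $ k) *\<^sub>R axis i 1)
    = (\<Sum>k\<in>UNIV. (dderiv (ebase k) F (jet u x) + dderiv evalue F (jet u x) * pd k u x
      + (\<Sum>i\<in>UNIV. dderiv (eslope i) F (jet u x) * pd k (pd i u) x)) * h $ k)" for h
  proof -
    have s: "(\<Sum>i\<in>UNIV. (\<Sum>k\<in>UNIV. pd k (pd i u) x * h $ k) *\<^sub>R axis i (1::real)) $ j
        = (\<Sum>k\<in>UNIV. pd k (pd j u) x * h $ k)" for j
      by (simp add: axis_def if_distrib cong: if_cong)
    have "(\<Sum>j\<in>UNIV. dderiv (eslope j) F (jet u x) * (\<Sum>k\<in>UNIV. pd k (pd j u) x * h $ k))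
        = (\<Sum>k\<in>UNIV. (\<Sum>j\<in>UNIV. dderiv (eslope j) F (jet u x) * pd k (pd j u) x) * h $ k)"
      unfolding sum_distrib_left sum_distrib_right by (subst sum.swap) (simp only: mult_ac)
    note sw = this
    have "?D (h, \<Sum>k\<in>UNIV. pd k u x * h $ k, \<Sum>i\<in>UNIV. (\<Sum>k\<in>UNIV. pd k (pd i u) x * h $ k) *\<^sub>R axis i 1)
      = dderiv (h, \<Sum>k\<in>UNIV. pd k u x * h $ k, \<Sum>i\<in>UNIV. (\<Sum>k\<in>UNIV. pd k (pd i u) x * h $ k) *\<^sub>R axis i 1) F (jet u x)"
      by (simp add: dderiv_def)
    also note dderiv_expand_jet[OF F]
    finally show ?thesis
      unfolding s sw by (simp only: distrib_right sum.distrib sum_distrib_left mult.assoc)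
  qed
  then show ?thesis
    unfolding has_partials_def using has_derivative_compose[OF jet D] by simp
qed

section \<open>The differentiated equation\<close>

text \<open>The norm hypotheses in pointwise form. Since \<open>K \<ge> 1\<close>, powers of
  \<open>K\<close> increase with the exponent, which lets lower-order terms be absorbed.\<close>

locale sigma2_pde =
  fixes K :: real and f :: "(real ^ 3) \<times> real \<times> (real ^ 3) \<Rightarrow> real" and u :: "real ^ 3 \<Rightarrow> real"
  assumes K: "K \<ge> 1"
    and u: "smooth_on (ball 0 10) u"
    and trace_pos: "x \<in> ball 0 10 \<Longrightarrow> trace (hessian u x) > 0"
    and eq: "x \<in> ball 0 10 \<Longrightarrow> sig2 (hessian u x) = f (jet u x)"
    and f_bounds: "z \<in> ball 0 10 \<times> UNIV \<Longrightarrow> 1 / K \<le> f z" "z \<in> ball 0 10 \<times> UNIV \<Longrightarrow> f z \<le> K"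
    and f_diff: "z \<in> ball 0 10 \<times> UNIV \<Longrightarrow> f differentiable (at z)"
      "z \<in> ball 0 10 \<times> UNIV \<Longrightarrow> b \<in> Basis \<Longrightarrow> dderiv b f differentiable (at z)"
    and f1: "z \<in> ball 0 10 \<times> UNIV \<Longrightarrow> b \<in> Basis \<Longrightarrow> \<bar>dderiv b f z\<bar> \<le> K"
    and f2: "z \<in> ball 0 10 \<times> UNIV \<Longrightarrow> b \<in> Basis \<Longrightarrow> c \<in> Basis \<Longrightarrow> \<bar>dderiv c (dderiv b f) z\<bar> \<le> K"
    and u1: "x \<in> ball 0 10 \<Longrightarrow> \<bar>pd i u x\<bar> \<le> K"
begin

abbreviation "\<Omega> \<equiv> ball (0 :: real ^ 3) 10"
abbreviation "A \<equiv> hessian u"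

text \<open>Besides the third derivatives of u, \<open>t\<close> is the gradient and
  \<open>W\<close> the Hessian of the Laplacian of u.\<close>

definition "T i j k x = pd i (pd j (pd k u)) x"
definition "t k x = (\<Sum>i\<in>UNIV. T i i k x)"
definition "W i j x = (\<Sum>k\<in>UNIV. pd i (pd j (pd k (pd k u))) x)"

definition "jet_partial g k x = dderiv (ebase k) g (jet u x) + dderiv evalue g (jet u x) * pd k u x
      + (\<Sum>i\<in>UNIV. dderiv (eslope i) g (jet u x) * pd k (pd i u) x)"

lemma jet_in: "x \<in> \<Omega> \<Longrightarrow> jet u x \<in> \<Omega> \<times> UNIV"
  by simp

lemma A_nth: "A x $ i $ j = pd i (pd j u) x"
  by (simp add: hessian_def)

lemma trace_A: "trace (A x) = (\<Sum>k\<in>UNIV. pd k (pd k u) x)"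
  by (simp add: trace_def A_nth)

lemma A_sym: "x \<in> \<Omega> \<Longrightarrow> transpose (A x) = A x"
  using smooth_on_pd_commute[OF u] by (simp add: transpose_def vec_eq_iff A_nth)

lemma sig2_pos: "x \<in> \<Omega> \<Longrightarrow> sig2 (A x) > 0"
  using f_bounds(1)[of "jet u x"] K by (simp add: eq less_le_trans[of 0 "1 / K"])

lemma smooth_partials: "smooth_on \<Omega> g \<Longrightarrow> x \<in> \<Omega> \<Longrightarrow> has_partials g (\<lambda>i. pd i g x) x"
  by (rule smooth_on_has_partials[of \<Omega>]) auto

lemma smooth2: "smooth_on \<Omega> (pd j (pd k u))"
  by (intro smooth_on_pd u)

lemma smooth3: "smooth_on \<Omega> (T i j k)"
  unfolding T_def[abs_def] by (intro smooth_on_pd u)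

lemma T_commute: "x \<in> \<Omega> \<Longrightarrow> T i j k x = T j i k x" "x \<in> \<Omega> \<Longrightarrow> T i j k x = T i k j x"
  unfolding T_def
   apply (rule smooth_on_pd_commute[OF smooth_on_pd[OF u]]; simp)
  apply (rule pd_cong_open[OF smooth2]; simp add: smooth_on_pd_commute[OF u])
  done

lemma t_eq: "x \<in> \<Omega> \<Longrightarrow> t k x = (\<Sum>i\<in>UNIV. T k i i x)"
  unfolding t_def by (intro sum.cong refl trans[OF T_commute(2) T_commute(1)])

lemma partials_A: "x \<in> \<Omega> \<Longrightarrow> has_partials (\<lambda>x. A x $ i $ j) (\<lambda>k. T k i j x) x"
  unfolding A_nth T_def by (intro smooth_partials smooth2) auto

lemma partials_trace: "x \<in> \<Omega> \<Longrightarrow> has_partials (\<lambda>x. trace (A x)) (\<lambda>k. t k x) x"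
  unfolding trace_A
  by (rule has_partials_eq[OF has_partials_sum[OF smooth_partials[OF smooth2]]]) (auto simp: t_eq T_def)

lemma partials_T: "x \<in> \<Omega> \<Longrightarrow> has_partials (T i j k) (\<lambda>l. pd l (T i j k) x) x"
  by (intro smooth_partials smooth3) auto

lemma partials_t:
  assumes "x \<in> \<Omega>"
  shows "has_partials (t j) (\<lambda>i. W i j x) x"
proof -
  have "has_partials (\<lambda>x. \<Sum>k\<in>UNIV. T j k k x) (\<lambda>i. W i j x) x"
    unfolding W_def T_def[abs_def]
    by (intro has_partials_sum smooth_partials smooth_on_pd u assms)
  then show ?thesis
    by (rule has_partials_cong_open[of _ _ _ \<Omega>]) (use assms in \<open>auto simp: t_eq\<close>)
qed

text \<open>Commutation of fourth derivatives. An exchange below an outer derivative is an equality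
  only on \<open>\<Omega>\<close>, so it passes through \<open>pd_cong_open\<close>.\<close>

lemma fourth_trace:
  assumes x: "x \<in> \<Omega>"
  shows "(\<Sum>k\<in>UNIV. pd k (T k i j) x) = W i j x"
proof -
  have swap: "pd k (pd k (pd i v)) z = pd i (pd k (pd k v)) z" if "smooth_on \<Omega> v" "z \<in> \<Omega>" for k i v z
  proof -
    have "pd k (pd k (pd i v)) z = pd k (pd i (pd k v)) z"
      by (rule pd_cong_open[of \<Omega>]) (use that in \<open>auto intro!: smooth_on_pd smooth_on_pd_commute\<close>)
    also have "\<dots> = pd i (pd k (pd k v)) z"
      by (rule smooth_on_pd_commute[of \<Omega>]) (use that in \<open>auto intro!: smooth_on_pd\<close>)
    finally show ?thesis .
  qed
  have "pd k (T k i j) x = pd i (pd j (pd k (pd k u))) x" for k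
  proof -
    have "pd k (T k i j) x = pd i (pd k (pd k (pd j u))) x"
      using swap[OF smooth_on_pd[OF u, of j] x, of k i] by (simp add: T_def[abs_def])
    also have "\<dots> = pd i (pd j (pd k (pd k u))) x"
      by (rule pd_cong_open[of \<Omega>]) (use x swap[OF u] in \<open>auto intro!: smooth_on_pd u\<close>)
    finally show ?thesis .
  qed
  then show ?thesis by (simp add: W_def)
qed

lemma partials_jet:
  assumes "g differentiable (at (jet u x))" "x \<in> \<Omega>"
  shows "has_partials (\<lambda>x. g (jet u x)) (\<lambda>k. jet_partial g k x) x"
  unfolding jet_partial_def by (intro has_partials_jet[of _ _ _ \<Omega>] assms u) auto

lemma partials_sig2:
  assumes "x \<in> \<Omega>"
  shows "has_partials (\<lambda>x. sig2 (A x))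
    (\<lambda>k. trace (A x) * t k x - (\<Sum>i\<in>UNIV. \<Sum>j\<in>UNIV. A x $ i $ j * T k i j x)) x"
proof -
  have "has_partials (\<lambda>x. 1 / 2 * (trace (A x) * trace (A x) - (\<Sum>i\<in>UNIV. \<Sum>j\<in>UNIV. A x $ i $ j * A x $ i $ j)))
    (\<lambda>k. 0 * (trace (A x) * trace (A x) - (\<Sum>i\<in>UNIV. \<Sum>j\<in>UNIV. A x $ i $ j * A x $ i $ j))
      + 1 / 2 * ((t k x * trace (A x) + trace (A x) * t k x)
        - (\<Sum>i\<in>UNIV. \<Sum>j\<in>UNIV. T k i j x * A x $ i $ j + A x $ i $ j * T k i j x))) x"
    using assms
    by (intro has_partials_mult has_partials_const has_partials_diff has_partials_sum partials_trace partials_A)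
  moreover have "(\<lambda>x. sig2 (A x)) = (\<lambda>x. 1 / 2 * (trace (A x) * trace (A x) - (\<Sum>i\<in>UNIV. \<Sum>j\<in>UNIV. A x $ i $ j * A x $ i $ j)))"
    by (simp add: sig2_def power2_eq_square)
  ultimately show ?thesis
    by (auto elim!: has_partials_eq simp: sum.distrib mult.commute simp flip: sum_distrib_left)
qed

lemma first_derivative_equation:
  assumes "x \<in> \<Omega>"
  shows "trace (A x) * t k x - (\<Sum>i\<in>UNIV. \<Sum>j\<in>UNIV. A x $ i $ j * T k i j x) = jet_partial f k x"
proof -
  have 1: "has_partials (\<lambda>x. f (jet u x)) (\<lambda>k. trace (A x) * t k x - (\<Sum>i\<in>UNIV. \<Sum>j\<in>UNIV. A x $ i $ j * T k i j x)) x"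
    by (rule has_partials_cong_open[OF partials_sig2[OF assms], of \<Omega>]) (use assms eq in auto)
  have 2: "has_partials (\<lambda>x. f (jet u x)) (\<lambda>k. jet_partial f k x) x"
    using assms by (intro partials_jet f_diff jet_in)
  show ?thesis
    using has_partials_unique[OF 1, of k] has_partials_unique[OF 2, of k] by simp
qed

lemma newton_contract:
  "(\<Sum>i\<in>UNIV. \<Sum>j\<in>UNIV. newton M i j * S i j) = trace M * (\<Sum>i\<in>UNIV. S i i) - (\<Sum>i\<in>UNIV. \<Sum>j\<in>UNIV. M $ i $ j * S i j)"
  unfolding newton_def sum_3 by (simp add: algebra_simps)

text \<open>This is the differentiated equation, as \<open>newton\<close> is the gradient of
  \<open>sig2\<close>. It replaces third derivatives of u by quantities that involve only second
  ones.\<close>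

lemma newton_T:
  assumes "x \<in> \<Omega>"
  shows "(\<Sum>i\<in>UNIV. \<Sum>j\<in>UNIV. newton (A x) i j * T i j k x) = jet_partial f k x"
proof -
  have "T i j k x = T k i j x" for i j
    using T_commute(2)[OF assms, of i j k] T_commute(1)[OF assms, of i k j] by simp
  then have "(\<Sum>i\<in>UNIV. \<Sum>j\<in>UNIV. A x $ i $ j * T i j k x) = (\<Sum>i\<in>UNIV. \<Sum>j\<in>UNIV. A x $ i $ j * T k i j x)"
    by simp
  then show ?thesis
    using first_derivative_equation[OF assms, of k] by (simp add: newton_contract t_def)
qed

text \<open>The second total derivative of the right-hand side in direction k. Third derivatives of
  u occur only through the factors \<open>T k k i x\<close> in the last sum.\<close>

definition "jet_partial2 k x = jet_partial (dderiv (ebase k) f) k x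
  + (jet_partial (dderiv evalue f) k x * pd k u x + dderiv evalue f (jet u x) * A x $ k $ k)
  + (\<Sum>i\<in>UNIV. jet_partial (dderiv (eslope i) f) k x * A x $ k $ i + dderiv (eslope i) f (jet u x) * T k k i x)"

lemma partials_jet_partial:
  assumes "x \<in> \<Omega>"
  shows "pd k (jet_partial f k) x = jet_partial2 k x"
proof -
  have 1: "has_partials (\<lambda>x. dderiv b f (jet u x)) (\<lambda>k. jet_partial (dderiv b f) k x) x" if "b \<in> Basis" for b
    using assms that by (intro partials_jet f_diff jet_in)
  have 2: "has_partials (pd k u) (\<lambda>l. A x $ l $ k) x"
    unfolding A_nth using assms by (intro smooth_partials smooth_on_pd u) auto
  have 3: "has_partials (pd k (pd i u)) (\<lambda>l. T l k i x) x" for i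
    using partials_A[OF assms, of k i] by (simp add: A_nth)
  have "has_partials (\<lambda>x. dderiv (ebase k) f (jet u x) + dderiv evalue f (jet u x) * pd k u x
      + (\<Sum>i\<in>UNIV. dderiv (eslope i) f (jet u x) * pd k (pd i u) x))
    (\<lambda>l. jet_partial (dderiv (ebase k) f) l x
      + (jet_partial (dderiv evalue f) l x * pd k u x + dderiv evalue f (jet u x) * A x $ l $ k)
      + (\<Sum>i\<in>UNIV. jet_partial (dderiv (eslope i) f) l x * pd k (pd i u) x + dderiv (eslope i) f (jet u x) * T l k i x)) x"
    by (intro has_partials_add has_partials_mult has_partials_sum 1 2 3 jet_basis)
  then have "pd k (\<lambda>x. dderiv (ebase k) f (jet u x) + dderiv evalue f (jet u x) * pd k u x
      + (\<Sum>i\<in>UNIV. dderiv (eslope i) f (jet u x) * pd k (pd i u) x)) x = jet_partial2 k x"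
    by (rule has_partials_unique[THEN trans]) (simp add: jet_partial2_def A_nth)
  then show ?thesis
    by (simp only: jet_partial_def[abs_def])
qed

text \<open>The equation is differentiated twice in each direction k and summed. The terms quadratic
  in third derivatives come from the second derivative of \<open>sig2\<close>, a quadratic
  polynomial in the Hessian.\<close>

lemma trace_equation:
  assumes x: "x \<in> \<Omega>"
  shows "(\<Sum>i\<in>UNIV. \<Sum>j\<in>UNIV. newton (A x) i j * W i j x)
    = (\<Sum>k\<in>UNIV. jet_partial2 k x) + (\<Sum>i\<in>UNIV. \<Sum>j\<in>UNIV. \<Sum>k\<in>UNIV. (T i j k x)\<^sup>2) - (\<Sum>k\<in>UNIV. (t k x)\<^sup>2)"
proof -
  have "jet_partial2 k x = t k x * t k x + trace (A x) * W k k x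
      - (\<Sum>i\<in>UNIV. \<Sum>j\<in>UNIV. T k i j x * T k i j x + A x $ i $ j * pd k (T k i j) x)" for k
  proof -
    have "has_partials (\<lambda>x. trace (A x) * t k x - (\<Sum>i\<in>UNIV. \<Sum>j\<in>UNIV. A x $ i $ j * T k i j x))
      (\<lambda>l. t l x * t k x + trace (A x) * W l k x
      - (\<Sum>i\<in>UNIV. \<Sum>j\<in>UNIV. T l i j x * T k i j x + A x $ i $ j * pd l (T k i j) x)) x"
      using x by (intro has_partials_mult has_partials_diff has_partials_sum partials_trace partials_A partials_t partials_T)
    then have "has_partials (jet_partial f k) (\<lambda>l. t l x * t k x + trace (A x) * W l k x
      - (\<Sum>i\<in>UNIV. \<Sum>j\<in>UNIV. T l i j x * T k i j x + A x $ i $ j * pd l (T k i j) x)) x"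
      by (rule has_partials_cong_open[of _ _ _ \<Omega>]) (use x first_derivative_equation in auto)
    from has_partials_unique[OF this, of k] show ?thesis
      by (simp only: partials_jet_partial[OF x])
  qed
  then have "(\<Sum>k\<in>UNIV. jet_partial2 k x) = (\<Sum>k\<in>UNIV. (t k x)\<^sup>2) + trace (A x) * (\<Sum>k\<in>UNIV. W k k x)
      - (\<Sum>k\<in>UNIV. \<Sum>i\<in>UNIV. \<Sum>j\<in>UNIV. (T k i j x)\<^sup>2)
      - (\<Sum>k\<in>UNIV. \<Sum>i\<in>UNIV. \<Sum>j\<in>UNIV. A x $ i $ j * pd k (T k i j) x)"
    by (simp add: sum.distrib sum_subtractf sum_distrib_left power2_eq_square)
  moreover have "(\<Sum>k\<in>UNIV. \<Sum>i\<in>UNIV. \<Sum>j\<in>UNIV. A x $ i $ j * pd k (T k i j) x)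
      = (\<Sum>i\<in>UNIV. \<Sum>j\<in>UNIV. A x $ i $ j * W i j x)"
  proof -
    have "(\<Sum>k\<in>UNIV. \<Sum>i\<in>UNIV. \<Sum>j\<in>UNIV. A x $ i $ j * pd k (T k i j) x)
        = (\<Sum>i\<in>UNIV. \<Sum>j\<in>UNIV. \<Sum>k\<in>UNIV. A x $ i $ j * pd k (T k i j) x)"
      by (subst sum.swap) (intro sum.cong refl sum.swap)
    then show ?thesis
      unfolding fourth_trace[OF x, symmetric] sum_distrib_left .
  qed
  ultimately show ?thesis
    by (simp add: newton_contract)
qed

end

section \<open>Bounds for the data and the subsolution property of the trace\<close>

lemma mean_value_bound:
  assumes S: "convex S" "x \<in> S" "y \<in> S" and g: "\<And>z. z \<in> S \<Longrightarrow> g differentiable (at z)"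
    and b: "\<And>z. z \<in> S \<Longrightarrow> \<bar>dderiv (x - y) g z\<bar> \<le> M"
  shows "\<bar>g x - g y\<bar> \<le> M"
proof -
  have seg: "y + s *\<^sub>R (x - y) \<in> S" if "0 \<le> s" "s \<le> 1" for s
  proof -
    have "y + s *\<^sub>R (x - y) = (1 - s) *\<^sub>R y + s *\<^sub>R x" by (simp add: algebra_simps)
    then show ?thesis using S that by (simp add: convexD)
  qed
  obtain s where s: "0 < s" "s < 1"
    "g (y + 1 *\<^sub>R (x - y)) - g (y + 0 *\<^sub>R (x - y)) = (1 - 0) * dderiv (x - y) g (y + s *\<^sub>R (x - y))"
    using MVT2[of 0 1 "\<lambda>s. g (y + s *\<^sub>R (x - y))" "\<lambda>s. dderiv (x - y) g (y + s *\<^sub>R (x - y))"]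
      dderiv_along_line g seg by (metis zero_less_one)
  then show ?thesis using b[OF seg[of s]] by simp
qed

lemma has_partials_cmult: "has_partials g G x \<Longrightarrow> has_partials (\<lambda>x. c * g x) (\<lambda>i. c * G i) x"
  by (rule has_partials_eq[OF has_partials_mult[OF has_partials_const]], assumption) simp

lemma has_partials_power2: "has_partials g G x \<Longrightarrow> has_partials (\<lambda>x. (g x)\<^sup>2) (\<lambda>i. 2 * g x * G i) x"
  by (rule has_partials_compose) (auto intro!: derivative_eq_intros)

lemma has_partials_nth_diff: "has_partials (\<lambda>x. x $ k - c) (\<lambda>i. if i = k then 1 else 0) x"
  by (rule has_partials_eq[OF has_partials_diff[OF has_partials_nth has_partials_const]]) simp

context sigma2_pde
begin

lemma K_pow: "1 \<le> K ^ n"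
  using K by (rule one_le_power)

lemma sig2_bounds: "x \<in> \<Omega> \<Longrightarrow> 1 / K \<le> sig2 (A x)" "x \<in> \<Omega> \<Longrightarrow> sig2 (A x) \<le> K"
  using f_bounds[OF jet_in] by (simp_all add: eq)

text \<open>The squared trace is at least 2 \<open>sig2\<close>. The bound allows terms of order
  zero in the trace to be absorbed into terms of order one.\<close>

lemma trace_lower:
  assumes x: "x \<in> \<Omega>"
  shows "1 \<le> K * trace (A x)"
proof -
  have "(\<Sum>i\<in>UNIV. \<Sum>j\<in>UNIV. (A x $ i $ j)\<^sup>2) \<ge> 0" by (intro sum_nonneg) auto
  then have "(trace (A x))\<^sup>2 \<ge> 1 / K"
    using sig2_bounds(1)[OF x] K trace_squared[of "A x"] by (smt (verit) divide_pos_pos)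
  then have "K\<^sup>2 * (trace (A x))\<^sup>2 \<ge> K\<^sup>2 * (1 / K)"
    by (intro mult_left_mono) auto
  moreover have "K\<^sup>2 * (1 / K) = K" using K by (simp add: power2_eq_square)
  ultimately have "(K * trace (A x))\<^sup>2 \<ge> 1\<^sup>2"
    using K by (simp add: power_mult_distrib)
  then show ?thesis
    using K trace_pos[OF x] by (intro power2_le_imp_le[of 1]) auto
qed

lemma trace_le_vol:
  assumes x: "x \<in> \<Omega>"
  shows "trace (A x) \<le> 3 / 2 * K * vol (A x)"
proof -
  have "trace (A x) * (1 / K) \<le> trace (A x) * sig2 (A x)"
    using sig2_bounds[OF x] trace_pos[OF x] by (intro mult_left_mono) auto
  then have "2 * (trace (A x) / K) \<le> 3 * vol (A x)"
    using vol_lower_bound[OF A_sym[OF x] trace_pos[OF x] sig2_pos[OF x]] by simp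
  then show ?thesis using K by (simp add: field_simps)
qed

lemma vol_pos:
  assumes "x \<in> \<Omega>"
  shows "vol (A x) > 0"
  using less_le_trans[OF trace_pos trace_le_vol, OF assms assms] K by (simp add: zero_less_mult_iff)

lemma A_le_trace: "x \<in> \<Omega> \<Longrightarrow> \<bar>A x $ i $ j\<bar> \<le> trace (A x)"
  using entry_le_trace[of "A x"] trace_pos[of x] sig2_pos[of x] by simp

text \<open>The 5 counts one base term, one value term and three slope terms, each at most K^3 times
  the trace.\<close>

lemma jet_partial_bound:
  assumes x: "x \<in> \<Omega>" and g: "\<And>b. b \<in> Basis \<Longrightarrow> \<bar>dderiv b g (jet u x)\<bar> \<le> K"
  shows "\<bar>jet_partial g k x\<bar> \<le> 5 * K ^ 3 * trace (A x)"
proof -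
  let ?w = "trace (A x)"
  have w: "?w > 0" "1 \<le> K * ?w" using trace_pos trace_lower x by auto
  have "\<bar>\<Sum>i\<in>UNIV. dderiv (eslope i) g (jet u x) * pd k (pd i u) x\<bar> \<le> (\<Sum>i\<in>(UNIV::3 set). K * ?w)"
    using A_le_trace[OF x] K
    by (intro order_trans[OF sum_abs] sum_mono) (auto simp: abs_mult A_nth intro!: mult_mono g jet_basis)
  then have 3: "\<bar>\<Sum>i\<in>UNIV. dderiv (eslope i) g (jet u x) * pd k (pd i u) x\<bar> \<le> 3 * (K * ?w)" by simp
  have 2: "\<bar>dderiv evalue g (jet u x) * pd k u x\<bar> \<le> K * K"
    using K u1[OF x] by (auto simp: abs_mult intro!: mult_mono g jet_basis)
  have 1: "\<bar>dderiv (ebase k) g (jet u x)\<bar> \<le> K" by (intro g jet_basis)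
  have "K * 1 \<le> K\<^sup>2 * (K * ?w)" "K * K * 1 \<le> K\<^sup>2 * (K * ?w)" "1 * (K * ?w) \<le> K\<^sup>2 * (K * ?w)"
    using mult_mono[of K "K\<^sup>2" 1 "K * ?w"] mult_left_mono[of 1 "K * ?w" "K * K"] mult_right_mono[of 1 "K\<^sup>2" "K * ?w"]
      K w K_pow[of 2] power_increasing[of 1 2 K] by (simp_all add: power2_eq_square)
  then have "\<bar>jet_partial g k x\<bar> \<le> 5 * (K\<^sup>2 * (K * ?w))"
    unfolding jet_partial_def using 1 2 3 by (smt (verit))
  then show ?thesis by (simp add: power2_eq_square power3_eq_cube mult_ac)
qed

text \<open>The subtracted sum carries the third derivatives; it is reserved for
  \<open>third_order_bound\<close>, where it is the term linear in \<open>p\<close>. The rest is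
  counted as 5 + 5 + 1 + 15 = 26.\<close>

lemma jet_partial2_bound:
  assumes x: "x \<in> \<Omega>"
  shows "\<bar>jet_partial2 k x - (\<Sum>i\<in>UNIV. dderiv (eslope i) f (jet u x) * T k k i x)\<bar> \<le> 26 * K ^ 5 * (trace (A x))\<^sup>2"
proof -
  let ?w = "trace (A x)"
  have w: "?w > 0" "1 \<le> K * ?w" using trace_pos trace_lower x by auto
  have J: "\<bar>jet_partial (dderiv b f) k x\<bar> \<le> 5 * K ^ 3 * ?w" if "b \<in> Basis" for b
    using that x by (intro jet_partial_bound f2) auto
  have "\<bar>\<Sum>i\<in>UNIV. jet_partial (dderiv (eslope i) f) k x * A x $ k $ i\<bar> \<le> (\<Sum>i\<in>(UNIV::3 set). 5 * K ^ 3 * ?w * ?w)"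
    using A_le_trace[OF x] K w
    by (intro order_trans[OF sum_abs] sum_mono) (auto simp: abs_mult intro!: mult_mono J jet_basis)
  then have 4: "\<bar>\<Sum>i\<in>UNIV. jet_partial (dderiv (eslope i) f) k x * A x $ k $ i\<bar> \<le> 15 * (K ^ 3 * ?w\<^sup>2)"
    by (simp add: power2_eq_square mult_ac)
  have 1: "\<bar>jet_partial (dderiv (ebase k) f) k x\<bar> \<le> 5 * K ^ 3 * ?w" by (intro J jet_basis)
  have 2: "\<bar>jet_partial (dderiv evalue f) k x * pd k u x\<bar> \<le> 5 * K ^ 3 * ?w * K"
    using K w u1[OF x] unfolding abs_mult by (intro mult_mono J jet_basis) auto
  have 3: "\<bar>dderiv evalue f (jet u x) * A x $ k $ k\<bar> \<le> K * ?w"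
    using K w A_le_trace[OF x] unfolding abs_mult by (intro mult_mono f1 jet_basis jet_in x) auto
  have e: "K ^ 5 * ?w\<^sup>2 = K ^ 4 * ?w * (K * ?w)" by (simp add: power2_eq_square numeral_eq_Suc)
  have "K ^ 3 * ?w * 1 \<le> K ^ 4 * ?w * (K * ?w)"
    using K w by (intro mult_mono power_increasing) auto
  moreover have "K ^ 3 * ?w * K * 1 \<le> K ^ 4 * ?w * (K * ?w)"
  proof -
    have "K ^ 3 * ?w * K = K ^ 4 * ?w" by (simp add: numeral_eq_Suc)
    then show ?thesis using K w by (simp only:) (intro mult_left_mono, auto)
  qed
  moreover have "K * ?w * 1 \<le> K ^ 4 * ?w * (K * ?w)"
    using K w power_increasing[of 1 4 K] by (intro mult_mono) auto
  moreover have "K ^ 3 * ?w\<^sup>2 \<le> K ^ 5 * ?w\<^sup>2"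
    using K by (intro mult_right_mono power_increasing) auto
  moreover have "jet_partial2 k x - (\<Sum>i\<in>UNIV. dderiv (eslope i) f (jet u x) * T k k i x)
    = jet_partial (dderiv (ebase k) f) k x + jet_partial (dderiv evalue f) k x * pd k u x
      + dderiv evalue f (jet u x) * A x $ k $ k + (\<Sum>i\<in>UNIV. jet_partial (dderiv (eslope i) f) k x * A x $ k $ i)"
    by (simp add: jet_partial2_def sum.distrib)
  ultimately show ?thesis
    using 1 2 3 4 unfolding e[symmetric] abs_le_iff by (simp only: mult_1_right mult.assoc) linarith
qed

text \<open>\<open>third_order_bound\<close> is applied with \<open>p\<close> the slope derivatives
  of f. The losses 2250 = 30 * 75 from the first derivatives of the right-hand side, 27/2 from
  \<open>p\<close> and 78 = 3 * 26 from \<open>jet_partial2_bound\<close> stay below 2400.\<close>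

lemma trace_subsolution_square:
  assumes x: "x \<in> \<Omega>"
  shows "- (2400 * K ^ 7 * (trace (A x))\<^sup>2) \<le> (\<Sum>i\<in>UNIV. \<Sum>j\<in>UNIV. newton (A x) i j * W i j x)"
proof -
  let ?w = "trace (A x)"
  let ?p = "\<lambda>i. dderiv (eslope i) f (jet u x)"
  have s: "1 / sig2 (A x) \<le> K" "1 / sig2 (A x) > 0"
    using sig2_bounds[OF x] sig2_pos[OF x] K by (simp_all add: field_simps)
  have "- (30 / sig2 (A x)) * (\<Sum>k\<in>UNIV. (\<Sum>i\<in>UNIV. \<Sum>j\<in>UNIV. newton (A x) i j * T i j k x)\<^sup>2)
      - (9 / 2 * ?w\<^sup>2 / sig2 (A x)) * (\<Sum>k\<in>UNIV. (?p k)\<^sup>2)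
    \<le> (\<Sum>i\<in>UNIV. \<Sum>j\<in>UNIV. \<Sum>k\<in>UNIV. (T i j k x)\<^sup>2) - (\<Sum>k\<in>UNIV. (\<Sum>i\<in>UNIV. T i i k x)\<^sup>2)
      + (\<Sum>k\<in>UNIV. ?p k * (\<Sum>i\<in>UNIV. T i i k x))"
    by (rule third_order_bound[OF A_sym trace_pos sig2_pos T_commute]; fact x)
  then have 1: "- (30 * (1 / sig2 (A x)) * (\<Sum>k\<in>UNIV. (jet_partial f k x)\<^sup>2))
      - (9 / 2 * ?w\<^sup>2 * (1 / sig2 (A x))) * (\<Sum>k\<in>UNIV. (?p k)\<^sup>2)
    \<le> (\<Sum>i\<in>UNIV. \<Sum>j\<in>UNIV. \<Sum>k\<in>UNIV. (T i j k x)\<^sup>2) - (\<Sum>k\<in>UNIV. (t k x)\<^sup>2)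
      + (\<Sum>k\<in>UNIV. ?p k * t k x)"
    unfolding newton_T[OF x] t_def by simp
  have "(jet_partial f k x)\<^sup>2 \<le> (5 * K ^ 3 * ?w)\<^sup>2" for k
    using jet_partial_bound[OF x, of f k] f1[OF jet_in[OF x]] K trace_pos[OF x]
    by (intro abs_le_square_iff[THEN iffD1]) (auto simp: abs_mult)
  then have "(\<Sum>k\<in>UNIV. (jet_partial f k x)\<^sup>2) \<le> (\<Sum>k\<in>(UNIV::3 set). (5 * K ^ 3 * ?w)\<^sup>2)"
    by (intro sum_mono)
  also have "\<dots> = 75 * (K ^ 6 * ?w\<^sup>2)" by (simp add: power_mult_distrib)
  finally have "30 * (1 / sig2 (A x)) * (\<Sum>k\<in>UNIV. (jet_partial f k x)\<^sup>2) \<le> 30 * K * (75 * (K ^ 6 * ?w\<^sup>2))"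
    using s K by (intro mult_mono sum_nonneg) auto
  then have 2: "30 * (1 / sig2 (A x)) * (\<Sum>k\<in>UNIV. (jet_partial f k x)\<^sup>2) \<le> 2250 * (K ^ 7 * ?w\<^sup>2)"
    by (simp add: numeral_eq_Suc)
  have "(?p k)\<^sup>2 \<le> K\<^sup>2" for k
    using f1[OF jet_in[OF x] jet_basis(3)] K by (intro abs_le_square_iff[THEN iffD1]) auto
  then have "(\<Sum>k\<in>UNIV. (?p k)\<^sup>2) \<le> (\<Sum>k\<in>(UNIV::3 set). K\<^sup>2)"
    by (intro sum_mono)
  then have "(9 / 2 * ?w\<^sup>2 * (1 / sig2 (A x))) * (\<Sum>k\<in>UNIV. (?p k)\<^sup>2) \<le> (9 / 2 * ?w\<^sup>2 * K) * (3 * K\<^sup>2)"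
    using s K by (intro mult_mono sum_nonneg mult_left_mono) auto
  also have "\<dots> = 27 / 2 * (K ^ 3 * ?w\<^sup>2)" by (simp add: numeral_eq_Suc)
  also have "\<dots> \<le> 27 / 2 * (K ^ 7 * ?w\<^sup>2)"
    using K by (intro mult_left_mono mult_right_mono power_increasing) auto
  finally have 3: "(9 / 2 * ?w\<^sup>2 * (1 / sig2 (A x))) * (\<Sum>k\<in>UNIV. (?p k)\<^sup>2) \<le> 27 / 2 * (K ^ 7 * ?w\<^sup>2)" .
  have "(\<Sum>k\<in>UNIV. jet_partial2 k x) \<ge> (\<Sum>k\<in>UNIV. (\<Sum>i\<in>UNIV. ?p i * T k k i x) - 26 * K ^ 5 * ?w\<^sup>2)"
  proof (intro sum_mono)
    show "(\<Sum>i\<in>UNIV. ?p i * T k k i x) - 26 * K ^ 5 * ?w\<^sup>2 \<le> jet_partial2 k x" for k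
      using jet_partial2_bound[OF x, of k] by linarith
  qed
  moreover have "(\<Sum>k\<in>UNIV. \<Sum>i\<in>UNIV. ?p i * T k k i x) = (\<Sum>i\<in>UNIV. ?p i * t i x)"
    unfolding t_def sum_distrib_left by (rule sum.swap)
  ultimately have 4: "(\<Sum>k\<in>UNIV. jet_partial2 k x) \<ge> (\<Sum>i\<in>UNIV. ?p i * t i x) - 78 * (K ^ 5 * ?w\<^sup>2)"
    by (simp add: sum_subtractf)
  have 5: "K ^ 5 * ?w\<^sup>2 \<le> K ^ 7 * ?w\<^sup>2" "0 \<le> K ^ 7 * ?w\<^sup>2"
    using K by (auto intro!: mult_right_mono power_increasing)
  show ?thesis
    unfolding trace_equation[OF x] using 1 2 3 4 5 by linarith
qed

lemma trace_subsolution: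
  assumes x: "x \<in> \<Omega>"
  shows "- (3600 * K ^ 8 * trace (A x) * vol (A x)) \<le> (\<Sum>i\<in>UNIV. \<Sum>j\<in>UNIV. newton (A x) i j * W i j x)"
proof -
  have "2400 * K ^ 7 * (trace (A x))\<^sup>2 = 2400 * K ^ 7 * trace (A x) * trace (A x)"
    by (simp add: power2_eq_square)
  also have "\<dots> \<le> 2400 * K ^ 7 * trace (A x) * (3 / 2 * K * vol (A x))"
    using K trace_pos[OF x] trace_le_vol[OF x] by (intro mult_left_mono) auto
  also have "\<dots> = 3600 * K ^ 8 * trace (A x) * vol (A x)"
    by (simp add: numeral_eq_Suc)
  finally show ?thesis
    using trace_subsolution_square[OF x] by linarith
qed

section \<open>The squared distance on the graph of the gradient\<close>

text \<open>The coefficient f is frozen at \<open>y\<close>, so that it is not differentiated in the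
  first and second partials \<open>rho1\<close> and \<open>rho2\<close>; the price is the
  oscillation of f between \<open>x\<close> and \<open>y\<close>.\<close>

definition "rho y x = 1 / 2 * (f (jet u y) * (\<Sum>i\<in>UNIV. (x $ i - y $ i)\<^sup>2) + (\<Sum>k\<in>UNIV. (pd k u x - pd k u y)\<^sup>2))"
definition "rho1 y i x = f (jet u y) * (x $ i - y $ i) + (\<Sum>k\<in>UNIV. A x $ i $ k * (pd k u x - pd k u y))"
definition "rho2 y i j x = (if i = j then f (jet u y) else 0)
  + (\<Sum>k\<in>UNIV. T j i k x * (pd k u x - pd k u y) + A x $ i $ k * A x $ j $ k)"

lemma partials_slope:
  assumes "x \<in> \<Omega>"
  shows "has_partials (\<lambda>x. pd k u x - c) (\<lambda>i. A x $ i $ k) x"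
  using has_partials_diff[OF smooth_partials[OF smooth_on_pd[OF u] assms, of k] has_partials_const[of c x]]
  by (simp add: A_nth)

lemma partials_rho:
  assumes x: "x \<in> \<Omega>"
  shows "has_partials (rho y) (\<lambda>i. rho1 y i x) x"
proof -
  let ?c = "f (jet u y)"
  have 1: "has_partials (\<lambda>x. \<Sum>i\<in>UNIV. (x $ i - y $ i)\<^sup>2)
      (\<lambda>j. \<Sum>i\<in>UNIV. 2 * (x $ i - y $ i) * (if j = i then 1 else 0)) x"
    by (intro has_partials_sum has_partials_power2 has_partials_nth_diff)
  have 2: "has_partials (\<lambda>x. \<Sum>k\<in>UNIV. (pd k u x - pd k u y)\<^sup>2)
      (\<lambda>j. \<Sum>k\<in>UNIV. 2 * (pd k u x - pd k u y) * A x $ j $ k) x"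
    by (intro has_partials_sum has_partials_power2 partials_slope x)
  have 3: "has_partials (rho y) (\<lambda>j. 1 / 2 * (?c * (\<Sum>i\<in>UNIV. 2 * (x $ i - y $ i) * (if j = i then 1 else 0))
      + (\<Sum>k\<in>UNIV. 2 * (pd k u x - pd k u y) * A x $ j $ k))) x"
    unfolding rho_def[abs_def] by (rule has_partials_cmult[OF has_partials_add[OF has_partials_cmult[OF 1] 2]])
  have "(\<Sum>i\<in>UNIV. 2 * (x $ i - y $ i) * (if j = i then 1 else 0)) = 2 * (x $ j - y $ j)" for j
    using sum_delta_mult[of j "\<lambda>i. 2 * (x $ i - y $ i)"] by (simp only: mult.commute)
  moreover have "(\<Sum>k\<in>UNIV. 2 * (pd k u x - pd k u y) * A x $ j $ k)
      = 2 * (\<Sum>k\<in>UNIV. A x $ j $ k * (pd k u x - pd k u y))" for j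
    unfolding sum_distrib_left by (simp only: mult_ac)
  ultimately show ?thesis
    by (intro has_partials_eq[OF 3]) (simp add: rho1_def)
qed

lemma partials_rho1:
  assumes x: "x \<in> \<Omega>"
  shows "has_partials (rho1 y i) (\<lambda>j. rho2 y i j x) x"
proof -
  let ?c = "f (jet u y)"
  have 1: "has_partials (\<lambda>x. \<Sum>k\<in>UNIV. A x $ i $ k * (pd k u x - pd k u y))
      (\<lambda>j. \<Sum>k\<in>UNIV. T j i k x * (pd k u x - pd k u y) + A x $ i $ k * A x $ j $ k) x"
    by (intro has_partials_sum has_partials_mult partials_slope partials_A x)
  have 2: "has_partials (rho1 y i) (\<lambda>j. ?c * (if j = i then 1 else 0)
      + (\<Sum>k\<in>UNIV. T j i k x * (pd k u x - pd k u y) + A x $ i $ k * A x $ j $ k)) x"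
    unfolding rho1_def[abs_def] by (rule has_partials_add[OF has_partials_cmult[OF has_partials_nth_diff] 1])
  show ?thesis
    by (rule has_partials_eq[OF 2]) (auto simp: rho2_def)
qed

lemma rho_nonneg: "y \<in> \<Omega> \<Longrightarrow> 0 \<le> rho y x"
  using f_bounds(1)[OF jet_in, of y] K unfolding rho_def
  by (intro mult_nonneg_nonneg add_nonneg_nonneg sum_nonneg) (auto intro: order_trans[of 0 "1 / K"])

lemma rho_coordinates:
  assumes y: "y \<in> \<Omega>"
  shows "(x $ i - y $ i)\<^sup>2 \<le> K * (2 * rho y x)" "\<bar>x $ i - y $ i\<bar> \<le> K * sqrt (2 * rho y x)"
    "\<bar>pd i u x - pd i u y\<bar> \<le> sqrt (2 * rho y x)"
    "(norm (x - y))\<^sup>2 \<le> K * (2 * rho y x)"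
proof -
  let ?c = "f (jet u y)"
  let ?X = "\<Sum>i\<in>UNIV. (x $ i - y $ i)\<^sup>2" and ?Q = "\<Sum>k\<in>UNIV. (pd k u x - pd k u y)\<^sup>2"
  have c: "1 / K \<le> ?c" "?c > 0"
    using f_bounds(1)[OF jet_in[OF y]] K by (auto simp: less_le_trans[of 0 "1 / K"])
  have X: "(x $ i - y $ i)\<^sup>2 \<le> ?X" and Q: "(pd i u x - pd i u y)\<^sup>2 \<le> ?Q"
    by (rule member_le_sum[where f = "\<lambda>i. (x $ i - y $ i)\<^sup>2"] member_le_sum[where f = "\<lambda>k. (pd k u x - pd k u y)\<^sup>2"]; simp)+
  have X0: "?X \<ge> 0" "?Q \<ge> 0" by (auto intro: sum_nonneg)
  have r: "2 * rho y x = ?c * ?X + ?Q" by (simp add: rho_def)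
  have "1 / K * ?X \<le> ?c * ?X" using c X0 by (intro mult_right_mono)
  then have "?X / K \<le> 2 * rho y x" using r X0 by simp
  then have XK: "?X \<le> K * (2 * rho y x)" using K by (simp add: field_simps)
  show 1: "(x $ i - y $ i)\<^sup>2 \<le> K * (2 * rho y x)" using X XK by linarith
  show "(norm (x - y))\<^sup>2 \<le> K * (2 * rho y x)"
    using XK by (simp add: norm_vec_def L2_set_def sum_nonneg)
  have "K * (2 * rho y x) \<le> K\<^sup>2 * (2 * rho y x)"
    using K rho_nonneg[OF y] by (intro mult_right_mono) (auto simp: power2_eq_square)
  also have "\<dots> = (K * sqrt (2 * rho y x))\<^sup>2"
    using rho_nonneg[OF y] by (simp add: power_mult_distrib)
  finally have "(x $ i - y $ i)\<^sup>2 \<le> (K * sqrt (2 * rho y x))\<^sup>2" using 1 by linarith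
  then show "\<bar>x $ i - y $ i\<bar> \<le> K * sqrt (2 * rho y x)"
    using K rho_nonneg[OF y] by (subst (asm) power2_le_iff_abs_le) simp_all
  have "(pd i u x - pd i u y)\<^sup>2 \<le> 2 * rho y x"
    using Q r mult_nonneg_nonneg[OF less_imp_le[OF c(2)] X0(1)] by linarith
  then show "\<bar>pd i u x - pd i u y\<bar> \<le> sqrt (2 * rho y x)"
    by (intro real_le_rsqrt) simp
qed

text \<open>Mean value theorem along the segment between the two jets. Its inner points need not be
  jets of u, but the derivative bounds hold on all of the convex set
  \<open>\<Omega> \<times> UNIV\<close>. Base, value and slope increments contribute 3 each to the
  9.\<close>

lemma f_oscillation:
  assumes x: "x \<in> \<Omega>" and y: "y \<in> \<Omega>"
  shows "\<bar>f (jet u y) - sig2 (A x)\<bar> \<le> 9 * K ^ 3 * sqrt (2 * rho y x)"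
proof -
  let ?r = "sqrt (2 * rho y x)"
  have r: "?r \<ge> 0" using rho_nonneg[OF y] by simp
  have "\<bar>u x - u y\<bar> \<le> 3 * (K * (K * ?r))"
  proof (rule mean_value_bound[of \<Omega>])
    fix z assume z: "z \<in> \<Omega>"
    show "u differentiable (at z)" by (rule smooth_on_differentiable[OF u _ z]) simp
    have "\<bar>dderiv (x - y) u z\<bar> = \<bar>\<Sum>i\<in>UNIV. pd i u z * (x $ i - y $ i)\<bar>"
      by (simp only: has_partials_dderiv[OF smooth_partials[OF u z], of "x - y"] vector_minus_component)
    also have "\<dots> \<le> (\<Sum>i\<in>(UNIV::3 set). K * (K * ?r))"
    proof (intro order_trans[OF sum_abs] sum_mono)
      show "\<bar>pd i u z * (x $ i - y $ i)\<bar> \<le> K * (K * ?r)" for i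
        unfolding abs_mult using K by (intro mult_mono u1[OF z] rho_coordinates(2)[OF y]) auto
    qed
    finally show "\<bar>dderiv (x - y) u z\<bar> \<le> 3 * (K * (K * ?r))" by simp
  qed (use x y in auto)
  note du = this
  have conv: "convex (\<Omega> \<times> (UNIV :: (real \<times> (real ^ 3)) set))"
    by (intro convex_Times) auto
  have "\<bar>f (jet u x) - f (jet u y)\<bar> \<le> 9 * K ^ 3 * ?r"
  proof (rule mean_value_bound[OF conv, where g = f and x = "jet u x" and y = "jet u y"])
    fix z assume z: "z \<in> \<Omega> \<times> (UNIV :: (real \<times> (real ^ 3)) set)"
    show "f differentiable (at z)" by (rule f_diff[OF z])
    have d: "jet u x - jet u y = (x - y, u x - u y, grad u x - grad u y)" by simp
    have g: "(grad u x - grad u y) $ k = pd k u x - pd k u y" for k by (simp add: grad_def)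
    have "\<bar>\<Sum>k\<in>UNIV. dderiv (ebase k) f z * (x - y) $ k\<bar> \<le> (\<Sum>k\<in>(UNIV::3 set). K * (K * ?r))"
    proof (intro order_trans[OF sum_abs] sum_mono)
      show "\<bar>dderiv (ebase k) f z * (x - y) $ k\<bar> \<le> K * (K * ?r)" for k
        unfolding abs_mult vector_minus_component using K
        by (intro mult_mono f1[OF z jet_basis(1)] rho_coordinates(2)[OF y]) auto
    qed
    moreover have "\<bar>\<Sum>k\<in>UNIV. dderiv (eslope k) f z * (grad u x - grad u y) $ k\<bar> \<le> (\<Sum>k\<in>(UNIV::3 set). K * ?r)"
    proof (intro order_trans[OF sum_abs] sum_mono)
      show "\<bar>dderiv (eslope k) f z * (grad u x - grad u y) $ k\<bar> \<le> K * ?r" for k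
        unfolding abs_mult g using K
        by (intro mult_mono f1[OF z jet_basis(3)] rho_coordinates(3)[OF y]) auto
    qed
    moreover have "\<bar>dderiv evalue f z * (u x - u y)\<bar> \<le> K * (3 * (K * (K * ?r)))"
      unfolding abs_mult using K du by (intro mult_mono f1[OF z] jet_basis) auto
    ultimately have "\<bar>dderiv (jet u x - jet u y) f z\<bar> \<le> 3 * (K * (K * ?r)) + 3 * (K * ?r) + 3 * (K * (K * (K * ?r)))"
      unfolding d dderiv_expand_jet[OF f_diff(1)[OF z], of "x - y" "u x - u y" "grad u x - grad u y"] by simp
    moreover have "K * (K * ?r) \<le> K ^ 3 * ?r"
      using K r power_increasing[of 2 3 K] by (simp add: mult_right_mono power2_eq_square flip: mult.assoc)
    moreover have "K * ?r \<le> K ^ 3 * ?r"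
      using K r power_increasing[of 1 3 K] by (simp add: mult_right_mono)
    moreover have "K * (K * (K * ?r)) = K ^ 3 * ?r"
      by (simp add: power3_eq_cube)
    ultimately show "\<bar>dderiv (jet u x - jet u y) f z\<bar> \<le> 9 * K ^ 3 * ?r"
      by linarith
  qed (use x y in auto)
  then show ?thesis using eq[OF x] by linarith
qed

text \<open>After \<open>newton_trace\<close>, \<open>newton_square\<close> and
  \<open>newton_T\<close> only two errors are left: the oscillation of f against the trace (18) and
  the derivative of the right-hand side against the slope difference (15). Passing from the trace to
  \<open>vol\<close> turns 33 into 99/2.\<close>

lemma rho_operator:
  assumes x: "x \<in> \<Omega>" and y: "y \<in> \<Omega>"
  shows "\<bar>(\<Sum>i\<in>UNIV. \<Sum>j\<in>UNIV. newton (A x) i j * rho2 y i j x) - 3 * vol (A x)\<bar>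
    \<le> 50 * K ^ 4 * sqrt (2 * rho y x) * vol (A x)"
proof -
  let ?r = "sqrt (2 * rho y x)" and ?w = "trace (A x)" and ?c = "f (jet u y)"
  let ?q = "\<lambda>k. pd k u x - pd k u y"
  have r: "?r \<ge> 0" using rho_nonneg[OF y] by simp
  have w: "?w > 0" using trace_pos[OF x] .
  have "(\<Sum>i\<in>UNIV. \<Sum>j\<in>UNIV. newton (A x) i j * rho2 y i j x)
    = (\<Sum>i\<in>UNIV. \<Sum>j\<in>UNIV. newton (A x) i j * (if i = j then ?c else 0))
      + (\<Sum>i\<in>UNIV. \<Sum>j\<in>UNIV. newton (A x) i j * (\<Sum>k\<in>UNIV. T j i k x * ?q k))
      + (\<Sum>i\<in>UNIV. \<Sum>j\<in>UNIV. newton (A x) i j * (\<Sum>k\<in>UNIV. A x $ i $ k * A x $ j $ k))"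
    by (simp only: rho2_def distrib_left sum.distrib add.assoc)
  also have "(\<Sum>i\<in>UNIV. \<Sum>j\<in>UNIV. newton (A x) i j * (\<Sum>k\<in>UNIV. T j i k x * ?q k))
      = (\<Sum>k\<in>UNIV. jet_partial f k x * ?q k)"
  proof -
    have "(\<Sum>i\<in>UNIV. \<Sum>j\<in>UNIV. newton (A x) i j * (\<Sum>k\<in>UNIV. T j i k x * ?q k))
        = (\<Sum>i\<in>UNIV. \<Sum>j\<in>UNIV. \<Sum>k\<in>UNIV. newton (A x) i j * T i j k x * ?q k)"
      by (simp add: sum_distrib_left mult.assoc T_commute(1)[OF x, of _ _ _])
    also have "\<dots> = (\<Sum>i\<in>UNIV. \<Sum>k\<in>UNIV. \<Sum>j\<in>UNIV. newton (A x) i j * T i j k x * ?q k)"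
      by (intro sum.cong refl sum.swap)
    also have "\<dots> = (\<Sum>k\<in>UNIV. \<Sum>i\<in>UNIV. \<Sum>j\<in>UNIV. newton (A x) i j * T i j k x * ?q k)"
      by (rule sum.swap)
    finally show ?thesis
      unfolding newton_T[OF x, symmetric] sum_distrib_right .
  qed
  finally have L: "(\<Sum>i\<in>UNIV. \<Sum>j\<in>UNIV. newton (A x) i j * rho2 y i j x) - 3 * vol (A x)
      = 2 * ?w * (?c - sig2 (A x)) + (\<Sum>k\<in>UNIV. jet_partial f k x * ?q k)"
    unfolding newton_trace newton_square[OF A_sym[OF x]] by (simp add: algebra_simps)
  have "\<bar>\<Sum>k\<in>UNIV. jet_partial f k x * ?q k\<bar> \<le> (\<Sum>k\<in>(UNIV::3 set). 5 * K ^ 3 * ?w * ?r)"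
    using K w by (intro order_trans[OF sum_abs] sum_mono)
      (auto simp: abs_mult intro!: mult_mono jet_partial_bound[OF x] f1[OF jet_in[OF x]] rho_coordinates[OF y])
  moreover have "\<bar>2 * ?w * (?c - sig2 (A x))\<bar> \<le> 2 * ?w * (9 * K ^ 3 * ?r)"
    using w f_oscillation[OF x y] by (simp add: abs_mult)
  ultimately have "\<bar>(\<Sum>i\<in>UNIV. \<Sum>j\<in>UNIV. newton (A x) i j * rho2 y i j x) - 3 * vol (A x)\<bar> \<le> 33 * K ^ 3 * ?r * ?w"
    unfolding L by (simp add: algebra_simps)
  also have "\<dots> \<le> 33 * K ^ 3 * ?r * (3 / 2 * K * vol (A x))"
    using K r trace_le_vol[OF x] by (intro mult_left_mono) auto
  also have "\<dots> = 99 / 2 * (K ^ 4 * ?r * vol (A x))"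
    by (simp add: numeral_eq_Suc)
  also have "\<dots> \<le> 50 * (K ^ 4 * ?r * vol (A x))"
    using K r vol_pos[OF x] by (intro mult_right_mono) auto
  finally show ?thesis by (simp add: mult.assoc)
qed

lemma rho_gradient:
  assumes x: "x \<in> \<Omega>" and y: "y \<in> \<Omega>"
  shows "(\<Sum>i\<in>UNIV. \<Sum>j\<in>UNIV. newton (A x) i j * rho1 y i x * rho1 y j x)
    \<le> (1 + 27 * K ^ 4 * sqrt (2 * rho y x)) * vol (A x) * (2 * rho y x)"
proof -
  let ?r = "sqrt (2 * rho y x)" and ?w = "trace (A x)" and ?c = "f (jet u y)"
  have r: "?r \<ge> 0" using rho_nonneg[OF y] by simp
  have c: "?c > 0"
    using f_bounds(1)[OF jet_in[OF y]] K by (auto simp: less_le_trans[of 0 "1 / K"])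
  have "(\<Sum>i\<in>UNIV. \<Sum>j\<in>UNIV. newton (A x) i j * rho1 y i x * rho1 y j x)
     \<le> (vol (A x) + 2 * ?w * \<bar>?c - sig2 (A x)\<bar>) * (?c * (\<Sum>i\<in>UNIV. (x $ i - y $ i)\<^sup>2) + (\<Sum>i\<in>UNIV. (pd i u x - pd i u y)\<^sup>2))"
    unfolding rho1_def by (rule newton_gradient_bound[OF A_sym[OF x] trace_pos[OF x] sig2_pos[OF x] c])
  also have "\<dots> = (vol (A x) + 2 * ?w * \<bar>?c - sig2 (A x)\<bar>) * (2 * rho y x)"
    by (simp add: rho_def)
  also have "\<dots> \<le> (vol (A x) + 27 * K ^ 4 * ?r * vol (A x)) * (2 * rho y x)"
  proof (intro mult_right_mono add_left_mono)
    have "2 * ?w * \<bar>?c - sig2 (A x)\<bar> \<le> 2 * (3 / 2 * K * vol (A x)) * (9 * K ^ 3 * ?r)"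
      using trace_pos[OF x] trace_le_vol[OF x] f_oscillation[OF x y] K r vol_pos[OF x]
      by (intro mult_mono) auto
    also have "\<dots> = 27 * K ^ 4 * ?r * vol (A x)" by (simp add: numeral_eq_Suc)
    finally show "2 * ?w * \<bar>?c - sig2 (A x)\<bar> \<le> 27 * K ^ 4 * ?r * vol (A x)" .
  qed (use rho_nonneg[OF y] in auto)
  finally show ?thesis by (simp add: algebra_simps)
qed

end

section \<open>A truncated radial supersolution\<close>

text \<open>With z = \<open>zz e s\<close>, all radial functions below become polynomials in z,
  subject to the single relation z^4 (2 s + e) = 1.\<close>

definition zz :: "real \<Rightarrow> real \<Rightarrow> real" where
  "zz e s = (2 * s + e) powr (- 1 / 4)"

lemma zz_pos: "2 * s + e > 0 \<Longrightarrow> zz e s > 0"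
  by (simp add: zz_def)

lemma zz_pow4: "2 * s + e > 0 \<Longrightarrow> zz e s ^ 4 * (2 * s + e) = 1"
proof -
  assume p: "2 * s + e > 0"
  have "zz e s ^ 4 = (2 * s + e) powr (- 1)"
    using p by (simp add: zz_def powr_power)
  then show ?thesis using p by (simp add: powr_minus field_simps)
qed

lemma zz_antimono: "2 * s + e > 0 \<Longrightarrow> s \<le> s' \<Longrightarrow> e \<le> e' \<Longrightarrow> zz e' s' \<le> zz e s"
  unfolding zz_def by (intro powr_mono2') auto

lemma zz_deriv:
  assumes "2 * s + e > 0"
  shows "(zz e has_real_derivative - (1 / 2) * zz e s ^ 5) (at s)"
proof -
  have "(zz e has_real_derivative - 1 / 4 * (2 * s + e) powr (- 1 / 4 - 1) * 2) (at s)"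
    unfolding zz_def[abs_def] using assms by (auto intro!: derivative_eq_intros)
  moreover have "(2 * s + e) powr (- 1 / 4 - 1) = zz e s ^ 5"
    using assms by (simp add: zz_def powr_power)
  ultimately show ?thesis by simp
qed

text \<open>With \<open>\<tau> = 2 s + e\<close> and \<open>zz e s = \<tau>\<^bsup>-1/4\<^esup>\<close>, this is \<open>\<tau>\<^bsup>-1/2\<^esup> + B \<tau>\<^bsup>-1/4\<^esup>\<close>: a regularised
  fundamental solution in dimension three, corrected by a less singular term that absorbs the
  curvature errors.\<close>
definition green :: "real \<Rightarrow> real \<Rightarrow> real \<Rightarrow> real" where
  "green B e s = zz e s ^ 2 + B * zz e s"
definition green1 :: "real \<Rightarrow> real \<Rightarrow> real \<Rightarrow> real" where
  "green1 B e s = - (zz e s ^ 6) - B / 2 * zz e s ^ 5"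
definition green2 :: "real \<Rightarrow> real \<Rightarrow> real \<Rightarrow> real" where
  "green2 B e s = 3 * zz e s ^ 10 + 5 / 4 * B * zz e s ^ 9"

lemma green_deriv: "2 * s + e > 0 \<Longrightarrow> (green B e has_real_derivative green1 B e s) (at s)"
  unfolding green_def[abs_def]
  by (rule derivative_eq_intros zz_deriv refl | assumption)+ (simp add: green1_def numeral_eq_Suc)

lemma green1_deriv: "2 * s + e > 0 \<Longrightarrow> (green1 B e has_real_derivative green2 B e s) (at s)"
  unfolding green1_def[abs_def]
  by (rule derivative_eq_intros zz_deriv refl | assumption)+ (simp add: green2_def numeral_eq_Suc)

text \<open>The cut-off is obtained by subtracting the second Taylor polynomial at the cut-off radius,
  so that the extension by zero is \<open>C\<^sup>2\<close>.\<close>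
definition cutG :: "real \<Rightarrow> real \<Rightarrow> real \<Rightarrow> real \<Rightarrow> real" where
  "cutG B e a s = (if s \<le> a then green B e s - green B e a - green1 B e a * (s - a) - green2 B e a / 2 * (s - a)\<^sup>2 else 0)"
definition cutG1 :: "real \<Rightarrow> real \<Rightarrow> real \<Rightarrow> real \<Rightarrow> real" where
  "cutG1 B e a s = (if s \<le> a then green1 B e s - green1 B e a - green2 B e a * (s - a) else 0)"
definition cutG2 :: "real \<Rightarrow> real \<Rightarrow> real \<Rightarrow> real \<Rightarrow> real" where
  "cutG2 B e a s = (if s \<le> a then green2 B e s - green2 B e a else 0)"

text \<open>At the gluing point the difference quotient of the truncated function is dominated by
  that of \<open>p\<close>, which tends to 0.\<close>

lemma DERIV_cut_off:
  fixes p :: "real \<Rightarrow> real"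
  assumes p: "(p has_real_derivative p1) (at s)" and 0: "s = a \<Longrightarrow> p s = 0 \<and> p1 = 0"
  shows "((\<lambda>s. if s \<le> a then p s else 0) has_real_derivative (if s \<le> a then p1 else 0)) (at s)"
proof (cases s a rule: linorder_cases)
  case less
  have "eventually (\<lambda>x. x \<in> {..<a}) (nhds s)" by (rule eventually_nhds_in_open) (use less in auto)
  then have "eventually (\<lambda>x. p x = (if x \<le> a then p x else 0)) (nhds s)"
    by eventually_elim auto
  from DERIV_cong_ev[OF refl this refl] show ?thesis using p less by simp
next
  case greater
  have "eventually (\<lambda>x. x \<in> {a<..}) (nhds s)" by (rule eventually_nhds_in_open) (use greater in auto)
  then have "eventually (\<lambda>x. 0 = (if x \<le> a then p x else 0)) (nhds s)"
    by eventually_elim auto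
  from DERIV_cong_ev[OF refl this refl, of 0] show ?thesis using greater by simp
next
  case equal
  have p0: "p a = 0" "p1 = 0" using 0[OF equal] equal by auto
  have "((\<lambda>h. p (a + h) / h) \<longlongrightarrow> 0) (at 0)"
    using p p0 equal by (simp add: DERIV_def)
  then have "((\<lambda>h. ((if a + h \<le> a then p (a + h) else 0) - 0) / h) \<longlongrightarrow> 0) (at 0)"
    by (rule Lim_null_comparison[rotated, OF tendsto_rabs_zero]) auto
  then show ?thesis
    unfolding equal by (simp add: DERIV_def p0)
qed

lemma cutG_deriv:
  assumes "e > 0" "s \<ge> 0"
  shows "(cutG B e a has_real_derivative cutG1 B e a s) (at s)"
proof -
  have "2 * s + e > 0" using assms by simp
  from green_deriv[OF this]
  have "((\<lambda>s. green B e s - green B e a - green1 B e a * (s - a) - green2 B e a / 2 * (s - a)\<^sup>2) has_real_derivative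
    green1 B e s - green1 B e a - green2 B e a * (s - a)) (at s)"
    by (auto intro!: derivative_eq_intros)
  from DERIV_cut_off[OF this] show ?thesis
    unfolding cutG_def[abs_def] cutG1_def by simp
qed

lemma cutG1_deriv:
  assumes "e > 0" "s \<ge> 0"
  shows "(cutG1 B e a has_real_derivative cutG2 B e a s) (at s)"
proof -
  have "2 * s + e > 0" using assms by simp
  from green1_deriv[OF this]
  have "((\<lambda>s. green1 B e s - green1 B e a - green2 B e a * (s - a)) has_real_derivative
    green2 B e s - green2 B e a) (at s)"
    by (auto intro!: derivative_eq_intros)
  from DERIV_cut_off[OF this] show ?thesis
    unfolding cutG1_def[abs_def] cutG2_def by simp
qed

lemma zz_cont: "e > 0 \<Longrightarrow> continuous_on {0..} (zz e)"
  unfolding zz_def[abs_def] by (intro continuous_intros) auto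

lemma cutG2_cont:
  assumes "e > 0"
  shows "continuous_on {0..} (cutG2 B e a)"
proof -
  have c: "continuous_on {0..} (green2 B e)"
    unfolding green2_def[abs_def] using zz_cont[OF assms] by (intro continuous_intros)
  have "continuous_on ({0..a} \<union> {max 0 a..}) (cutG2 B e a)"
    unfolding cutG2_def[abs_def]
    by (rule continuous_on_cases) (auto intro!: continuous_intros continuous_on_subset[OF c])
  moreover have "{0..a} \<union> {max 0 a..} = {0..}" by auto
  ultimately show ?thesis by simp
qed

lemma green_sign:
  assumes "B \<ge> 0" "2 * s + e > 0"
  shows "green B e s \<ge> 0" "green1 B e s \<le> 0" "green2 B e s \<ge> 0"
proof -
  have z: "zz e s > 0" using assms zz_pos by blast
  then have "0 \<le> zz e s ^ 6 + B / 2 * zz e s ^ 5" using assms by simp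
  then show "green1 B e s \<le> 0" by (simp add: green1_def)
  show "green B e s \<ge> 0" "green2 B e s \<ge> 0"
    using z assms by (simp_all add: green_def green2_def)
qed

lemma cutG2_nonneg:
  assumes "B \<ge> 0" "e > 0" "s \<ge> 0"
  shows "cutG2 B e a s \<ge> 0"
proof (cases "s \<le> a")
  case True
  have z: "zz e a \<le> zz e s" "zz e a \<ge> 0"
    using assms True zz_antimono[of s e a e] zz_pos[of a e] by auto
  have "green2 B e a \<le> green2 B e s"
    unfolding green2_def using assms z by (intro add_mono mult_left_mono power_mono) auto
  then show ?thesis by (simp add: cutG2_def)
qed (simp add: cutG2_def)

text \<open>The derivative \<open>cutG2\<close> is nonnegative and the value at \<open>a\<close> is
  0. The signs of the three functions decide which one-sided estimates suffice: L \<rho> from below,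
  F(D\<rho>, D\<rho>) from above, L \<sigma>1 from below.\<close>

lemma cutG1_nonpos:
  assumes "B \<ge> 0" "e > 0" "s \<ge> 0"
  shows "cutG1 B e a s \<le> 0"
proof (cases "s \<le> a")
  case True
  have "cutG1 B e a s \<le> cutG1 B e a a"
    using assms cutG2_nonneg cutG1_deriv by (intro DERIV_nonneg_imp_nondecreasing[OF True]) (metis order_trans)
  then show ?thesis by (simp add: cutG1_def)
qed (simp add: cutG1_def)

lemma cutG_nonneg:
  assumes "B \<ge> 0" "e > 0" "s \<ge> 0"
  shows "cutG B e a s \<ge> 0"
proof (cases "s \<le> a")
  case True
  have "cutG B e a a \<le> cutG B e a s"
    using assms cutG1_nonpos cutG_deriv by (intro DERIV_nonpos_imp_nonincreasing[OF True]) (metis order_trans)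
  then show ?thesis by (simp add: cutG_def)
qed (simp add: cutG_def)

text \<open>Bounds three times what the truncation adds to \<open>green1\<close> when B = 64 C.
  Taking \<open>zz\<close> at e = 0, where it is largest, makes the bound uniform in e.\<close>

definition cut_error :: "real \<Rightarrow> real \<Rightarrow> real" where
  "cut_error C a = 3 * (zz 0 a ^ 6 + 32 * C * zz 0 a ^ 5 + (3 * zz 0 a ^ 10 + 80 * C * zz 0 a ^ 9) * a)"

text \<open>For s = |x|^2 / 2 in three-space, 3 \<phi>' + 2 s \<phi>'' is the Laplacian of
  \<phi>(s); for the part z^2 it equals - 3 e z^10. The corrector contributes (- 3/2 + 5/4) B z^5 =
  - 16 C z^5 and a nonpositive term, while the errors amount to (4 + 8 + 1 + 1) C z^5.\<close>

lemma green_ode: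
  assumes C: "C \<ge> 1" and a: "a \<le> 1 / (400 * C\<^sup>2)" and e: "0 < e" "e \<le> 2 * a" and s: "0 \<le> s" "s \<le> a"
  defines "r \<equiv> sqrt (2 * s)" and "B \<equiv> 64 * C"
  shows "14 * C * r \<le> 1"
    and "(3 - C * r) * green1 B e s + (1 + C * r) * (2 * s) * green2 B e s + C * green B e s \<le> - (3 * e * zz e s ^ 10)"
proof -
  define z where "z = zz e s"
  let ?\<tau> = "2 * s + e"
  have \<tau>: "?\<tau> > 0" using e s by simp
  have z: "z > 0" "z ^ 4 * ?\<tau> = 1" using zz_pos[OF \<tau>] zz_pow4[OF \<tau>] by (auto simp: z_def)
  have r: "r \<ge> 0" "r\<^sup>2 = 2 * s" using s by (auto simp: r_def)
  \<comment> \<open>The 400 serves two purposes: it exceeds 392 = 2 * 14^2, which makes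
    \<open>C * r\<close> small, and 256 = 64 * 4, which makes z^4 at least 64 C because 2 s + e
    \<le> 4 a.\<close>
  have Ca: "400 * C\<^sup>2 * a \<le> 1"
    using a C by (simp add: field_simps)
  have "(14 * C * r)\<^sup>2 = 392 * C\<^sup>2 * s"
    using r by (simp add: power_mult_distrib)
  also have "\<dots> \<le> 400 * C\<^sup>2 * a"
    using s C by (intro mult_mono) auto
  also have "\<dots> \<le> 1\<^sup>2" using Ca by simp
  finally show Cr: "14 * C * r \<le> 1"
    by (rule power2_le_imp_le) simp
  have "(r * z\<^sup>2)\<^sup>2 = 2 * s * z ^ 4"
    using r by (simp add: power_mult_distrib)
  also have "\<dots> = 1 - e * z ^ 4"
    using z(2) by (simp add: algebra_simps)
  also have "\<dots> \<le> 1\<^sup>2"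
    using z e by simp
  finally have rz: "r * z\<^sup>2 \<le> 1"
    by (rule power2_le_imp_le) simp
  have "64 * C * ?\<tau> \<le> 64 * C * (4 * a)"
    using s e C by (intro mult_left_mono) auto
  also have "\<dots> \<le> 400 * C\<^sup>2 * a"
  proof -
    have "256 * C * a \<le> 400 * C\<^sup>2 * a"
      using C s by (intro mult_right_mono) (auto simp: power2_eq_square intro: order_trans[of _ "400 * C"])
    then show ?thesis by simp
  qed
  also note Ca
  finally have C\<tau>: "64 * C * ?\<tau> \<le> 1" .
  have z4: "64 * C \<le> z ^ 4"
  proof -
    have "z ^ 4 * (64 * C * ?\<tau>) \<le> z ^ 4 * 1"
      using C\<tau> z(1) by (intro mult_left_mono) auto
    moreover have "z ^ 4 * (64 * C * ?\<tau>) = 64 * C * (z ^ 4 * ?\<tau>)"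
      by (simp only: mult_ac)
    ultimately show ?thesis unfolding z(2) by simp
  qed
  have z1: "z \<ge> 1"
  proof (rule ccontr)
    assume "\<not> z \<ge> 1"
    then have "z ^ 4 \<le> 1" using z by (intro power_le_one) auto
    then show False using z4 C by linarith
  qed
  have e1: "2 * s * z ^ 10 = z ^ 6 - e * z ^ 10" "2 * s * z ^ 9 = z ^ 5 - e * z ^ 9"
  proof -
    have "z ^ 6 = z ^ 6 * (z ^ 4 * ?\<tau>)" "z ^ 5 = z ^ 5 * (z ^ 4 * ?\<tau>)" unfolding z(2) by simp_all
    then show "2 * s * z ^ 10 = z ^ 6 - e * z ^ 10" "2 * s * z ^ 9 = z ^ 5 - e * z ^ 9"
      by (simp_all add: algebra_simps flip: power_add)
  qed
  have pos: "e * z ^ 10 \<ge> 0" "e * z ^ 9 \<ge> 0" "C * r * (e * z ^ 10) \<ge> 0" "C * r * (C * (e * z ^ 9)) \<ge> 0" "C * (e * z ^ 9) \<ge> 0"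
    using e z C r by auto
  have "(3 - C * r) * green1 B e s + (1 + C * r) * (2 * s) * green2 B e s + C * green B e s
    = (3 - C * r) * (- (z ^ 6) - 32 * C * z ^ 5) + (1 + C * r) * (3 * (2 * s * z ^ 10) + 80 * C * (2 * s * z ^ 9))
      + C * (z\<^sup>2 + 64 * C * z)"
    by (simp add: green_def green1_def green2_def B_def z_def algebra_simps)
  also have "\<dots> = - (3 * (e * z ^ 10)) + 4 * (C * (r * z ^ 6)) - 16 * (C * z ^ 5) + 112 * (C * r * (C * z ^ 5)) + C * z\<^sup>2 + 64 * C * (C * z)
     - 80 * (C * (e * z ^ 9)) - 3 * (C * r * (e * z ^ 10)) - 80 * (C * r * (C * (e * z ^ 9)))"
    unfolding e1 by (simp add: algebra_simps)
  also have "\<dots> \<le> - (3 * (e * z ^ 10)) + 4 * (C * (r * z ^ 6)) - 16 * (C * z ^ 5) + 112 * (C * r * (C * z ^ 5)) + C * z\<^sup>2 + 64 * C * (C * z)"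
    using pos by linarith
  also have "\<dots> \<le> - (3 * (e * z ^ 10))"
  proof -
    have "r * z ^ 6 = (r * z\<^sup>2) * z ^ 4" by (simp add: mult.assoc flip: power_add)
    also have "\<dots> \<le> 1 * z ^ 4" using rz z by (intro mult_right_mono) auto
    also have "\<dots> \<le> z ^ 5" using z1 by (simp add: power_increasing)
    finally have 1: "C * (r * z ^ 6) \<le> C * z ^ 5" using C by (intro mult_left_mono) auto
    have 2: "112 * (C * r * (C * z ^ 5)) \<le> 8 * (C * z ^ 5)"
      using mult_right_mono[OF Cr, of "C * z ^ 5"] C z by (simp add: mult_ac)
    have 3: "C * z\<^sup>2 \<le> C * z ^ 5"
      using C z1 by (intro mult_left_mono power_increasing) auto
    have "64 * C * (C * z) \<le> z ^ 4 * (C * z)"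
      using z4 C z by (intro mult_right_mono) auto
    then have 4: "64 * C * (C * z) \<le> C * z ^ 5"
      by (simp add: numeral_eq_Suc mult_ac)
    have "C * z ^ 5 \<ge> 0" using C z by simp
    then show ?thesis using 1 2 3 4 by linarith
  qed
  finally show "(3 - C * r) * green1 B e s + (1 + C * r) * (2 * s) * green2 B e s + C * green B e s \<le> - (3 * e * zz e s ^ 10)"
    by (simp add: z_def)
qed

text \<open>Truncation only decreases the function and its second derivative. The first derivative
  gains a nonnegative amount \<open>H\<close>, and its contribution is what \<open>cut_error\<close>
  bounds.\<close>

lemma cutG_supersolution:
  assumes C: "C \<ge> 1" and a: "0 < a" "a \<le> 1 / (400 * C\<^sup>2)" and e: "0 < e" "e \<le> 2 * a" and s: "0 \<le> s" "s \<le> a"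
    and V: "V \<ge> 0" and L: "(3 - C * sqrt (2 * s)) * V \<le> L"
    and Q: "Q \<le> (1 + C * sqrt (2 * s)) * V * (2 * s)"
  shows "cutG1 (64 * C) e a s * L + cutG2 (64 * C) e a s * Q + C * cutG (64 * C) e a s * V
    \<le> (cut_error C a - 3 * e * zz e s ^ 10) * V"
proof -
  let ?B = "64 * C" and ?r = "sqrt (2 * s)"
  have B: "?B \<ge> 0" using C by simp
  have r: "?r \<ge> 0" "14 * C * ?r \<le> 1"
    using s green_ode(1)[OF C a(2) e s] by auto
  have Cr: "0 \<le> C * ?r" "C * ?r \<le> 1" using r C by auto
  have a0: "2 * a + e > 0" using a e by simp
  note s0 = green_sign[OF B a0]
  have s2: "green2 ?B e s \<ge> 0" using green_sign(3)[OF B, of s e] e s by simp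
  define H where "H = - green1 ?B e a + green2 ?B e a * (a - s)"
  have 1: "cutG1 ?B e a s * L \<le> cutG1 ?B e a s * ((3 - C * ?r) * V)"
    using cutG1_nonpos[OF B e(1) s(1)] L by (intro mult_left_mono_neg)
  have 2: "cutG2 ?B e a s * Q \<le> cutG2 ?B e a s * ((1 + C * ?r) * V * (2 * s))"
    using cutG2_nonneg[OF B e(1) s(1)] Q by (intro mult_left_mono)
  have 3: "(3 - C * ?r) * cutG1 ?B e a s \<le> (3 - C * ?r) * green1 ?B e s + cut_error C a"
  proof -
    have "green2 ?B e a * (a - s) \<ge> 0" using s0 s by simp
    then have "H \<ge> 0" using s0 by (simp add: H_def)
    then have "(3 - C * ?r) * H \<le> 3 * H" using Cr by (intro mult_right_mono) auto
    also have "3 * H \<le> cut_error C a"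
    proof -
      have z: "0 \<le> zz e a" "zz e a \<le> zz 0 a"
        using zz_pos[OF a0] zz_antimono[of a 0 a e] a e by auto
      have "green2 ?B e a * (a - s) \<le> green2 ?B e a * a"
        using s0 s by (intro mult_left_mono) auto
      also have "\<dots> \<le> (3 * zz 0 a ^ 10 + 80 * C * zz 0 a ^ 9) * a"
        unfolding green2_def using z C a by (intro mult_right_mono add_mono) (auto intro!: mult_mono power_mono)
      finally have G2: "green2 ?B e a * (a - s) \<le> (3 * zz 0 a ^ 10 + 80 * C * zz 0 a ^ 9) * a" .
      have G1: "- green1 ?B e a \<le> zz 0 a ^ 6 + 32 * C * zz 0 a ^ 5"
        unfolding green1_def using add_mono[of "zz e a ^ 6" "zz 0 a ^ 6" "32 * C * zz e a ^ 5" "32 * C * zz 0 a ^ 5"] z C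
        by (simp add: power_mono mult_left_mono)
      show ?thesis
        unfolding H_def cut_error_def by (rule mult_left_mono[OF add_mono[OF G1 G2]]) simp
    qed
    finally have "(3 - C * ?r) * H \<le> cut_error C a" .
    moreover have "cutG1 ?B e a s = green1 ?B e s + H"
      using s by (simp add: cutG1_def H_def algebra_simps)
    ultimately show ?thesis by (simp add: distrib_left)
  qed
  have 4: "(1 + C * ?r) * (2 * s) * cutG2 ?B e a s \<le> (1 + C * ?r) * (2 * s) * green2 ?B e s"
    using s0 s Cr by (intro mult_left_mono) (auto simp: cutG2_def)
  have "cutG ?B e a s \<le> green ?B e s"
  proof -
    have "0 \<le> green1 ?B e a * (s - a)" "0 \<le> green2 ?B e a / 2 * (s - a)\<^sup>2"
      using s0 s by (auto intro: mult_nonpos_nonpos)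
    then show ?thesis using s s0(1) unfolding cutG_def by simp
  qed
  then have 5: "C * cutG ?B e a s \<le> C * green ?B e s"
    using C by (intro mult_left_mono) auto
  have "(3 - C * ?r) * cutG1 ?B e a s + (1 + C * ?r) * (2 * s) * cutG2 ?B e a s + C * cutG ?B e a s
    \<le> cut_error C a - 3 * e * zz e s ^ 10"
    using 3 4 5 green_ode(2)[OF C a(2) e s] by linarith
  from mult_right_mono[OF this V] show ?thesis
    using 1 2 by (simp add: algebra_simps)
qed

section \<open>The mean value inequality\<close>

text \<open>Pointwise Green identity, with \<open>p0\<close>, \<open>p1\<close>, \<open>p2\<close>
  the radial function and its derivatives at \<rho>. The terms with \<open>Z\<close> cancel because
  the Newton tensor is divergence-free; the mixed products of \<open>t\<close> and \<open>r\<close>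
  cancel because \<open>N\<close> is symmetric.\<close>

lemma divergence_expansion:
  fixes N R W :: "3 \<Rightarrow> 3 \<Rightarrow> real" and S :: "3 \<Rightarrow> 3 \<Rightarrow> 3 \<Rightarrow> real" and r t Z :: "3 \<Rightarrow> real"
  assumes N: "\<And>i j. N i j = N j i" and t: "\<And>j. t j = (\<Sum>i\<in>UNIV. S i i j)"
  shows "(\<Sum>i\<in>UNIV. \<Sum>j\<in>UNIV. ((if i = j then t i else 0) - S i i j) * Z j
      + N i j * (t i * (p1 * r j) + w * (p2 * r i * r j + p1 * R j i) - (p1 * r i * t j + p0 * W i j)))
    = w * (p1 * (\<Sum>i\<in>UNIV. \<Sum>j\<in>UNIV. N i j * R i j) + p2 * (\<Sum>i\<in>UNIV. \<Sum>j\<in>UNIV. N i j * r i * r j))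
      - p0 * (\<Sum>i\<in>UNIV. \<Sum>j\<in>UNIV. N i j * W i j)"
proof -
  have "(\<Sum>i\<in>UNIV. \<Sum>j\<in>UNIV. ((if i = j then t i else 0) - S i i j) * Z j) = 0"
    unfolding t sum_3 by (simp add: algebra_simps)
  moreover have "N i j * (t i * (p1 * r j) + w * (p2 * r i * r j + p1 * R j i) - (p1 * r i * t j + p0 * W i j))
      = p1 * (N i j * t i * r j) - p1 * (N i j * r i * t j) + w * (p1 * (N i j * R j i))
        + w * (p2 * (N i j * r i * r j)) - p0 * (N i j * W i j)" for i j
    by (simp add: algebra_simps)
  moreover have "(\<Sum>i\<in>UNIV. \<Sum>j\<in>UNIV. N i j * t i * r j) = (\<Sum>i\<in>UNIV. \<Sum>j\<in>UNIV. N i j * r i * t j)"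
    unfolding sum_3 N[of 2 1] N[of 3 1] N[of 3 2] by simp
  moreover have "(\<Sum>i\<in>UNIV. \<Sum>j\<in>UNIV. N i j * R j i) = (\<Sum>i\<in>UNIV. \<Sum>j\<in>UNIV. N i j * R i j)"
    unfolding sum_3 N[of 2 1] N[of 3 1] N[of 3 2] by simp
  ultimately show ?thesis
    by (simp only: sum.distrib sum_subtractf sum_distrib_left[symmetric]) (simp add: distrib_left)
qed

lemma measure_affine_ball_image:
  fixes M :: "real ^ 3 ^ 3" and y :: "real ^ 3"
  assumes "det M \<noteq> 0" "d > 0"
  defines "S \<equiv> (\<lambda>h. y + M *v h) ` ball 0 d"
  shows "open S" "measure lborel S = \<bar>det M\<bar> * (4 / 3 * pi * d ^ 3)"
proof -
  have S: "S = (+) y ` ((*v) M ` ball 0 d)" unfolding S_def by (simp add: image_image)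
  have lin: "linear ((*v) M)" by (rule matrix_vector_mul_linear)
  have "surj ((*v) M)"
    using assms(1) by (metis invertible_det_nz invertible_eq_bij bij_is_surj)
  then show op: "open S"
    unfolding S by (intro open_translation open_surjective_linear_image lin) auto
  then have "measure lborel S = measure lebesgue S" by simp
  also have "\<dots> = \<bar>det M\<bar> * measure lebesgue (ball (0 :: real ^ 3) d)"
    unfolding S measure_translation using measure_linear_image[OF lin, of "ball 0 d"] by simp
  also have "measure lebesgue (ball (0 :: real ^ 3) d) = 4 / 3 * pi * d ^ 3"
    using sphere_volume[of d 0] assms(2) by simp
  finally show "measure lborel S = \<bar>det M\<bar> * (4 / 3 * pi * d ^ 3)" .
qed

context sigma2_pde
begin

lemma continuous_on_smooth: "smooth_on \<Omega> g \<Longrightarrow> S \<subseteq> \<Omega> \<Longrightarrow> continuous_on S g"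
  by (rule continuous_on_subset[OF smooth_on_continuous])

lemma continuous_on_A: "S \<subseteq> \<Omega> \<Longrightarrow> continuous_on S (\<lambda>x. A x $ i $ j)"
  unfolding A_nth by (rule continuous_on_smooth[OF smooth2])

lemma continuous_on_trace: "S \<subseteq> \<Omega> \<Longrightarrow> continuous_on S (\<lambda>x. trace (A x))"
  unfolding trace_A by (intro continuous_on_sum continuous_on_smooth[OF smooth2])

lemma continuous_on_vol: "S \<subseteq> \<Omega> \<Longrightarrow> continuous_on S (\<lambda>x. vol (A x))"
  unfolding vol_def sig2_def det_3
  by (intro continuous_on_diff continuous_on_mult continuous_on_add continuous_on_divide continuous_on_power
      continuous_on_sum continuous_on_const continuous_on_trace continuous_on_A) auto

lemma continuous_on_T: "S \<subseteq> \<Omega> \<Longrightarrow> continuous_on S (T i j k)"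
  by (rule continuous_on_smooth[OF smooth3])

lemma continuous_on_t: "S \<subseteq> \<Omega> \<Longrightarrow> continuous_on S (t k)"
  unfolding t_def[abs_def] by (intro continuous_on_sum continuous_on_T)

lemma continuous_on_W: "S \<subseteq> \<Omega> \<Longrightarrow> continuous_on S (W i j)"
  unfolding W_def[abs_def] by (intro continuous_on_sum continuous_on_smooth smooth_on_pd u)

lemma continuous_on_newton: "S \<subseteq> \<Omega> \<Longrightarrow> continuous_on S (\<lambda>x. newton (A x) i j)"
  unfolding newton_def
  by (cases "i = j") (auto intro!: continuous_on_diff continuous_on_minus continuous_on_trace continuous_on_A)

lemma continuous_on_slope: "S \<subseteq> \<Omega> \<Longrightarrow> continuous_on S (pd k u)"
  by (intro continuous_on_smooth smooth_on_pd u)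

lemma continuous_on_rho:
  assumes "S \<subseteq> \<Omega>"
  shows "continuous_on S (rho y)" "continuous_on S (rho1 y i)" "continuous_on S (rho2 y i j)"
  unfolding rho_def[abs_def] rho1_def[abs_def] rho2_def[abs_def]
  by (intro continuous_on_diff continuous_on_mult continuous_on_add continuous_on_power continuous_on_sum
      continuous_on_const continuous_on_component continuous_on_id continuous_on_A continuous_on_T
      continuous_on_slope assms)+

lemma partials_newton:
  assumes "x \<in> \<Omega>"
  shows "has_partials (\<lambda>x. newton (A x) i j) (\<lambda>l. (if i = j then t l x else 0) - T l i j x) x"
proof (cases "i = j")
  case True
  have "has_partials (\<lambda>x. trace (A x) - A x $ i $ j) (\<lambda>l. t l x - T l i j x) x"
    by (intro has_partials_diff partials_trace partials_A assms)
  then show ?thesis using True by (simp add: newton_def)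
next
  case False
  have "has_partials (\<lambda>x. 0 - A x $ i $ j) (\<lambda>l. 0 - T l i j x) x"
    by (intro has_partials_diff has_partials_const partials_A assms)
  then show ?thesis using False by (simp add: newton_def)
qed

definition "Lrho y x = (\<Sum>i\<in>UNIV. \<Sum>j\<in>UNIV. newton (A x) i j * rho2 y i j x)"
definition "Qrho y x = (\<Sum>i\<in>UNIV. \<Sum>j\<in>UNIV. newton (A x) i j * rho1 y i x * rho1 y j x)"
definition "Ltrace x = (\<Sum>i\<in>UNIV. \<Sum>j\<in>UNIV. newton (A x) i j * W i j x)"

text \<open>Gives the truncated function compact support in the unit ball around
  \<open>y\<close>.\<close>

lemma rho_small_close:
  assumes y: "y \<in> cball 0 1" and a: "8 * K * a \<le> 1" and x: "rho y x \<le> a"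
  shows "x \<in> cball y (1 / 2)"
proof -
  have "(norm (x - y))\<^sup>2 \<le> K * (2 * rho y x)"
    using rho_coordinates(4)[of y x] y by simp
  also have "\<dots> \<le> K * (2 * a)" using x K by (intro mult_left_mono) auto
  also have "\<dots> \<le> (1 / 2)\<^sup>2" using a by (simp add: power2_eq_square)
  finally have "norm (x - y) \<le> 1 / 2" by (rule power2_le_imp_le) simp
  then show ?thesis by (simp add: dist_norm norm_minus_commute)
qed

lemma ball_subset: "y \<in> cball 0 1 \<Longrightarrow> ball y 1 \<subseteq> \<Omega>"
proof
  fix x assume "y \<in> cball 0 1" "x \<in> ball y 1"
  then show "x \<in> \<Omega>" using norm_triangle_ineq2[of x y] by (simp add: dist_norm norm_minus_commute)
qed

lemma green_identity:
  fixes B e a :: real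
  assumes y: "y \<in> cball 0 1" and e: "e > 0" and a: "8 * K * a \<le> 1"
  defines "D \<equiv> \<lambda>x. trace (A x) * (cutG1 B e a (rho y x) * Lrho y x + cutG2 B e a (rho y x) * Qrho y x)
    - cutG B e a (rho y x) * Ltrace x"
  shows "set_integrable lborel (ball y 1) D" "(LINT x:ball y 1|lborel. D x) = 0"
proof -
  note sub = ball_subset[OF y]
  have y': "y \<in> \<Omega>" using y by simp
  note r0 = rho_nonneg[OF y']
  let ?P0 = "\<lambda>x. cutG B e a (rho y x)" and ?P1 = "\<lambda>x. cutG1 B e a (rho y x)" and ?P2 = "\<lambda>x. cutG2 B e a (rho y x)"
  \<comment> \<open>The field w D\<phi> - \<phi> Dw for the trace w and \<phi> = \<open>cutG\<close>
    of \<rho>; the Newton tensor turns it into the flux \<open>X\<close>.\<close>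
  define Z where "Z j x = trace (A x) * (?P1 x * rho1 y j x) - ?P0 x * t j x" for j x
  define X where "X i x = (\<Sum>j\<in>UNIV. newton (A x) i j * Z j x)" for i x
  define G where "G i x l = (\<Sum>j\<in>UNIV. ((if i = j then t l x else 0) - T l i j x) * Z j x
     + newton (A x) i j * (t l x * (?P1 x * rho1 y j x) + trace (A x) * (?P2 x * rho1 y l x * rho1 y j x + ?P1 x * rho2 y j l x)
        - (?P1 x * rho1 y l x * t j x + ?P0 x * W l j x)))" for i x l
  have p0: "has_partials ?P0 (\<lambda>l. ?P1 x * rho1 y l x) x" if "x \<in> \<Omega>" for x
    by (rule has_partials_compose[OF cutG_deriv[OF e r0] partials_rho[OF that]])
  have p1: "has_partials ?P1 (\<lambda>l. ?P2 x * rho1 y l x) x" if "x \<in> \<Omega>" for x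
    by (rule has_partials_compose[OF cutG1_deriv[OF e r0] partials_rho[OF that]])
  have pZ: "has_partials (Z j) (\<lambda>l. t l x * (?P1 x * rho1 y j x)
      + trace (A x) * (?P2 x * rho1 y l x * rho1 y j x + ?P1 x * rho2 y j l x)
        - (?P1 x * rho1 y l x * t j x + ?P0 x * W l j x)) x" if "x \<in> \<Omega>" for j x
    unfolding Z_def[abs_def]
    by (rule has_partials_diff[OF has_partials_mult[OF partials_trace[OF that] has_partials_mult[OF p1[OF that] partials_rho1[OF that]]]
      has_partials_mult[OF p0[OF that] partials_t[OF that]]])
  have part: "has_partials (X i) (G i x) x" if "x \<in> ball y 1" for i x
  proof -
    have x: "x \<in> \<Omega>" using that sub by blast
    show ?thesis
      unfolding X_def[abs_def] G_def[abs_def]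
      by (rule has_partials_sum, rule has_partials_mult[OF partials_newton[OF x] pZ[OF x]])
  qed
  have cP: "continuous_on (ball y 1) ?P0" "continuous_on (ball y 1) ?P1" "continuous_on (ball y 1) ?P2"
  proof -
    show "continuous_on (ball y 1) ?P0" "continuous_on (ball y 1) ?P1"
      by (rule continuous_at_imp_continuous_on, rule ballI,
          (rule has_partials_continuous[OF p0] | rule has_partials_continuous[OF p1]), use sub in blast)+
    show "continuous_on (ball y 1) ?P2"
      by (rule continuous_on_compose2[OF cutG2_cont[OF e] continuous_on_rho(1)[OF sub]]) (use r0 in auto)
  qed
  have if_cont: "continuous_on (ball y 1) (\<lambda>x. if i = j then t l x else 0)" for i j l :: 3
    using continuous_on_t[OF sub] by (cases "i = j") auto
  have cont: "continuous_on (ball y 1) (\<lambda>x. G i x i)" for i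
    unfolding G_def Z_def
    by (intro continuous_on_diff continuous_on_mult continuous_on_add continuous_on_sum
      if_cont cP continuous_on_t continuous_on_T continuous_on_W continuous_on_newton
      continuous_on_trace continuous_on_rho sub)
  have supp: "X i x = 0" if "x \<in> ball y 1" "x \<notin> cball y (1 / 2)" for i x
  proof -
    have "\<not> rho y x \<le> a" using rho_small_close[OF y a] that by blast
    then show ?thesis by (simp add: X_def Z_def cutG_def cutG1_def)
  qed
  have GD: "(\<Sum>i\<in>UNIV. G i x i) = D x" if "x \<in> ball y 1" for x
  proof -
    have x: "x \<in> \<Omega>" using that sub by blast
    show ?thesis
      unfolding G_def D_def Lrho_def Qrho_def Ltrace_def
      by (rule divergence_expansion[where N = "newton (A x)" and S = "\<lambda>i j k. T i j k x" and t = "\<lambda>j. t j x"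
          and r = "\<lambda>i. rho1 y i x" and R = "\<lambda>i j. rho2 y i j x" and W = "\<lambda>i j. W i j x" and Z = "\<lambda>j. Z j x"])
        (simp_all only: newton_commute[OF A_sym[OF x]] t_def)
  qed
  have half: "(1 / 2 :: real) < 1" by simp
  note div = divergence_compact_support[of "1 / 2" 1 y X G, OF half part cont supp]
  show "set_integrable lborel (ball y 1) D"
    using div(1) by (rule set_integrable_cong[THEN iffD1, rotated -1]) (use GD in auto)
  show "(LINT x:ball y 1|lborel. D x) = 0"
    using div(2) GD by (subst set_lebesgue_integral_cong[of _ _ D "\<lambda>x. \<Sum>i\<in>UNIV. G i x i"]) auto
qed

text \<open>The set is the image of a ball under the normalising matrix at \<open>y\<close>, on
  which the linearisation of Du at \<open>y\<close> controls \<rho>. Its size \<open>d\<close> comes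
  from differentiability and continuity at \<open>y\<close> alone and is not bounded below in terms
  of \<open>K\<close>.\<close>

lemma ellipsoid_in_sublevel:
  assumes y: "y \<in> cball 0 1" and a: "a > 0"
  obtains d S where "d > 0" "d\<^sup>2 \<le> a" "open S" "S \<subseteq> ball y 1"
    "measure lborel S = 4 / 3 * pi * d ^ 3 / vol (A y)"
    "\<And>x. x \<in> S \<Longrightarrow> rho y x \<le> d\<^sup>2"
    "\<And>x. x \<in> S \<Longrightarrow> trace (A y) * vol (A y) / 2 \<le> trace (A x) * vol (A x)"
proof -
  have y': "y \<in> \<Omega>" using y by simp
  let ?c = "f (jet u y)" and ?V = "vol (A y)" and ?w = "trace (A y)"
  have c: "1 / K \<le> ?c" "?c > 0" "?c = sig2 (A y)"
    using f_bounds(1)[OF jet_in[OF y']] K eq[OF y'] by (auto simp: less_le_trans[of 0 "1 / K"])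
  have V: "?V > 0" by (rule vol_pos[OF y'])
  have w: "?w > 0" by (rule trace_pos[OF y'])
  obtain M where M': "\<bar>det M\<bar> = 1 / ?V"
    "\<And>x. sig2 (A y) * (norm (M *v x))\<^sup>2 + (norm (A y *v (M *v x)))\<^sup>2 = (norm x)\<^sup>2"
    by (rule metric_normalization[OF A_sym[OF y'] trace_pos[OF y'] sig2_pos[OF y']], rule that; assumption)
  note M = M'[folded c(3)]
  \<comment> \<open>Splitting each of the three squared slope differences doubles the squared
    remainder, so the total error is 6 \<theta>^2 |\<xi>|^2. It equals the displacement term, so 2
    \<rho> is at most twice the normalised form.\<close>
  define \<theta> where "\<theta> = sqrt (?c / 6)"
  have \<theta>: "\<theta> > 0" "6 * \<theta>\<^sup>2 = ?c" using c(2) by (auto simp: \<theta>_def)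
  have "\<exists>d>0. \<forall>x. norm (x - y) < d \<longrightarrow> \<bar>pd k u x - pd k u y - (A y *v (x - y)) $ k\<bar> \<le> \<theta> * norm (x - y)" for k
  proof -
    have "has_partials (pd k u) (\<lambda>i. A y $ i $ k) y"
      unfolding A_nth by (intro smooth_partials smooth_on_pd u y')
    moreover have "(\<Sum>i\<in>UNIV. A y $ i $ k * h $ i) = (A y *v h) $ k" for h
    proof -
      have "A y $ i $ k = A y $ k $ i" for i
        unfolding A_nth by (rule smooth_on_pd_commute[OF u open_ball y'])
      then show ?thesis by (simp add: matrix_vector_mult_def)
    qed
    ultimately have "(pd k u has_derivative (\<lambda>h. (A y *v h) $ k)) (at y)"
      by (simp add: has_partials_def)
    then have "\<forall>e>0. \<exists>d>0. \<forall>x. norm (x - y) < d \<longrightarrow>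
        norm (pd k u x - pd k u y - (A y *v (x - y)) $ k) \<le> e * norm (x - y)"
      unfolding has_derivative_at_alt by (rule conjunct2)
    from this[rule_format, OF \<theta>(1)] show ?thesis by (simp only: real_norm_def)
  qed
  then have "\<exists>dk. \<forall>k. dk k > 0 \<and> (\<forall>x. norm (x - y) < dk k \<longrightarrow>
      \<bar>pd k u x - pd k u y - (A y *v (x - y)) $ k\<bar> \<le> \<theta> * norm (x - y))"
    by (intro choice allI)
  then obtain dk where dk: "\<And>k. dk k > 0"
    "\<And>k x. norm (x - y) < dk k \<Longrightarrow> \<bar>pd k u x - pd k u y - (A y *v (x - y)) $ k\<bar> \<le> \<theta> * norm (x - y)"
    by blast
  have "continuous (at y) (\<lambda>x. trace (A x) * vol (A x))"
    by (rule continuous_on_interior[of \<Omega>])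
      (use y' in \<open>auto intro!: continuous_on_mult continuous_on_trace continuous_on_vol\<close>)
  moreover have "?w * ?V / 2 > 0" using w V by simp
  ultimately obtain d0 where d0: "d0 > 0"
    "\<And>x. dist x y < d0 \<Longrightarrow> dist (trace (A x) * vol (A x)) (?w * ?V) < ?w * ?V / 2"
    unfolding continuous_at_eps_delta by blast
  define m where "m = Min (insert 1 (insert d0 (range dk)))"
  have m: "m > 0" "m \<le> 1" "m \<le> d0" "\<And>k. m \<le> dk k"
  proof -
    have "m \<le> v" if "v \<in> insert 1 (insert d0 (range dk))" for v
      unfolding m_def using that by (intro Min_le) auto
    then show "m \<le> 1" "m \<le> d0" "\<And>k. m \<le> dk k" by auto
    show "m > 0" unfolding m_def using d0(1) dk(1) by (subst Min_gr_iff) auto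
  qed
  define d where "d = min (m / (2 * K)) (sqrt a)"
  have d: "d > 0" "K * d < m" "d\<^sup>2 \<le> a"
  proof -
    show "d > 0" using m K a by (simp add: d_def)
    have "K * d \<le> K * (m / (2 * K))" using K by (intro mult_left_mono) (auto simp: d_def)
    also have "\<dots> < m" using K m by simp
    finally show "K * d < m" .
    have "d\<^sup>2 \<le> (sqrt a)\<^sup>2" using \<open>d > 0\<close> by (intro power_mono) (auto simp: d_def)
    then show "d\<^sup>2 \<le> a" using a by simp
  qed
  define S where "S = (\<lambda>h. y + M *v h) ` ball 0 d"
  have S: "norm (x - y) < m \<and> rho y x \<le> d\<^sup>2" if xS: "x \<in> S" for x
  proof -
    obtain h where h: "x = y + M *v h" "norm h < d" using xS by (auto simp: S_def)
    let ?\<xi> = "M *v h"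
    have \<xi>: "x - y = ?\<xi>" using h by simp
    have h2: "(norm h)\<^sup>2 \<le> d\<^sup>2" using h by (intro power_mono) auto
    have "1 / K * (norm ?\<xi>)\<^sup>2 \<le> ?c * (norm ?\<xi>)\<^sup>2" using c by (intro mult_right_mono) auto
    also have "\<dots> \<le> d\<^sup>2" using M(2)[of h] h2 zero_le_power2[of "norm (A y *v ?\<xi>)"] by linarith
    finally have "(norm ?\<xi>)\<^sup>2 \<le> K * d\<^sup>2" using K by (simp add: field_simps)
    also have "\<dots> \<le> K\<^sup>2 * d\<^sup>2" using K by (intro mult_right_mono) (auto simp: power2_eq_square)
    finally have "(norm ?\<xi>)\<^sup>2 \<le> (K * d)\<^sup>2" by (simp add: power_mult_distrib)
    then have "norm ?\<xi> \<le> K * d" by (rule power2_le_imp_le) (use K d in auto)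
    then have n: "norm (x - y) < m" using d \<xi> by simp
    have q: "(pd k u x - pd k u y)\<^sup>2 \<le> 2 * ((A y *v ?\<xi>) $ k)\<^sup>2 + 2 * (\<theta>\<^sup>2 * (norm ?\<xi>)\<^sup>2)" for k
    proof -
      define b where "b = pd k u x - pd k u y - (A y *v ?\<xi>) $ k"
      have "\<bar>b\<bar> \<le> \<theta> * norm ?\<xi>"
        using dk(2)[of x k] n m(4)[of k] unfolding \<xi> b_def by simp
      then have "\<bar>b\<bar>\<^sup>2 \<le> (\<theta> * norm ?\<xi>)\<^sup>2" by (intro power_mono) auto
      then have "b\<^sup>2 \<le> \<theta>\<^sup>2 * (norm ?\<xi>)\<^sup>2" by (simp add: power_mult_distrib)
      moreover have "((A y *v ?\<xi>) $ k + b)\<^sup>2 \<le> 2 * ((A y *v ?\<xi>) $ k)\<^sup>2 + 2 * b\<^sup>2"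
        using sum_squares_bound[of "(A y *v ?\<xi>) $ k" b] by (simp add: power2_sum)
      moreover have "pd k u x - pd k u y = (A y *v ?\<xi>) $ k + b" by (simp add: b_def)
      ultimately show ?thesis by simp
    qed
    have "2 * rho y x = ?c * (norm (x - y))\<^sup>2 + (\<Sum>k\<in>UNIV. (pd k u x - pd k u y)\<^sup>2)"
      by (simp add: rho_def norm_vec_def L2_set_def sum_nonneg)
    also have "\<dots> \<le> ?c * (norm ?\<xi>)\<^sup>2 + (\<Sum>k\<in>UNIV. 2 * ((A y *v ?\<xi>) $ k)\<^sup>2 + 2 * (\<theta>\<^sup>2 * (norm ?\<xi>)\<^sup>2))"
      unfolding \<xi> by (intro add_left_mono sum_mono q)
    also have "\<dots> = ?c * (norm ?\<xi>)\<^sup>2 + 2 * (norm (A y *v ?\<xi>))\<^sup>2 + 6 * \<theta>\<^sup>2 * (norm ?\<xi>)\<^sup>2"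
      by (simp add: sum.distrib norm_vec_def[of "A y *v ?\<xi>"] L2_set_def sum_nonneg flip: sum_distrib_left)
    also have "\<dots> = 2 * (norm h)\<^sup>2"
      unfolding \<theta>(2) M(2)[of h, symmetric] by simp
    finally have "rho y x \<le> (norm h)\<^sup>2" by simp
    with h2 n show ?thesis by simp
  qed
  show ?thesis
  proof (rule that[OF d(1,3)])
    have dM: "det M \<noteq> 0" using M(1) V by auto
    show "open S" unfolding S_def by (rule measure_affine_ball_image[OF dM d(1)])
    show "measure lborel S = 4 / 3 * pi * d ^ 3 / vol (A y)"
      unfolding S_def measure_affine_ball_image(2)[OF dM d(1)] M(1) by simp
    show "S \<subseteq> ball y 1"
      using S m by (force simp: dist_norm norm_minus_commute)
    show "rho y x \<le> d\<^sup>2" if "x \<in> S" for x using S[OF that] by simp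
    show "?w * ?V / 2 \<le> trace (A x) * vol (A x)" if "x \<in> S" for x
    proof -
      have "dist x y < d0" using S[OF that] m by (simp add: dist_norm)
      from d0(2)[OF this] show ?thesis unfolding dist_real_def by linarith
    qed
  qed
qed

lemma mean_value_inequality:
  assumes y: "y \<in> cball 0 1"
  defines "C \<equiv> 3600 * K ^ 8"
  defines "a \<equiv> 1 / (400 * C\<^sup>2)"
  shows "trace (A y) \<le> 8 * cut_error C a / pi * (LINT x:ball y 1|lborel. trace (A x) * vol (A x))"
proof -
  have y': "y \<in> \<Omega>" using y by simp
  note sub = ball_subset[OF y]
  let ?E = "cut_error C a" and ?wV = "\<lambda>x. trace (A x) * vol (A x)"
  \<comment> \<open>The constant of \<open>trace_subsolution\<close> also dominates those of
    \<open>rho_operator\<close> and \<open>rho_gradient\<close>.\<close>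
  have CK: "C \<ge> 1" "50 * K ^ 4 \<le> C" "27 * K ^ 4 \<le> C" "K \<le> C"
    using K_pow[of 8] power_increasing[of 4 8 K] power_increasing[of 1 8 K] K by (auto simp: C_def)
  have a: "a > 0" "8 * K * a \<le> 1"
  proof -
    show "a > 0" using CK by (simp add: a_def)
    have "8 * K \<le> 400 * C\<^sup>2"
      using CK K mult_mono[of 1 C K C] by (simp add: power2_eq_square)
    then show "8 * K * a \<le> 1" using CK by (simp add: a_def field_simps)
  qed
  obtain d S where d: "d > 0" "d\<^sup>2 \<le> a" and S: "open S" "S \<subseteq> ball y 1"
    "measure lborel S = 4 / 3 * pi * d ^ 3 / vol (A y)"
    "\<And>x. x \<in> S \<Longrightarrow> rho y x \<le> d\<^sup>2"
    "\<And>x. x \<in> S \<Longrightarrow> ?wV y / 2 \<le> ?wV x"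
    by (rule ellipsoid_in_sublevel[OF y a(1)], rule that; assumption)
  \<comment> \<open>Matches the regularisation to the ellipsoid: on \<open>S\<close> one has 2 s + e
    \<le> (2 d)^2, so z^10 is at least 1 / (32 d^5) and the gain 3 e z^10 at least 3 / (16
    d^3).\<close>
  define e where "e = 2 * d\<^sup>2"
  have e: "e > 0" "e \<le> 2 * a" using d by (auto simp: e_def)
  define D where "D x = trace (A x) * (cutG1 (64 * C) e a (rho y x) * Lrho y x + cutG2 (64 * C) e a (rho y x) * Qrho y x)
    - cutG (64 * C) e a (rho y x) * Ltrace x" for x
  \<comment> \<open>That gain times half the value of the integrand at \<open>y\<close>. Multiplied
    by the measure of \<open>S\<close>, both \<open>d\<close> and \<open>vol (A y)\<close> cancel
    and pi / 8 times the trace at \<open>y\<close> is left.\<close>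
  define \<kappa> where "\<kappa> = 3 / 32 / d ^ 3 * ?wV y"
  have E0: "?E \<ge> 0"
    unfolding cut_error_def using CK a zz_pos[of a 0] by simp
  have pos: "trace (A x) > 0" "vol (A x) > 0" if "x \<in> ball y 1" for x
    using that sub trace_pos vol_pos by auto
  have bound: "D x \<le> ?E * ?wV x - indicator S x * \<kappa>" if x: "x \<in> ball y 1" for x
  proof -
    have x': "x \<in> \<Omega>" using x sub by blast
    define s where "s = rho y x"
    have s0: "s \<ge> 0" unfolding s_def by (rule rho_nonneg[OF y'])
    have w: "trace (A x) > 0" and V: "vol (A x) > 0" using pos[OF x] .
    have B: "64 * C \<ge> 0" using CK by simp
    have r: "sqrt (2 * s) \<ge> 0" using s0 by simp
    show ?thesis
    proof (cases "s \<le> a")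
      case False
      then have "D x = 0" by (simp add: D_def cutG_def cutG1_def cutG2_def flip: s_def)
      moreover have "x \<notin> S" using S(4)[of x] d False by (auto simp: s_def)
      ultimately show ?thesis using E0 w V by simp
    next
      case True
      have L: "(3 - C * sqrt (2 * s)) * vol (A x) \<le> Lrho y x"
      proof -
        have "50 * K ^ 4 * sqrt (2 * s) * vol (A x) \<le> C * sqrt (2 * s) * vol (A x)"
          using CK r V by (intro mult_right_mono) auto
        then show ?thesis
          using rho_operator[OF x' y'] by (simp add: Lrho_def s_def algebra_simps abs_le_iff)
      qed
      have Q: "Qrho y x \<le> (1 + C * sqrt (2 * s)) * vol (A x) * (2 * s)"
      proof -
        have "Qrho y x \<le> (1 + 27 * K ^ 4 * sqrt (2 * s)) * vol (A x) * (2 * s)"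
          unfolding Qrho_def s_def by (rule rho_gradient[OF x' y'])
        also have "\<dots> \<le> (1 + C * sqrt (2 * s)) * vol (A x) * (2 * s)"
          using CK r V s0 by (intro mult_right_mono add_left_mono) auto
        finally show ?thesis .
      qed
      have super: "cutG1 (64 * C) e a s * Lrho y x + cutG2 (64 * C) e a s * Qrho y x + C * cutG (64 * C) e a s * vol (A x)
          \<le> (?E - 3 * e * zz e s ^ 10) * vol (A x)"
        by (rule cutG_supersolution[OF CK(1) a(1) _ e s0 True _ L Q]) (use V in \<open>auto simp: a_def\<close>)
      have "- (C * trace (A x) * vol (A x)) \<le> Ltrace x"
        unfolding C_def Ltrace_def by (rule trace_subsolution[OF x'])
      then have "cutG (64 * C) e a s * - (C * trace (A x) * vol (A x)) \<le> cutG (64 * C) e a s * Ltrace x"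
        by (intro mult_left_mono cutG_nonneg[OF B e(1) s0])
      then have "D x \<le> trace (A x) * (cutG1 (64 * C) e a s * Lrho y x + cutG2 (64 * C) e a s * Qrho y x + C * cutG (64 * C) e a s * vol (A x))"
        by (simp add: D_def s_def algebra_simps)
      also have "\<dots> \<le> trace (A x) * ((?E - 3 * e * zz e s ^ 10) * vol (A x))"
        using super w by (intro mult_left_mono) auto
      also have "\<dots> = ?E * ?wV x - 3 * e * zz e s ^ 10 * ?wV x"
        by (simp add: algebra_simps)
      finally have D: "D x \<le> ?E * ?wV x - 3 * e * zz e s ^ 10 * ?wV x" .
      have "indicator S x * \<kappa> \<le> 3 * e * zz e s ^ 10 * ?wV x"
      proof (cases "x \<in> S")
        case False
        then show ?thesis using e w V zz_pos[of s e] s0 by simp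
      next
        case xS: True
        define z where "z = zz e s"
        have p: "2 * s + e > 0" using s0 e by simp
        have z: "z > 0" "z ^ 4 * (2 * s + e) = 1"
          using zz_pos[OF p] zz_pow4[OF p] by (auto simp: z_def)
        have "2 * s + e \<le> (2 * d)\<^sup>2"
          using S(4)[OF xS] by (simp add: s_def e_def power2_eq_square)
        then have "z ^ 4 * (2 * s + e) \<le> z ^ 4 * (2 * d)\<^sup>2"
          using z by (intro mult_left_mono) auto
        then have "1\<^sup>2 \<le> (z\<^sup>2 * (2 * d))\<^sup>2"
          unfolding z(2) by (simp add: power_mult_distrib)
        then have "1 \<le> z\<^sup>2 * (2 * d)"
          by (rule power2_le_imp_le) (use d z in auto)
        then have "1 \<le> (z\<^sup>2 * (2 * d)) ^ 5" by (rule one_le_power)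
        then have "1 \<le> z ^ 10 * (32 * d ^ 5)" by (simp add: power_mult_distrib)
        then have "3 / 16 / d ^ 3 * 1 \<le> 3 / 16 / d ^ 3 * (z ^ 10 * (32 * d ^ 5))"
          using d by (intro mult_left_mono) auto
        also have "\<dots> = 3 * e * z ^ 10"
          using d by (simp add: e_def numeral_eq_Suc)
        finally have "3 / 16 / d ^ 3 * (?wV y / 2) \<le> 3 * e * z ^ 10 * ?wV x"
          using S(5)[OF xS] d e z w V pos[of y] by (intro mult_mono) auto
        then show ?thesis using xS by (simp add: \<kappa>_def z_def)
      qed
      then show ?thesis using D by linarith
    qed
  qed
  have int: "set_integrable lborel (ball y 1) ?wV"
  proof (rule set_integrable_subset[of _ "cball y 1"])
    have "cball y 1 \<subseteq> \<Omega>"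
    proof
      fix x assume "x \<in> cball y 1"
      then show "x \<in> \<Omega>" using y norm_triangle_ineq2[of x y] by (simp add: dist_norm norm_minus_commute)
    qed
    then show "set_integrable lborel (cball y 1) ?wV"
      unfolding set_integrable_def
      by (intro borel_integrable_compact continuous_on_mult continuous_on_trace continuous_on_vol) auto
  qed auto
  have intS: "set_integrable lborel (ball y 1) (\<lambda>x. indicator S x * \<kappa>)"
    and valS: "(LINT x:ball y 1|lborel. indicator S x * \<kappa>) = \<kappa> * measure lborel S"
  proof -
    have fin: "emeasure lborel S < \<infinity>"
      by (rule emeasure_bounded_finite[OF bounded_subset[OF bounded_ball S(2)]])
    have eq': "indicator (ball y 1) x *\<^sub>R (indicator S x * \<kappa>) = \<kappa> * indicator S x" for x
      using S(2) by (auto simp: indicator_def)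
    have "integrable lborel (\<lambda>x. \<kappa> * indicator S x :: real)"
      using S(1) fin by (intro integrable_mult_right integrable_real_indicator) auto
    then show "set_integrable lborel (ball y 1) (\<lambda>x. indicator S x * \<kappa>)"
      unfolding set_integrable_def eq' .
    show "(LINT x:ball y 1|lborel. indicator S x * \<kappa>) = \<kappa> * measure lborel S"
      unfolding set_lebesgue_integral_def eq' using S(1) by simp
  qed
  note green = green_identity[OF y e(1) a(2), of "64 * C", folded D_def]
  have "0 = (LINT x:ball y 1|lborel. D x)"
    using green(2) by simp
  also have "\<dots> \<le> (LINT x:ball y 1|lborel. ?E * ?wV x - indicator S x * \<kappa>)"
    using green(1) int intS bound by (intro set_integral_mono set_integral_diff) auto
  also have "\<dots> = ?E * (LINT x:ball y 1|lborel. ?wV x) - \<kappa> * measure lborel S"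
    by (subst set_integral_diff(2)) (use int intS in \<open>simp_all only: set_integrable_mult_right set_integral_mult_right valS\<close>)
  finally have "\<kappa> * measure lborel S \<le> ?E * (LINT x:ball y 1|lborel. ?wV x)" by simp
  moreover have "\<kappa> * measure lborel S = pi / 8 * trace (A y)"
    unfolding S(3) \<kappa>_def using d vol_pos[OF y'] by (simp add: field_simps)
  ultimately show ?thesis by (simp add: field_simps)
qed

end

section \<open>From the norms to pointwise bounds, and the conclusion\<close>

lemma sup_norm_nonneg: "S \<noteq> {} \<Longrightarrow> 0 \<le> sup_norm S g"
  unfolding sup_norm_def by (meson SUP_upper2 abs_ge_zero ereal_less_eq(5) ex_in_conv)

lemma sup_norm_le_iff: "sup_norm S g \<le> ereal K \<longleftrightarrow> (\<forall>x\<in>S. \<bar>g x\<bar> \<le> K)"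
  by (simp add: sup_norm_def SUP_le_iff)

lemma C2_norm_le:
  fixes S :: "'a::euclidean_space set"
  assumes S: "S \<noteq> {}" and g: "C2_norm S g \<le> ereal K" and bc: "b \<in> Basis" "c \<in> Basis" and x: "x \<in> S"
  shows "\<bar>g x\<bar> \<le> K" "\<bar>dderiv b g x\<bar> \<le> K" "\<bar>dderiv c (dderiv b g) x\<bar> \<le> K"
proof -
  let ?B = "\<Sum>b\<in>Basis. sup_norm S (dderiv b g)"
  let ?D = "\<Sum>c\<in>Basis. \<Sum>b\<in>Basis. sup_norm S (dderiv c (dderiv b g))"
  note n = sup_norm_nonneg[OF S]
  have mem: "h b \<le> sum h Basis" if "b \<in> Basis" "\<And>b. h b \<ge> 0" for h :: "'a \<Rightarrow> ereal" and b
    using sum_mono2[of Basis "{b}" h] that by simp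
  have D0: "?D \<ge> 0" "?B \<ge> 0" by (intro sum_nonneg n)+
  have le: "sup_norm S g + ?B + ?D \<le> ereal K" using g by (simp add: C2_norm_def)
  have "sup_norm S g \<le> sup_norm S g + ?B + ?D"
    using D0 by (simp add: add_increasing2 add.assoc)
  then have 1: "sup_norm S g \<le> ereal K" using le by (rule order_trans)
  have "?B \<le> sup_norm S g + ?B + ?D"
    using D0 n[of g] by (simp add: add_increasing add_increasing2)
  moreover have "sup_norm S (dderiv b g) \<le> ?B"
    by (rule mem[OF bc(1) n])
  ultimately have 2: "sup_norm S (dderiv b g) \<le> ereal K" using le by (meson order_trans)
  have "?D \<le> sup_norm S g + ?B + ?D"
    using D0 n[of g] by (intro add_increasing add_nonneg_nonneg) auto
  moreover have "sup_norm S (dderiv c (dderiv b g)) \<le> (\<Sum>b\<in>Basis. sup_norm S (dderiv c (dderiv b g)))"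
    by (rule mem[OF bc(1) n])
  moreover have "\<dots> \<le> ?D"
    by (rule mem[OF bc(2) sum_nonneg[OF n]])
  ultimately have 3: "sup_norm S (dderiv c (dderiv b g)) \<le> ereal K" using le by (meson order_trans)
  show "\<bar>g x\<bar> \<le> K" "\<bar>dderiv b g x\<bar> \<le> K" "\<bar>dderiv c (dderiv b g) x\<bar> \<le> K"
    using 1 2 3 x unfolding sup_norm_le_iff by blast+
qed

text \<open>Replacing \<open>K\<close> by \<open>max K 1\<close> preserves the bounds and supplies
  the normalisation; the bound on 1/f becomes the lower bound for f, and admissibility the
  positivity of the trace.\<close>

lemma sigma2_pdeI:
  fixes f :: "(real ^ 3) \<times> real \<times> (real ^ 3) \<Rightarrow> real" and u :: "real ^ 3 \<Rightarrow> real"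
  assumes f: "\<forall>z \<in> ball 0 10 \<times> UNIV. f z > 0" "Ck_on 2 (ball 0 10 \<times> UNIV) f"
    and u: "admissible_on (ball 0 10) u" "sigma2_solution_on (ball 0 10) f u"
    and norms: "C2_norm (ball 0 10 \<times> UNIV) f \<le> ereal K"
      "sup_norm (ball 0 10 \<times> UNIV) (\<lambda>z. 1 / f z) \<le> ereal K" "C1_norm (ball 0 10) u \<le> ereal K"
  shows "sigma2_pde (max K 1) f u"
proof -
  let ?S = "ball (0 :: real ^ 3) 10 \<times> (UNIV :: (real \<times> (real ^ 3)) set)"
  have S: "open ?S" by (intro open_Times) auto
  have ne: "?S \<noteq> {}" by (auto intro: exI[of _ 0])
  have adm: "transpose (hessian u x) = hessian u x" "sigma_k 1 (hessian u x) > 0" if "x \<in> ball 0 10" for x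
    using u(1) that by (auto simp: admissible_on_def Gamma2_def)
  have C2: "f differentiable_on ?S" "\<And>b. b \<in> Basis \<Longrightarrow> dderiv b f differentiable_on ?S"
    using f(2) by (auto simp: numeral_2_eq_2)
  note b = C2_norm_le[OF ne norms(1)]
  show ?thesis
  proof
    show "smooth_on (ball 0 10) u" using u(1) by (simp add: admissible_on_def)
    show "trace (hessian u x) > 0" if "x \<in> ball 0 10" for x
      using adm[OF that] sigma_k_symmetric_3(1)[OF adm(1)[OF that]] by simp
    show "sig2 (hessian u x) = f (jet u x)" if "x \<in> ball 0 10" for x
      using u(2) that sigma_k_symmetric_3(2)[OF adm(1)[OF that]] by (simp add: sig2_def sigma2_solution_on_def)
    show "1 / max K 1 \<le> f z" if z: "z \<in> ?S" for z
    proof -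
      have "f z > 0" using f(1) z by blast
      moreover have "1 / f z \<le> max K 1"
        using norms(2) z unfolding sup_norm_le_iff by (meson abs_le_D1 max.coboundedI1)
      ultimately show ?thesis by (simp add: field_simps)
    qed
    show "f z \<le> max K 1" if "z \<in> ?S" for z
      using b(1)[OF jet_basis(2) jet_basis(2) that] by linarith
    show "f differentiable (at z)" if "z \<in> ?S" for z
      using C2(1) that unfolding differentiable_on_eq_differentiable_at[OF S] by blast
    show "dderiv b f differentiable (at z)" if "z \<in> ?S" "b \<in> Basis" for z b
      using C2(2)[OF that(2)] that unfolding differentiable_on_eq_differentiable_at[OF S] by blast
    show "\<bar>dderiv b f z\<bar> \<le> max K 1" if "z \<in> ?S" "b \<in> Basis" for z b
      using b(2)[OF that(2,2,1)] by linarith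
    show "\<bar>dderiv c (dderiv b f) z\<bar> \<le> max K 1" if "z \<in> ?S" "b \<in> Basis" "c \<in> Basis" for z b c
      using b(3)[OF that(2,3,1)] by linarith
    show "\<bar>pd i u x\<bar> \<le> max K 1" if "x \<in> ball 0 10" for x i
    proof -
      have "\<bar>u x\<bar> + norm (grad u x) \<le> K"
        using norms(3) that by (auto simp: C1_norm_def SUP_le_iff)
      moreover have "\<bar>pd i u x\<bar> \<le> norm (grad u x)"
        using component_le_norm_cart[of "grad u x" i] by (simp add: grad_def)
      ultimately show ?thesis by linarith
    qed
  qed simp
qed

theorem theorem2:
  fixes K :: real
  assumes "K > 0"
  shows "\<exists>C::real. \<forall>(f :: (real ^ 3) \<times> real \<times> (real ^ 3) \<Rightarrow> real) (u :: real ^ 3 \<Rightarrow> real) (y0 :: real ^ 3).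
    (\<forall>z \<in> ball 0 10 \<times> UNIV. f z > 0) \<and>
    Ck_on 2 (ball 0 10 \<times> UNIV) f \<and>
    admissible_on (ball 0 10) u \<and>
    sigma2_solution_on (ball 0 10) f u \<and>
    C2_norm (ball 0 10 \<times> UNIV) f \<le> ereal K \<and>
    sup_norm (ball 0 10 \<times> UNIV) (\<lambda>z. 1 / f z) \<le> ereal K \<and>
    C1_norm (ball 0 10) u \<le> ereal K \<and>
    y0 \<in> closure (ball 0 1) \<and>
    sigma_k 1 (hessian u y0) = (SUP x\<in>ball 0 1. sigma_k 1 (hessian u x))
    \<longrightarrow>
    (SUP x\<in>ball 0 1. sigma_k 1 (hessian u x)) = sigma_k 1 (hessian u y0) \<and>
    sigma_k 1 (hessian u y0) \<le>
      C * (LINT x:ball y0 1|lborel. sigma_k 1 (hessian u x) *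
        (sigma_k 1 (hessian u x) * f (x, u x, grad u x) - sigma_k 3 (hessian u x)))"
proof -
  let ?C = "3600 * max K 1 ^ 8"
  let ?c = "8 * cut_error ?C (1 / (400 * ?C\<^sup>2)) / pi"
  show ?thesis
  proof (intro exI[of _ ?c] allI impI, elim conjE, intro conjI)
    fix f :: "(real ^ 3) \<times> real \<times> (real ^ 3) \<Rightarrow> real" and u :: "real ^ 3 \<Rightarrow> real" and y0 :: "real ^ 3"
    assume hyps: "\<forall>z \<in> ball 0 10 \<times> UNIV. f z > 0" "Ck_on 2 (ball 0 10 \<times> UNIV) f"
      "admissible_on (ball 0 10) u" "sigma2_solution_on (ball 0 10) f u"
      "C2_norm (ball 0 10 \<times> UNIV) f \<le> ereal K" "sup_norm (ball 0 10 \<times> UNIV) (\<lambda>z. 1 / f z) \<le> ereal K"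
      "C1_norm (ball 0 10) u \<le> ereal K"
      and "y0 \<in> closure (ball 0 1)"
      and sup: "sigma_k 1 (hessian u y0) = (SUP x\<in>ball 0 1. sigma_k 1 (hessian u x))"
    show "(SUP x\<in>ball 0 1. sigma_k 1 (hessian u x)) = sigma_k 1 (hessian u y0)"
      using sup by (rule sym)
    have y0: "y0 \<in> cball 0 1" using \<open>y0 \<in> closure (ball 0 1)\<close> by simp
    interpret sigma2_pde "max K 1" f u
      by (rule sigma2_pdeI[OF hyps])
    have "trace (A x) = sigma_k 1 (A x)" "vol (A x) = sigma_k 1 (A x) * f (jet u x) - sigma_k 3 (A x)"
      if "x \<in> \<Omega>" for x
      using sigma_k_symmetric_3[OF A_sym[OF that]] eq[OF that] by (simp_all add: vol_def)
    note sigma = this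
    have "(LINT x:ball y0 1|lborel. trace (A x) * vol (A x)) =
        (LINT x:ball y0 1|lborel. sigma_k 1 (A x) * (sigma_k 1 (A x) * f (jet u x) - sigma_k 3 (A x)))"
      using ball_subset[OF y0] by (intro set_lebesgue_integral_cong) (auto simp: sigma subset_iff)
    with mean_value_inequality[OF y0]
    show "sigma_k 1 (hessian u y0) \<le> ?c * (LINT x:ball y0 1|lborel. sigma_k 1 (hessian u x) *
        (sigma_k 1 (hessian u x) * f (x, u x, grad u x) - sigma_k 3 (hessian u x)))"
      using y0 sigma(1)[of y0] by simp
  qed
qed

end
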